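(* For every $g\ge 2$ the map $\mathbb{P}grTh:\mathcal{A}_g^{4,8}\to \mathrm{Gr}_{\mathbb{C}}(g,2^{g-1}(2^g-1))$ is injective on tangent spaces, i.e. its differential is injective at every point of $\mathcal{A}_g^{4,8}$.
   Context: Let $g\ge 2$. $\mathcal{H}_g$ is the Siegel upper half-space of complex symmetric $g\times g$ matrices with positive definite imaginary part; $\Gamma_g=\mathrm{Sp}(2g,\mathbb{Z})$ acts on it by $\gamma\tau=(a\tau+b)(c\tau+d)^{-1}$ for $\gamma=\begin{pmatrix}a&b\\c&d\end{pmatrix}$. Put $\Gamma_g(n)=\{\gamma\in\Gamma_g:\gamma\equiv 1 \bmod n\}$, $\Gamma_g(n,2n)=\{\gamma\in\Gamma_g(n):\operatorname{diag}(a^tb)\equiv\operatorname{diag}(c^td)\equiv 0 \bmod 2n\}$ and $\mathcal{A}_g^{n,2n}=\mathcal{H}_g/\Gamma_g(n,2n)$. For $\varepsilon,\delta\in\mathbb{Z}_2^g$ (viewed as vectors of zeros and ones), $\tau\in\mathcal{H}_g$, $z\in\mathbb{C}^g$, the theta function with characteristic $[\varepsilon,\delta]$ is $$\theta[\varepsilon,\delta](\tau,z)=\sum_{m\in\mathbb{Z}^g}\exp \pi i\left[\left(m+\tfrac{\varepsilon}{2},\tau(m+\tfrac{\varepsilon}{2})\right)+2\left(m+\tfrac{\varepsilon}{2},z+\tfrac{\delta}{2}\right)\right].$$ The characteristic $[\varepsilon,\delta]$ is even or odd according to whether $\varepsilon\cdot\delta\in\mathbb{Z}_2$ is $0$ or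 $1$. There are $N=2^{g-1}(2^g-1)$ odd characteristics. For $\tau\in\mathcal{H}_g$, the $g\times N$ matrix $\left(\frac{\partial}{\partial z_i}\theta[\varepsilon,\delta](\tau,z)|_{z=0}\right)_{1\le i\le g,\ [\varepsilon,\delta]\text{ odd}}$ always has rank $g$; $\mathbb{P}grTh(\tau)\in\mathrm{Gr}_{\mathbb{C}}(g,N)$ is the $g$-dimensional subspace of $\mathbb{C}^N$ spanned by its $g$ rows. This subspace depends only on the class of $\tau$ modulo $\Gamma_g(4,8)$, so $\mathbb{P}grTh$ is a well-defined map on $\mathcal{A}_g^{4,8}$. *)

theory Defs
  imports "HOL-Analysis.Analysis"
begin

text \<open>The genus is \<^term>\<open>CARD('g)\<close> for a finite index type \<^typ>\<open>'g\<close>.\<close>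

section \<open>The Siegel upper half-space and its quotients\<close>

definition siegel_space :: "(complex^'g^'g) set" where
  "siegel_space = {\<tau>. transpose \<tau> = \<tau> \<and>
     (\<forall>x::real^'g. x \<noteq> 0 \<longrightarrow> 0 < x \<bullet> ((\<chi> i j. Im (\<tau> $ i $ j)) *v x))}"

text \<open>Matrices of size \<open>2g\<close> are indexed by \<open>'g + 'g\<close>; their blocks are \<open>g \<times> g\<close> matrices.\<close>

definition blk_a :: "int^('g::finite+'g)^('g+'g) \<Rightarrow> int^'g^'g" where
  "blk_a \<gamma> = (\<chi> i j. \<gamma> $ Inl i $ Inl j)"

definition blk_b :: "int^('g::finite+'g)^('g+'g) \<Rightarrow> int^'g^'g" where
  "blk_b \<gamma> = (\<chi> i j. \<gamma> $ Inl i $ Inr j)"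

definition blk_c :: "int^('g::finite+'g)^('g+'g) \<Rightarrow> int^'g^'g" where
  "blk_c \<gamma> = (\<chi> i j. \<gamma> $ Inr i $ Inl j)"

definition blk_d :: "int^('g::finite+'g)^('g+'g) \<Rightarrow> int^'g^'g" where
  "blk_d \<gamma> = (\<chi> i j. \<gamma> $ Inr i $ Inr j)"

definition symplectic_form :: "int^('g::finite+'g)^('g+'g)" where
  "symplectic_form = (\<chi> i j. case (i, j) of
      (Inl k, Inr l) \<Rightarrow> (if k = l then 1 else 0)
    | (Inr k, Inl l) \<Rightarrow> (if k = l then -1 else 0)
    | _ \<Rightarrow> 0)"

definition Sp_int :: "(int^('g::finite+'g)^('g+'g)) set" where
  "Sp_int = {\<gamma>. transpose \<gamma> ** symplectic_form ** \<gamma> = symplectic_form}"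

definition Gamma :: "int \<Rightarrow> (int^('g::finite+'g)^('g+'g)) set" where
  "Gamma n = {\<gamma> \<in> Sp_int. \<forall>i j. n dvd (\<gamma> - mat 1) $ i $ j}"

text \<open>This is \<open>\<Gamma>(n, 2n)\<close>; the diagonals are those of \<open>a \<cdot> transpose b\<close> and
  \<open>c \<cdot> transpose d\<close>, which are symmetric for symplectic matrices.\<close>

definition Gamma2 :: "int \<Rightarrow> (int^('g::finite+'g)^('g+'g)) set" where
  "Gamma2 n = {\<gamma> \<in> Gamma n. \<forall>i.
     2 * n dvd (blk_a \<gamma> ** transpose (blk_b \<gamma>)) $ i $ i \<and>
     2 * n dvd (blk_c \<gamma> ** transpose (blk_d \<gamma>)) $ i $ i}"

definition cmat :: "int^'g^'g \<Rightarrow> complex^'g^'g" where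
  "cmat a = (\<chi> i j. of_int (a $ i $ j))"

definition siegel_act :: "int^('g::finite+'g)^('g+'g) \<Rightarrow> complex^'g^'g \<Rightarrow> complex^'g^'g" where
  "siegel_act \<gamma> \<tau> = (cmat (blk_a \<gamma>) ** \<tau> + cmat (blk_b \<gamma>)) **
     matrix_inv (cmat (blk_c \<gamma>) ** \<tau> + cmat (blk_d \<gamma>))"

definition siegel_rel :: "int \<Rightarrow> ((complex^'g^'g) \<times> (complex^'g^'g)) set" where
  "siegel_rel n = {(\<tau>, \<tau>'). \<tau> \<in> siegel_space \<and> (\<exists>\<gamma> \<in> Gamma2 n. \<tau>' = siegel_act \<gamma> \<tau>)}"

definition siegel_class :: "int \<Rightarrow> complex^'g^'g \<Rightarrow> (complex^'g^'g) set" where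
  "siegel_class n \<tau> = siegel_rel n `` {\<tau>}"

definition siegel_quotient :: "int \<Rightarrow> (complex^'g^'g) set set" where
  "siegel_quotient n = siegel_space // siegel_rel n"


section \<open>Theta functions with characteristics\<close>

text \<open>A characteristic is a pair of vectors over the field with two elements; \<^const>\<open>of_bool\<close>
  gives their representatives with entries zero and one.\<close>

definition half_char :: "bool^'g \<Rightarrow> complex^'g" where
  "half_char \<epsilon> = (\<chi> i. of_bool (\<epsilon> $ i) / 2)"

text \<open>The inner product of the library is not complex bilinear, hence:\<close>

definition cbil :: "complex^'g \<Rightarrow> complex^'g \<Rightarrow> complex" where
  "cbil x y = (\<Sum>i\<in>UNIV. x $ i * y $ i)"

definition theta :: "bool^'g \<Rightarrow> bool^'g \<Rightarrow> complex^'g^'g \<Rightarrow> complex^'g \<Rightarrow> complex" where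
  "theta \<epsilon> \<delta> \<tau> z = (\<Sum>\<^sub>\<infinity>m\<in>(UNIV :: (int^'g) set).
     let v = (\<chi> i. of_int (m $ i)) + half_char \<epsilon>
     in exp (pi * \<i> * (cbil v (\<tau> *v v) + 2 * cbil v (z + half_char \<delta>))))"

definition odd_pair :: "(bool^'g) \<times> (bool^'g) \<Rightarrow> bool" where
  "odd_pair m \<longleftrightarrow> odd (\<Sum>i\<in>UNIV. of_bool (fst m $ i) * of_bool (snd m $ i) :: nat)"

typedef ('g::finite) odd_char = "{m :: (bool^'g) \<times> (bool^'g). odd_pair m}"
proof -
  fix k :: 'g
  have "odd_pair (\<chi> i. i = k, \<chi> i. i = k)"
    by (simp add: odd_pair_def of_bool_def if_distrib cong: if_cong)
  then show ?thesis by blast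
qed

instance odd_char :: (finite) finite
proof
  have "finite (range (Rep_odd_char :: 'a odd_char \<Rightarrow> _))" by simp
  then show "finite (UNIV :: 'a odd_char set)"
    by (rule finite_imageD) (simp add: inj_on_def Rep_odd_char_inject)
qed

lemma card_odd_char:
  "CARD('g::finite odd_char) = 2 ^ (CARD('g) - 1) * (2 ^ CARD('g) - 1)"
proof -
  let ?O = "{m :: (bool^'g) \<times> (bool^'g). odd_pair m}"
  let ?E = "{m :: (bool^'g) \<times> (bool^'g). \<not> odd_pair m}"
  let ?s = "\<lambda>m :: (bool^'g) \<times> (bool^'g).
    \<Prod>i\<in>UNIV. (-1::int) ^ (of_bool (fst m $ i) * of_bool (snd m $ i))"
  have s: "?s m = (if odd_pair m then -1 else 1)" for m
    unfolding odd_pair_def by (simp add: power_sum [symmetric])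
  have card_eq: "CARD('g odd_char) = card ?O"
    using type_definition.card [OF type_definition_odd_char] by blast
  have "bij_betw (\<lambda>f :: 'g \<Rightarrow> bool \<times> bool. (\<chi> i. fst (f i), \<chi> i. snd (f i)))
      UNIV (UNIV :: ((bool^'g) \<times> (bool^'g)) set)"
    by (rule bij_betw_byWitness [where f' = "\<lambda>m i. (fst m $ i, snd m $ i)"]) auto
  then have "(\<Sum>m\<in>UNIV. ?s m) =
      (\<Sum>f\<in>(UNIV :: ('g \<Rightarrow> bool \<times> bool) set).
         \<Prod>i\<in>UNIV. (-1::int) ^ (of_bool (fst (f i)) * of_bool (snd (f i))))"
    by (subst sum.reindex_bij_betw [symmetric]) auto
  also have "\<dots> = (\<Prod>i\<in>(UNIV :: 'g set). \<Sum>p\<in>(UNIV :: (bool \<times> bool) set).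
      (-1::int) ^ (of_bool (fst p) * of_bool (snd p)))"
    by (subst prod_sum_PiE) auto
  also have "(\<Sum>p\<in>(UNIV :: (bool \<times> bool) set).
      (-1::int) ^ (of_bool (fst p) * of_bool (snd p))) = 2"
    by (simp add: UNIV_Times_UNIV [symmetric] UNIV_bool sum.cartesian_product [symmetric]
          del: UNIV_Times_UNIV)
  finally have sum: "(\<Sum>m\<in>UNIV. ?s m) = 2 ^ CARD('g)" by simp
  have "(\<Sum>m\<in>UNIV. ?s m) = (\<Sum>m\<in>?O \<union> ?E. ?s m)"
    by (rule sum.cong) auto
  also have "\<dots> = (\<Sum>m\<in>?O. ?s m) + (\<Sum>m\<in>?E. ?s m)"
    by (rule sum.union_disjoint) auto
  also have "\<dots> = int (card ?E) - int (card ?O)"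
    by (simp add: s)
  finally have diff: "int (card ?E) - int (card ?O) = 2 ^ CARD('g)"
    using sum by simp
  have "card ?O + card ?E = card (?O \<union> ?E)"
    by (rule card_Un_disjoint [symmetric]) auto
  also have "?O \<union> ?E = UNIV" by auto
  also have "card (UNIV :: ((bool^'g) \<times> (bool^'g)) set) = 2 ^ CARD('g) * 2 ^ CARD('g)"
    by simp
  finally have "int (card ?O + card ?E) = int (2 ^ CARD('g) * 2 ^ CARD('g))"
    by (rule arg_cong)
  then have all: "int (card ?O) + int (card ?E) = 2 ^ CARD('g) * 2 ^ CARD('g)"
    by simp
  obtain h where h: "CARD('g) = Suc h"
    using gr0_implies_Suc zero_less_card_finite by blast
  have "int (card ?O) = 2 ^ h * (2 ^ Suc h - 1)"
    using diff all unfolding h by (simp add: algebra_simps)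
  also have "\<dots> = int (2 ^ h * (2 ^ Suc h - 1))"
    by (simp add: of_nat_diff)
  finally show ?thesis
    unfolding card_eq h by (simp only: of_nat_eq_iff diff_Suc_1)
qed

definition theta_gradients :: "complex^'g^'g \<Rightarrow> complex^('g odd_char)^'g" where
  "theta_gradients \<tau> = (\<chi> i m. case Rep_odd_char m of (\<epsilon>, \<delta>) \<Rightarrow>
     deriv (\<lambda>w. theta \<epsilon> \<delta> \<tau> (axis i w)) 0)"


section \<open>The Grassmannian and the map \<open>\<P>grTh\<close>\<close>

definition grassmannian :: "nat \<Rightarrow> (complex^'n) set set" where
  "grassmannian k = {V. vec.subspace V \<and> vec.dim V = k}"

text \<open>The standard affine charts: a choice \<open>I\<close> of columns gives the chart of those subspaces that
  are the row space of a (necessarily unique) matrix whose columns chosen by \<open>I\<close> form the identity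
  matrix; the remaining entries of that matrix are the coordinates.\<close>

definition gr_normalized :: "('g::finite \<Rightarrow> 'n::finite) \<Rightarrow> (complex^'n^'g) \<Rightarrow> bool" where
  "gr_normalized I B \<longleftrightarrow> (\<forall>i j. B $ i $ I j = (if i = j then 1 else 0))"

definition gr_chart_domain :: "('g::finite \<Rightarrow> 'n::finite) \<Rightarrow> (complex^'n) set set" where
  "gr_chart_domain I = {V. \<exists>B. gr_normalized I B \<and> vec.span (rows B) = V}"

definition gr_chart :: "('g::finite \<Rightarrow> 'n::finite) \<Rightarrow> (complex^'n) set \<Rightarrow> complex^'n^'g" where
  "gr_chart I V = (THE B. gr_normalized I B \<and> vec.span (rows B) = V)"

definition grad_space :: "complex^'g^'g \<Rightarrow> (complex^('g odd_char)) set" where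
  "grad_space \<tau> = vec.span (rows (theta_gradients \<tau>))"

text \<open>On an orbit, the common value of \<^const>\<open>grad_space\<close> at all its points.\<close>

definition PgrTh :: "(complex^'g^'g) set \<Rightarrow> (complex^('g odd_char)) set" where
  "PgrTh p = the_elem (grad_space ` p)"

text \<open>The group \<open>\<Gamma>(n, 2n)\<close> with \<open>n \<ge> 3\<close> acts freely and properly discontinuously, and the
  complex structure of the quotient is the one that makes the projection a local isomorphism. So
  near the class of \<open>\<tau>\<close> the local coordinate is the point of the Siegel space itself, which is open
  in the space of symmetric matrices, and the tangent space at the class is the space of symmetric
  matrices. On it the derivative within \<^const>\<open>siegel_space\<close> is unique.\<close>

definition injective_differential_at ::
    "int \<Rightarrow> ((complex^'g^'g) set \<Rightarrow> (complex^'n) set) \<Rightarrow> (complex^'g^'g) set \<Rightarrow> bool" where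
  "injective_differential_at n F p \<longleftrightarrow>
     (\<forall>\<tau> \<in> p. \<forall>I :: 'g \<Rightarrow> 'n. F p \<in> gr_chart_domain I \<longrightarrow>
        (\<forall>\<^sub>F t in at \<tau> within siegel_space. F (siegel_class n t) \<in> gr_chart_domain I) \<and>
        (\<exists>D. ((\<lambda>t. gr_chart I (F (siegel_class n t))) has_derivative D) (at \<tau> within siegel_space)
             \<and> inj_on D {\<eta>. transpose \<eta> = \<eta>}))"

end

theory Submission
  imports Defs "HOL-Complex_Analysis.Conformal_Mappings"
begin

text \<open>A tangent vector at the class of \<^term>\<open>\<tau>\<close> is a symmetric matrix \<^term>\<open>\<eta>\<close>, and it lies in the
  kernel of the differential when the derivative of the gradient matrix along \<^term>\<open>\<eta>\<close> is a matrix
  times the gradient matrix itself: the rows then move inside the space that they span. By the heat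
  equation, differentiation in \<^term>\<open>\<tau>\<close> along \<^term>\<open>\<eta>\<close> is, up to a constant, the second order operator
  with symbol \<^term>\<open>\<eta>\<close> in the variable \<open>z\<close>. So a kernel vector says that for each index \<open>i\<close> some operator
  with cubic symbol \<^term>\<open>\<eta>\<close> times \<open>\<partial>\<^sub>i\<close>, corrected by a vector field, kills all odd theta functions
  with characteristics at the origin. Likewise, a linear relation between the rows of the gradient matrix
  is a vector field that kills them.

  Such operators are odd, hence kill the even theta functions too. Up to rescaling of \<open>z\<close>, the theta
  functions with characteristics span the space of theta functions of order four, those entire functions
  that transform like the fourth power of the Riemann theta function \<open>\<theta>\<close>
  (\<open>vanishing_on_characteristics\<close>, \<open>quasi_periodic_imp_theta_series\<close>). So the operators kill every
  product \<open>\<theta>(p + z) \<theta>(q + z) \<theta>(r + z) \<theta>(- p - q - r + z)\<close> at the origin. There are enough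
  such products because in every direction \<open>\<theta>\<close> has a zero at which the derivative in that direction is not
  zero (\<open>rtheta_transverse_zero\<close>).

  With a single factor vanishing at the origin this excludes vector fields, so the gradient matrix has full
  rank. With \<open>p\<close>, \<open>q\<close>, \<open>r\<close> zeros of \<open>\<theta>\<close> whose gradients are \<open>\<alpha>\<close>, \<open>\<beta>\<close>, \<open>\<gamma>\<close>, a cubic operator sees only the
  product of the gradients, and \<open>\<eta>(\<alpha>, \<beta>) \<gamma> + \<eta>(\<alpha>, \<gamma>) \<beta> + \<eta>(\<beta>, \<gamma>) \<alpha> = 0\<close> follows if
  \<open>\<theta>(p + q + r)\<close> is not zero. When \<open>\<alpha>\<close> and \<open>\<beta>\<close> are independent, sums of nearby zeros fill an open set, and
  this last condition holds after a small displacement. Taking \<open>r = p\<close> gives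
  \<open>\<eta>(\<alpha>, \<alpha>) = \<eta>(\<alpha>, \<beta>) = 0\<close>, and as the gradients detect every direction, \<^term>\<open>\<eta>\<close> vanishes
  (\<open>order_four_no_divisible_cubic_symbol\<close>). Independent gradients exist only from dimension two on.

  That the map is defined on the quotient is the transformation law of theta functions under
  \<open>\<Gamma>(4, 8)\<close> (\<open>theta_Gamma2\<close>). It too follows from the uniqueness of functions with given quasi-periods:
  the transformed theta function has the quasi-periods of the old one. The gradient matrix is then
  multiplied by an invertible matrix. In a chart of the Grassmannian, finally, the map is the gradient
  matrix multiplied by the inverse of one of its maximal square submatrices, and a tangent vector killed by
  the differential of such a product is one with the property above (\<open>has_derivative_inverse_mult\<close>).\<close>

section \<open>Series of exponentials of linear forms\<close>

lemma exp_diff_linear_bound: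
  fixes w :: complex
  shows "norm (exp w - 1 - w) \<le> (norm w)\<^sup>2 * exp (norm w)"
proof -
  have "norm (exp w - (\<Sum>k\<le>1. w ^ k / fact k)) \<le> exp (norm w) * norm w ^ Suc 1 / fact 1"
    by (rule Taylor_exp_field)
  then show ?thesis by (simp add: algebra_simps power2_eq_square)
qed

lemma summable_on_diff:
  fixes f g :: "'i \<Rightarrow> complex"
  assumes "f summable_on A" "g summable_on A"
  shows "(\<lambda>n. f n - g n) summable_on A"
    and "(\<Sum>\<^sub>\<infinity>n\<in>A. f n - g n) = infsum f A - infsum g A"
proof -
  have g: "(\<lambda>n. - g n) summable_on A" using assms(2) by (simp add: summable_on_uminus)
  show "(\<lambda>n. f n - g n) summable_on A" using summable_on_add[OF assms(1) g] by simp
  show "(\<Sum>\<^sub>\<infinity>n\<in>A. f n - g n) = infsum f A - infsum g A"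
    using infsum_add[OF assms(1) g] by (simp add: infsum_uminus)
qed

text \<open>Termwise differentiation. The exponential of \<^term>\<open>\<delta> * M n\<close> in the summability hypothesis
  dominates every power of the norm of \<^term>\<open>L n\<close>, so that it bounds both the derivative series
  and the quadratic remainder of each term.\<close>

lemma exp_series_has_derivative:
  fixes L :: "'i \<Rightarrow> 'x::real_normed_vector \<Rightarrow> complex"
  assumes lin: "\<And>n. linear (L n)"
    and bd: "\<And>n h. norm (L n h) \<le> M n * norm h"
    and M: "\<And>n. 0 \<le> M n" and \<delta>: "0 < \<delta>"
    and S: "(\<lambda>n. norm (c n) * exp (Re (L n x) + \<delta> * M n)) summable_on UNIV"
  shows "((\<lambda>y. \<Sum>\<^sub>\<infinity>n. c n * exp (L n y)) has_derivative
           (\<lambda>h. \<Sum>\<^sub>\<infinity>n. c n * L n h * exp (L n x))) (at x)"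
proof -
  define A where "A = (\<lambda>n. norm (c n) * exp (Re (L n x) + \<delta> * M n))"
  define K where "K = infsum A UNIV"
  have sA: "A summable_on UNIV" using S by (simp add: A_def)
  have A0: "0 \<le> A n" for n by (simp add: A_def)
  have K0: "0 \<le> K" unfolding K_def by (rule infsum_nonneg) (use A0 in auto)
  have dom: "f summable_on UNIV \<and> norm (infsum f UNIV) \<le> B * K"
    if "\<And>n. norm (f n) \<le> B * A n" for f :: "'i \<Rightarrow> complex" and B
  proof
    have s: "(\<lambda>n. B * A n) summable_on UNIV" by (rule summable_on_cmult_right[OF sA])
    have n: "(\<lambda>n. norm (f n)) summable_on UNIV"
      by (rule Infinite_Sum.abs_summable_on_comparison_test'[OF s]) (use that in auto)
    show f: "f summable_on UNIV" by (rule abs_summable_summable[OF n])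
    have "norm (infsum f UNIV) \<le> infsum (\<lambda>n. B * A n) UNIV"
      by (rule norm_infsum_le[OF has_sum_infsum[OF f] has_sum_infsum[OF s]]) (use that in auto)
    then show "norm (infsum f UNIV) \<le> B * K"
      by (simp add: infsum_cmult_right' K_def)
  qed
  have e1: "norm (c n * exp (L n (x + h))) \<le> 1 * A n" if "norm h \<le> \<delta>" for n h
  proof -
    have "Re (L n h) \<le> M n * norm h"
      using bd[of n h] complex_Re_le_cmod order_trans by blast
    also have "\<dots> \<le> \<delta> * M n" using mult_left_mono[OF that M[of n]] by (simp add: mult.commute)
    finally show ?thesis
      unfolding A_def by (auto simp: norm_mult linear_add[OF lin] intro!: mult_left_mono)
  qed
  have s1: "(\<lambda>n. c n * exp (L n (x + h))) summable_on UNIV" if "norm h \<le> \<delta>" for h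
    using dom[OF e1[OF that]] by simp
  have e2: "norm (c n * L n h * exp (L n x)) \<le> (norm h / \<delta>) * A n" for n h
  proof -
    have "M n \<le> exp (\<delta> * M n) / \<delta>"
      using order_trans[OF _ exp_ge_add_one_self[of "\<delta> * M n"], of "\<delta> * M n"] \<delta> by (simp add: field_simps)
    then have "M n * norm h \<le> exp (\<delta> * M n) / \<delta> * norm h" by (rule mult_right_mono) simp
    with bd[of n h] have "norm (L n h) \<le> exp (\<delta> * M n) / \<delta> * norm h" by linarith
    then have "norm (c n) * norm (L n h) * exp (Re (L n x)) \<le>
        norm (c n) * (exp (\<delta> * M n) / \<delta> * norm h) * exp (Re (L n x))"
      by (intro mult_right_mono mult_left_mono) auto
    then show ?thesis by (simp add: A_def norm_mult exp_add field_simps)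
  qed
  have s2: "(\<lambda>n. c n * L n h * exp (L n x)) summable_on UNIV" for h
    using dom[OF e2] by simp
  define D where "D = (\<lambda>h. \<Sum>\<^sub>\<infinity>n. c n * L n h * exp (L n x))"
  have bl: "bounded_linear D"
  proof (rule bounded_linear_intro[where K = "K / \<delta>"])
    show "D (a + b) = D a + D b" for a b
      unfolding D_def by (subst infsum_add[symmetric, OF s2 s2])
        (simp add: linear_add[OF lin] algebra_simps)
    show "D (r *\<^sub>R a) = r *\<^sub>R D a" for r a
      unfolding D_def by (subst infsum_scaleR_right[symmetric])
        (simp add: linear_scale[OF lin])
    show "norm (D a) \<le> norm a * (K / \<delta>)" for a
      using dom[OF e2] by (simp add: D_def)
  qed
  have e3: "norm (c n * (exp (L n (x + h)) - exp (L n x) - L n h * exp (L n x)))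
      \<le> ((norm h)\<^sup>2 * (8 / \<delta>\<^sup>2)) * A n" if "norm h \<le> \<delta> / 2" for n h
  proof -
    have b: "norm (L n h) \<le> M n * (\<delta> / 2)"
      by (rule order_trans[OF bd]) (rule mult_left_mono[OF that M])
    have "(M n * \<delta> / 2)\<^sup>2 / 2 \<le> exp (M n * \<delta> / 2)"
    proof -
      have "0 \<le> M n * \<delta> / 2" using M[of n] \<delta> by simp
      then show ?thesis using exp_lower_Taylor_quadratic[of "M n * \<delta> / 2"] by linarith
    qed
    then have m2: "(M n)\<^sup>2 \<le> 8 / \<delta>\<^sup>2 * exp (M n * \<delta> / 2)"
      using \<delta> by (simp add: field_simps power2_eq_square)
    have "norm (exp (L n h) - 1 - L n h) \<le> (norm (L n h))\<^sup>2 * exp (norm (L n h))"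
      by (rule exp_diff_linear_bound)
    also have "\<dots> \<le> (M n * norm h)\<^sup>2 * exp (M n * (\<delta> / 2))"
      by (intro mult_mono power_mono bd) (use b in auto)
    also have "\<dots> = (norm h)\<^sup>2 * ((M n)\<^sup>2 * exp (M n * \<delta> / 2))" by (simp add: power_mult_distrib)
    also have "\<dots> \<le> (norm h)\<^sup>2 * ((8 / \<delta>\<^sup>2 * exp (M n * \<delta> / 2)) * exp (M n * \<delta> / 2))"
      by (intro mult_left_mono mult_right_mono m2) auto
    also have "\<dots> = (norm h)\<^sup>2 * (8 / \<delta>\<^sup>2) * exp (\<delta> * M n)"
      by (simp add: exp_add[symmetric] mult.commute)
    finally have "norm (exp (L n h) - 1 - L n h) \<le> (norm h)\<^sup>2 * (8 / \<delta>\<^sup>2) * exp (\<delta> * M n)" .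
    then have "norm (c n) * exp (Re (L n x)) * norm (exp (L n h) - 1 - L n h)
       \<le> norm (c n) * exp (Re (L n x)) * ((norm h)\<^sup>2 * (8 / \<delta>\<^sup>2) * exp (\<delta> * M n))"
      by (rule mult_left_mono) auto
    moreover have "c n * (exp (L n (x + h)) - exp (L n x) - L n h * exp (L n x))
        = c n * exp (L n x) * (exp (L n h) - 1 - L n h)"
      by (simp add: linear_add[OF lin] exp_add algebra_simps)
    then have "norm (c n * (exp (L n (x + h)) - exp (L n x) - L n h * exp (L n x)))
        = norm (c n) * exp (Re (L n x)) * norm (exp (L n h) - 1 - L n h)"
      by (simp only: norm_mult norm_exp_eq_Re)
    ultimately show ?thesis by (simp add: A_def exp_add mult_ac)
  qed
  show "((\<lambda>y. \<Sum>\<^sub>\<infinity>n. c n * exp (L n y)) has_derivative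
           (\<lambda>h. \<Sum>\<^sub>\<infinity>n. c n * L n h * exp (L n x))) (at x)"
    unfolding has_derivative_at_alt D_def[symmetric]
  proof (intro conjI bl allI impI)
    fix e :: real assume e: "e > 0"
    define d where "d = min (\<delta> / 2) (e * \<delta>\<^sup>2 / (8 * (K + 1)))"
    have d: "d > 0" using \<delta> e K0 by (simp add: d_def)
    show "\<exists>d>0. \<forall>y. norm (y - x) < d \<longrightarrow>
        norm ((\<Sum>\<^sub>\<infinity>n. c n * exp (L n y)) - (\<Sum>\<^sub>\<infinity>n. c n * exp (L n x)) - D (y - x)) \<le> e * norm (y - x)"
    proof (intro exI[of _ d] conjI d allI impI)
      fix y assume y: "norm (y - x) < d"
      define h where "h = y - x"
      have h: "norm h \<le> \<delta> / 2" "norm h \<le> e * \<delta>\<^sup>2 / (8 * (K + 1))" "norm h \<le> \<delta>"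
        using y \<delta> by (auto simp: h_def d_def)
      have yx: "y = x + h" by (simp add: h_def)
      have s0: "(\<lambda>n. c n * exp (L n x)) summable_on UNIV" using s1[of 0] \<delta> by simp
      have sd: "(\<lambda>n. c n * exp (L n y) - c n * exp (L n x)) summable_on UNIV"
        using summable_on_diff(1)[OF s1[OF h(3)] s0] by (simp add: yx)
      have "(\<Sum>\<^sub>\<infinity>n. c n * exp (L n y)) - (\<Sum>\<^sub>\<infinity>n. c n * exp (L n x)) - D h
        = (\<Sum>\<^sub>\<infinity>n. c n * (exp (L n (x + h)) - exp (L n x) - L n h * exp (L n x)))"
        unfolding D_def yx
        using summable_on_diff(2)[OF s1[OF h(3)] s0] summable_on_diff(2)[OF sd[unfolded yx] s2]
        by (simp add: algebra_simps)
      then have "norm ((\<Sum>\<^sub>\<infinity>n. c n * exp (L n y)) - (\<Sum>\<^sub>\<infinity>n. c n * exp (L n x)) - D h)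
          \<le> (norm h)\<^sup>2 * (8 / \<delta>\<^sup>2) * K"
        using dom[OF e3[OF h(1)]] by simp
      also have "\<dots> = norm h * (norm h * (8 / \<delta>\<^sup>2 * K))" by (simp add: power2_eq_square)
      also have "\<dots> \<le> norm h * (e * \<delta>\<^sup>2 / (8 * (K + 1)) * (8 / \<delta>\<^sup>2 * K))"
        by (intro mult_left_mono mult_right_mono h) (use K0 in auto)
      also have "\<dots> = norm h * (e * (K / (K + 1)))" using \<delta> K0 by (simp add: field_simps)
      also have "\<dots> \<le> norm h * (e * 1)"
        by (intro mult_left_mono) (use K0 e in auto)
      finally show "norm ((\<Sum>\<^sub>\<infinity>n. c n * exp (L n y)) - (\<Sum>\<^sub>\<infinity>n. c n * exp (L n x)) - D (y - x))
          \<le> e * norm (y - x)" by (simp add: h_def mult.commute)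
    qed
  qed
qed

section \<open>Gaussian sums over the integral lattice\<close>

definition rvec :: "int^'g \<Rightarrow> real^'g" where
  "rvec n = (\<chi> i. real_of_int (n $ i))"

lemma int_exp_abs_summable: "(\<lambda>k::int. exp (- \<bar>real_of_int k\<bar>)) summable_on UNIV"
proof -
  have s: "summable (\<lambda>n. exp (- real n))"
    using summable_geometric[of "exp (-1::real)"] by (simp add: exp_of_nat_mult[symmetric])
  have 1: "(\<lambda>k::int. exp (- \<bar>real_of_int k\<bar>)) summable_on range int"
    by (subst summable_on_reindex)
      (use s in \<open>auto simp: o_def inj_on_def intro!: summable_nonneg_imp_summable_on\<close>)
  have 2: "(\<lambda>k::int. exp (- \<bar>real_of_int k\<bar>)) summable_on range (\<lambda>n. - int n)"
    by (subst summable_on_reindex)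
      (use s in \<open>auto simp: o_def inj_on_def intro!: summable_nonneg_imp_summable_on\<close>)
  have "(UNIV :: int set) = range int \<union> range (\<lambda>n. - int n)"
  proof -
    have "k \<in> range int \<union> range (\<lambda>n. - int n)" for k
      by (cases k rule: int_cases2) auto
    then show ?thesis by auto
  qed
  then show ?thesis using summable_on_union[OF 1 2] by simp
qed

lemma lattice_exp_abs_summable:
  "(\<lambda>n::int^'g. \<Prod>i\<in>UNIV. exp (- \<bar>real_of_int (n $ i)\<bar>)) summable_on UNIV"
proof -
  let ?e = "\<lambda>k::int. exp (- \<bar>real_of_int k\<bar>)"
  have pos: "infsum ?e UNIV > 0"
  proof -
    have "?e 0 \<le> infsum ?e UNIV"
      using finite_sum_le_infsum[OF int_exp_abs_summable, of "{0}"] by simp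
    then show ?thesis by simp
  qed
  have "infsum (\<lambda>g. \<Prod>i\<in>(UNIV::'g set). ?e (g i)) (PiE UNIV (\<lambda>_. UNIV))
      = (\<Prod>i\<in>(UNIV::'g set). infsum ?e UNIV)"
    by (rule infsum_prod_PiE_abs) (use int_exp_abs_summable in auto)
  also have "\<dots> \<noteq> 0" using pos by simp
  finally have "(\<lambda>g. \<Prod>i\<in>(UNIV::'g set). ?e (g i)) summable_on UNIV"
    using infsum_not_exists by (force simp: PiE_UNIV_domain)
  moreover have "bij_betw (\<lambda>n::int^'g. \<lambda>i. n $ i) UNIV UNIV"
    by (rule bij_betw_byWitness[where f' = vec_lambda]) auto
  ultimately show ?thesis
    by (subst (asm) summable_on_reindex_bij_betw[symmetric]) auto
qed

text \<open>Completing the square absorbs the linear exponent and any further multiple of the norm. This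
  leaves a product of one-variable geometric series.\<close>

lemma gaussian_lattice_summable:
  assumes "\<kappa> > 0"
  shows "(\<lambda>n::int^'g. (1 + norm (rvec n)) ^ k * exp (\<mu> * norm (rvec n) - \<kappa> * (norm (rvec n))\<^sup>2))
    summable_on UNIV"
proof -
  define \<nu> where "\<nu> = \<mu> + 1 + real CARD('g)"
  define C where "C = fact k * exp 1 * exp (\<nu>\<^sup>2 / (4 * \<kappa>))"
  have le: "(1 + norm (rvec n)) ^ k * exp (\<mu> * norm (rvec n) - \<kappa> * (norm (rvec n))\<^sup>2)
      \<le> C * (\<Prod>i\<in>UNIV. exp (- \<bar>real_of_int (n $ i)\<bar>))" for n :: "int^'g"
  proof -
    define s where "s = norm (rvec n)"
    have s0: "s \<ge> 0" by (simp add: s_def)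
    have comp: "\<bar>real_of_int (n $ i)\<bar> \<le> s" for i
      using component_le_norm_cart[of "rvec n" i] by (simp add: rvec_def s_def)
    have "(\<Sum>i\<in>UNIV. \<bar>real_of_int (n $ i)\<bar>) \<le> (\<Sum>i\<in>(UNIV::'g set). s)"
      by (rule sum_mono) (use comp in auto)
    then have sum: "exp (- (real CARD('g) * s)) \<le> (\<Prod>i\<in>UNIV. exp (- \<bar>real_of_int (n $ i)\<bar>))"
      by (simp add: exp_sum[symmetric] sum_negf)
    have pw: "(1 + s) ^ k \<le> fact k * exp (1 + s)"
    proof -
      have "(1 + s) ^ k / fact k \<le> exp (1 + s)"
      proof -
        have "(\<Sum>j\<in>{k}. (1 + s) ^ j /\<^sub>R fact j) \<le> (\<Sum>j. (1 + s) ^ j /\<^sub>R fact j)"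
          by (rule sum_le_suminf) (use s0 summable_exp_generic[of "1 + s"] in auto)
        then show ?thesis by (simp add: exp_def divide_inverse mult.commute)
      qed
      then show ?thesis by (simp add: field_simps)
    qed
    have q: "\<nu> * s - \<kappa> * s\<^sup>2 \<le> \<nu>\<^sup>2 / (4 * \<kappa>)"
    proof -
      have "0 \<le> (2 * \<kappa> * s - \<nu>)\<^sup>2" by simp
      then have "4 * \<kappa> * (\<nu> * s - \<kappa> * s\<^sup>2) \<le> \<nu>\<^sup>2" by (simp add: power2_eq_square algebra_simps)
      then show ?thesis using assms by (simp add: field_simps)
    qed
    have "(1 + s) ^ k * exp (\<mu> * s - \<kappa> * s\<^sup>2) \<le> fact k * exp (1 + s) * exp (\<mu> * s - \<kappa> * s\<^sup>2)"
      by (rule mult_right_mono[OF pw]) simp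
    also have "\<dots> = fact k * exp 1 * exp (\<nu> * s - \<kappa> * s\<^sup>2) * exp (- (real CARD('g) * s))"
      by (simp add: \<nu>_def exp_add[symmetric] algebra_simps)
    also have "\<dots> \<le> C * exp (- (real CARD('g) * s))"
      unfolding C_def by (intro mult_right_mono mult_left_mono) (use q in auto)
    also have "\<dots> \<le> C * (\<Prod>i\<in>UNIV. exp (- \<bar>real_of_int (n $ i)\<bar>))"
      by (rule mult_left_mono[OF sum]) (simp add: C_def)
    finally show ?thesis by (simp add: s_def)
  qed
  have "(\<lambda>n::int^'g. norm ((1 + norm (rvec n)) ^ k *
      exp (\<mu> * norm (rvec n) - \<kappa> * (norm (rvec n))\<^sup>2))) summable_on UNIV"
    by (rule Infinite_Sum.abs_summable_on_comparison_test'[OF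
          summable_on_cmult_right[OF lattice_exp_abs_summable, of C]])
      (use le in \<open>auto simp: abs_mult\<close>)
  then show ?thesis by (rule abs_summable_summable)
qed

subsection \<open>The complex bilinear pairing\<close>

lemma cbil_commute: "cbil x y = cbil y x"
  by (simp add: cbil_def mult.commute)

lemma cbil_add_left: "cbil (x + y) z = cbil x z + cbil y z"
  by (simp add: cbil_def algebra_simps sum.distrib)

lemma cbil_add_right: "cbil z (x + y) = cbil z x + cbil z y"
  by (simp add: cbil_def algebra_simps sum.distrib)

lemma cbil_diff_left: "cbil (x - y) z = cbil x z - cbil y z"
  by (simp add: cbil_def algebra_simps sum_subtractf)

lemma cbil_diff_right: "cbil z (x - y) = cbil z x - cbil z y"
  by (simp add: cbil_def algebra_simps sum_subtractf)

lemma cbil_minus_left: "cbil (- x) z = - cbil x z"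
  by (simp add: cbil_def sum_negf)

lemma cbil_minus_right: "cbil z (- x) = - cbil z x"
  by (simp add: cbil_def sum_negf)

lemma cbil_scale_left: "cbil (a *s x) z = a * cbil x z"
  by (simp add: cbil_def sum_distrib_left mult.assoc)

lemma cbil_scale_right: "cbil z (a *s x) = a * cbil z x"
  by (simp add: cbil_def sum_distrib_left algebra_simps)

lemma cbil_scaleR_left: "cbil (r *\<^sub>R x) z = of_real r * cbil x z"
  by (simp add: cbil_def sum_distrib_left mult.assoc scaleR_conv_of_real[where 'a=complex])

lemma cbil_scaleR_right: "cbil z (r *\<^sub>R x) = of_real r * cbil z x"
  by (simp add: cbil_commute[of z] cbil_scaleR_left)

lemma cbil_zero [simp]: "cbil 0 x = 0" "cbil x 0 = 0"
  by (simp_all add: cbil_def)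

lemma cbil_axis: "cbil x (axis i a) = x $ i * a" "cbil (axis i a) x = a * x $ i"
  by (simp_all add: cbil_def axis_def if_distrib if_distribR cong: if_cong)

lemma cbil_matrix: "cbil x (A *v y) = cbil (transpose A *v x) y"
proof -
  have "cbil x (A *v y) = (\<Sum>i\<in>UNIV. \<Sum>j\<in>UNIV. x $ i * (A $ i $ j * y $ j))"
    by (simp add: cbil_def matrix_vector_mult_def sum_distrib_left)
  also have "\<dots> = (\<Sum>j\<in>UNIV. \<Sum>i\<in>UNIV. x $ i * (A $ i $ j * y $ j))" by (rule sum.swap)
  also have "\<dots> = cbil (transpose A *v x) y"
    by (simp add: cbil_def matrix_vector_mult_def transpose_def sum_distrib_left mult_ac)
  finally show ?thesis .
qed

lemmas cbil_simps = cbil_add_left cbil_add_right cbil_diff_left cbil_diff_right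
  cbil_minus_left cbil_minus_right cbil_scale_left cbil_scale_right cbil_scaleR_left cbil_scaleR_right

lemma cbil_bound: "norm (cbil x y) \<le> norm x * norm y"
proof -
  have "norm (cbil x y) \<le> (\<Sum>i\<in>UNIV. \<bar>norm (x $ i)\<bar> * \<bar>norm (y $ i)\<bar>)"
    unfolding cbil_def by (rule order_trans[OF norm_sum]) (simp add: norm_mult)
  also have "\<dots> \<le> norm x * norm y"
    unfolding norm_vec_def by (rule L2_set_mult_ineq)
  finally show ?thesis .
qed

lemma matrix_vector_mult_uminus: "A *v (- x) = - (A *v x)" for A :: "complex^'n^'m"
  by (simp add: vec_eq_iff matrix_vector_mult_def sum_negf)

lemma matrix_vector_bound:
  fixes A :: "complex^'n^'m"
  shows "norm (A *v x) \<le> norm A * norm x"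
proof -
  have "norm (A *v x) \<le> L2_set (\<lambda>i. norm x * norm (A $ i)) UNIV"
    unfolding norm_vec_def[of "A *v x"]
  proof (rule L2_set_mono)
    fix i
    have "(A *v x) $ i = cbil (A $ i) x" by (simp add: matrix_vector_mult_def cbil_def)
    then show "norm ((A *v x) $ i) \<le> norm x * norm (A $ i)"
      using cbil_bound[of "A $ i" x] by (simp add: mult.commute)
  qed auto
  then show ?thesis by (simp add: norm_vec_def[of A] L2_set_right_distrib mult.commute)
qed

definition ivec :: "int^'g \<Rightarrow> complex^'g" where
  "ivec n = (\<chi> i. of_int (n $ i))"

definition qform :: "complex^'g^'g \<Rightarrow> int^'g \<Rightarrow> complex" where
  "qform \<tau> n = cbil (ivec n) (\<tau> *v ivec n)"

lemma ivec_simps [simp]: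
  "ivec (m + n) = ivec m + ivec n" "ivec (m - n) = ivec m - ivec n"
  "ivec (- n) = - ivec n" "ivec 0 = 0" "ivec (axis i 1) = axis i 1"
  "ivec (of_int k *s n) = of_int k *s ivec n"
  by (auto simp: ivec_def vec_eq_iff axis_def)

lemma norm_ivec [simp]: "norm (ivec n) = norm (rvec n)"
  by (simp add: norm_vec_def ivec_def rvec_def L2_set_def)

lemma cbil_ivec_ivec: "cbil (ivec m) (ivec n) = of_int (\<Sum>i\<in>UNIV. m $ i * n $ i)"
  by (simp add: cbil_def ivec_def)

lemma exp_cbil_ivec [simp]: "exp (2 * of_real pi * \<i> * cbil (ivec m) (ivec n)) = 1"
proof -
  have "2 * of_real pi * \<i> * cbil (ivec m) (ivec n) =
      of_int (\<Sum>i\<in>UNIV. m $ i * n $ i) * (2 * of_real pi * \<i>)"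
    unfolding cbil_ivec_ivec by simp
  then show ?thesis unfolding exp_eq_1 by (intro conjI exI[of _ "\<Sum>i\<in>UNIV. m $ i * n $ i"]) simp_all
qed

lemma qform_linear: "linear (\<lambda>\<tau>. qform \<tau> n)"
  by (rule linearI) (simp_all add: qform_def matrix_vector_mult_add_rdistrib cbil_add_right
      cbil_def matrix_vector_mult_def sum_distrib_left scaleR_conv_of_real[where 'a = complex]
      algebra_simps sum.distrib)

lemma qform_scaleR: "qform (r *\<^sub>R \<tau>) n = of_real r * qform \<tau> n"
  using linear_scale[OF qform_linear, of r \<tau> n] by (simp add: scaleR_conv_of_real)

lemma qform_bound: "norm (qform \<eta> n) \<le> (norm (rvec n))\<^sup>2 * norm \<eta>"
proof -
  have "norm (qform \<eta> n) \<le> norm (rvec n) * norm (\<eta> *v ivec n)"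
    unfolding qform_def using cbil_bound[of "ivec n"] by simp
  also have "\<dots> \<le> norm (rvec n) * (norm \<eta> * norm (rvec n))"
    by (rule mult_left_mono) (use matrix_vector_bound[of \<eta> "ivec n"] in auto)
  finally show ?thesis by (simp add: power2_eq_square mult_ac)
qed

lemma cbil_symmetric: "transpose \<tau> = \<tau> \<Longrightarrow> cbil x (\<tau> *v y) = cbil y (\<tau> *v x)"
  using cbil_matrix[of x \<tau> y] cbil_commute by metis

lemma qform_add:
  "transpose \<tau> = \<tau> \<Longrightarrow>
    qform \<tau> (m + n) = qform \<tau> m + qform \<tau> n + 2 * cbil (ivec n) (\<tau> *v ivec m)"
  using cbil_symmetric[of \<tau> "ivec n" "ivec m"]
  by (simp add: qform_def matrix_vector_right_distrib cbil_simps)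

subsection \<open>Convergence\<close>

text \<open>Positivity of the imaginary part without symmetry: an open condition in the space of all
  matrices, on which the series below depend only on the symmetric part.\<close>

definition pos_im :: "complex^'g^'g \<Rightarrow> bool" where
  "pos_im \<tau> \<longleftrightarrow> (\<forall>x::real^'g. x \<noteq> 0 \<longrightarrow> 0 < x \<bullet> ((\<chi> i j. Im (\<tau> $ i $ j)) *v x))"

lemma siegel_space_iff: "\<tau> \<in> siegel_space \<longleftrightarrow> transpose \<tau> = \<tau> \<and> pos_im \<tau>"
  by (simp add: siegel_space_def pos_im_def)

text \<open>By homogeneity the constant is the minimum of the form on the unit sphere, which is compact.\<close>

lemma pos_im_coercive:
  assumes "pos_im \<tau>"
  shows "\<exists>\<kappa>>0. \<forall>x. \<kappa> * (norm x)\<^sup>2 \<le> x \<bullet> ((\<chi> i j. Im (\<tau> $ i $ j)) *v x)"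
proof -
  define Y where "Y = (\<chi> i j. Im (\<tau> $ i $ j))"
  have ne: "sphere (0::real^'g) 1 \<noteq> {}" by simp
  have cont: "continuous_on (sphere 0 1) (\<lambda>x. x \<bullet> (Y *v x))"
    by (intro continuous_intros)
  obtain u where u: "u \<in> sphere 0 1" "\<And>x. x \<in> sphere 0 1 \<Longrightarrow> u \<bullet> (Y *v u) \<le> x \<bullet> (Y *v x)"
    using continuous_attains_inf[OF compact_sphere ne cont] by blast
  have "u \<noteq> 0" using u(1) by auto
  then have pos: "0 < u \<bullet> (Y *v u)" using assms by (auto simp: pos_im_def Y_def)
  moreover have "u \<bullet> (Y *v u) * (norm x)\<^sup>2 \<le> x \<bullet> (Y *v x)" for x
  proof (cases "x = 0")
    case False
    define y where "y = (1 / norm x) *\<^sub>R x"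
    have "y \<in> sphere 0 1" using False by (simp add: y_def)
    from u(2)[OF this] have "u \<bullet> (Y *v u) \<le> y \<bullet> (Y *v y)" .
    moreover have "x = norm x *\<^sub>R y" using False by (simp add: y_def)
    then have "x \<bullet> (Y *v x) = (norm x *\<^sub>R y) \<bullet> (Y *v (norm x *\<^sub>R y))" by (rule arg_cong)
    then have "x \<bullet> (Y *v x) = (norm x)\<^sup>2 * (y \<bullet> (Y *v y))"
      by (simp only: matrix_vector_mult_scaleR inner_scaleR_left inner_scaleR_right)
        (simp add: power2_eq_square)
    ultimately show ?thesis by (simp add: mult.commute mult_right_mono)
  qed simp
  ultimately show ?thesis unfolding Y_def by blast
qed

lemma Im_qform: "Im (qform \<tau> n) = rvec n \<bullet> ((\<chi> i j. Im (\<tau> $ i $ j)) *v rvec n)"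
  by (simp add: qform_def cbil_def matrix_vector_mult_def ivec_def rvec_def inner_vec_def)

text \<open>Closed under the operations that differentiation performs on coefficients: derivatives in \<open>z\<close> and in
  the matrix multiply them by linear and quadratic forms of the index.\<close>

definition poly_bounded :: "(int^'g \<Rightarrow> complex) \<Rightarrow> bool" where
  "poly_bounded c \<longleftrightarrow> (\<exists>C k. \<forall>n. norm (c n) \<le> C * (1 + norm (rvec n)) ^ k)"

lemma poly_boundedI: "(\<And>n. norm (c n) \<le> C) \<Longrightarrow> poly_bounded c"
  unfolding poly_bounded_def by (rule exI[of _ C], rule exI[of _ 0]) simp

lemma poly_bounded_const [simp]: "poly_bounded (\<lambda>n. a)"
  by (rule poly_boundedI) auto

lemma poly_bounded_mult [intro]:
  assumes "poly_bounded c" "poly_bounded d"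
  shows "poly_bounded (\<lambda>n. c n * d n)"
proof -
  obtain C k where c: "\<And>n. norm (c n) \<le> C * (1 + norm (rvec n)) ^ k"
    using assms(1) by (auto simp: poly_bounded_def)
  obtain D l where d: "\<And>n. norm (d n) \<le> D * (1 + norm (rvec n)) ^ l"
    using assms(2) by (auto simp: poly_bounded_def)
  have "norm (c n * d n) \<le> C * D * (1 + norm (rvec n)) ^ (k + l)" for n
  proof -
    have "norm (c n * d n) \<le> (C * (1 + norm (rvec n)) ^ k) * (D * (1 + norm (rvec n)) ^ l)"
      unfolding norm_mult by (rule mult_mono[OF c d]) (use order_trans[OF norm_ge_zero c] in auto)
    then show ?thesis by (simp add: power_add mult_ac)
  qed
  then show ?thesis unfolding poly_bounded_def by blast
qed

lemma poly_bounded_add [intro]: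
  assumes "poly_bounded c" "poly_bounded d"
  shows "poly_bounded (\<lambda>n. c n + d n)"
proof -
  obtain C k where c: "\<And>n. norm (c n) \<le> C * (1 + norm (rvec n)) ^ k"
    using assms(1) by (auto simp: poly_bounded_def)
  obtain D l where d: "\<And>n. norm (d n) \<le> D * (1 + norm (rvec n)) ^ l"
    using assms(2) by (auto simp: poly_bounded_def)
  have C: "0 \<le> C" and D: "0 \<le> D"
    using order_trans[OF norm_ge_zero c[of 0]] order_trans[OF norm_ge_zero d[of 0]]
    by (simp_all add: rvec_def zero_vec_def[symmetric])
  have "norm (c n + d n) \<le> (C + D) * (1 + norm (rvec n)) ^ (k + l)" for n
  proof -
    have "norm (c n + d n) \<le> C * (1 + norm (rvec n)) ^ k + D * (1 + norm (rvec n)) ^ l"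
      by (rule order_trans[OF norm_triangle_ineq add_mono[OF c d]])
    also have "\<dots> \<le> C * (1 + norm (rvec n)) ^ (k + l) + D * (1 + norm (rvec n)) ^ (k + l)"
      by (intro add_mono mult_left_mono power_increasing C D) auto
    finally show ?thesis by (simp add: algebra_simps)
  qed
  then show ?thesis unfolding poly_bounded_def by blast
qed

lemma poly_bounded_cmult [intro]: "poly_bounded c \<Longrightarrow> poly_bounded (\<lambda>n. a * c n)"
  by (rule poly_bounded_mult) auto

lemma poly_bounded_diff [intro]:
  assumes "poly_bounded c" "poly_bounded d"
  shows "poly_bounded (\<lambda>n. c n - d n)"
  using poly_bounded_add[OF assms(1) poly_bounded_cmult[OF assms(2), of "-1"]] by simp

lemma poly_bounded_sum [intro]:
  "(\<And>a. a \<in> A \<Longrightarrow> poly_bounded (c a)) \<Longrightarrow> poly_bounded (\<lambda>n. \<Sum>a\<in>A. c a n)"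
  by (induction A rule: infinite_finite_induct) auto

lemma poly_bounded_cbil [intro]: "poly_bounded (\<lambda>n. cbil (ivec n) z)"
  unfolding poly_bounded_def
proof (intro exI allI)
  fix n :: "int^'a"
  have "norm (cbil (ivec n) z) \<le> norm (rvec n) * norm z" using cbil_bound[of "ivec n" z] by simp
  also have "\<dots> \<le> norm z * (1 + norm (rvec n)) ^ 1" by (simp add: algebra_simps)
  finally show "norm (cbil (ivec n) z) \<le> norm z * (1 + norm (rvec n)) ^ 1" .
qed

lemma poly_bounded_qform [intro]: "poly_bounded (\<lambda>n. qform \<eta> n)"
  unfolding poly_bounded_def
proof (intro exI allI)
  fix n :: "int^'a"
  have "norm (qform \<eta> n) \<le> (norm (rvec n))\<^sup>2 * norm \<eta>" by (rule qform_bound)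
  also have "\<dots> \<le> norm \<eta> * (1 + norm (rvec n)) ^ 2"
    by (subst mult.commute) (intro mult_left_mono power_mono, auto)
  finally show "norm (qform \<eta> n) \<le> norm \<eta> * (1 + norm (rvec n)) ^ 2" .
qed

definition theta_exponent :: "complex^'g^'g \<Rightarrow> complex^'g \<Rightarrow> int^'g \<Rightarrow> complex" where
  "theta_exponent \<tau> z n = of_real pi * \<i> * qform \<tau> n + 2 * of_real pi * \<i> * cbil (ivec n) z"

definition theta_series :: "(int^'g \<Rightarrow> complex) \<Rightarrow> complex^'g^'g \<Rightarrow> complex^'g \<Rightarrow> complex" where
  "theta_series c \<tau> z = (\<Sum>\<^sub>\<infinity>n. c n * exp (theta_exponent \<tau> z n))"

text \<open>The quadratic room \<^term>\<open>\<delta>\<close> is what termwise differentiation in the matrix consumes, and the linear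
  room \<^term>\<open>\<mu>\<close> is what differentiation in \<open>z\<close> consumes.\<close>

lemma theta_series_majorant:
  assumes "pos_im \<tau>" "poly_bounded c"
  shows "\<exists>\<delta>>0. \<forall>\<mu> z. (\<lambda>n. norm (c n) * exp (Re (theta_exponent \<tau> z n) +
      (\<mu> * norm (rvec n) + \<delta> * (norm (rvec n))\<^sup>2))) summable_on UNIV"
proof -
  obtain \<kappa> where \<kappa>: "\<kappa> > 0"
    "\<And>x. \<kappa> * (norm x)\<^sup>2 \<le> x \<bullet> ((\<chi> i j. Im (\<tau> $ i $ j)) *v x)"
    using pos_im_coercive[OF assms(1)] by blast
  obtain C k where c: "\<And>n. norm (c n) \<le> C * (1 + norm (rvec n)) ^ k"
    using assms(2) by (auto simp: poly_bounded_def)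
  define \<delta> where "\<delta> = pi * \<kappa> / 2"
  have "(\<lambda>n. norm (c n) * exp (Re (theta_exponent \<tau> z n) +
      (\<mu> * norm (rvec n) + \<delta> * (norm (rvec n))\<^sup>2))) summable_on UNIV" for \<mu> z
  proof -
    define \<nu> where "\<nu> = \<mu> + 2 * pi * norm z"
    have le: "norm (norm (c n) * exp (Re (theta_exponent \<tau> z n) +
      (\<mu> * norm (rvec n) + \<delta> * (norm (rvec n))\<^sup>2)))
      \<le> C * ((1 + norm (rvec n)) ^ k * exp (\<nu> * norm (rvec n) - \<delta> * (norm (rvec n))\<^sup>2))" for n
    proof -
      have "- Im (cbil (ivec n) z) \<le> norm (rvec n) * norm z"
        using cbil_bound[of "ivec n" z] abs_Im_le_cmod[of "cbil (ivec n) z"] by simp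
      then have 1: "2 * pi * (- Im (cbil (ivec n) z)) \<le> 2 * pi * (norm (rvec n) * norm z)"
        by (intro mult_left_mono) auto
      have "\<kappa> * (norm (rvec n))\<^sup>2 \<le> Im (qform \<tau> n)" using \<kappa>(2) by (simp add: Im_qform)
      then have 2: "pi * (\<kappa> * (norm (rvec n))\<^sup>2) \<le> pi * Im (qform \<tau> n)"
        by (intro mult_left_mono) auto
      have 3: "Re (theta_exponent \<tau> z n) = - (pi * Im (qform \<tau> n)) + 2 * pi * (- Im (cbil (ivec n) z))"
        by (simp add: theta_exponent_def)
      have 4: "\<nu> * norm (rvec n) - \<delta> * (norm (rvec n))\<^sup>2 = \<mu> * norm (rvec n) +
          2 * pi * (norm (rvec n) * norm z) + \<delta> * (norm (rvec n))\<^sup>2 - pi * (\<kappa> * (norm (rvec n))\<^sup>2)"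
        by (simp add: \<nu>_def \<delta>_def algebra_simps)
      have "Re (theta_exponent \<tau> z n) + (\<mu> * norm (rvec n) + \<delta> * (norm (rvec n))\<^sup>2)
          \<le> \<nu> * norm (rvec n) - \<delta> * (norm (rvec n))\<^sup>2"
        unfolding 3 4 using 1 2 by linarith
      then have "norm (c n) * exp (Re (theta_exponent \<tau> z n) +
          (\<mu> * norm (rvec n) + \<delta> * (norm (rvec n))\<^sup>2))
        \<le> (C * (1 + norm (rvec n)) ^ k) * exp (\<nu> * norm (rvec n) - \<delta> * (norm (rvec n))\<^sup>2)"
        by (intro mult_mono c) (use order_trans[OF norm_ge_zero c] in auto)
      then show ?thesis by (simp add: mult_ac)
    qed
    have "\<delta> > 0" using \<kappa> by (simp add: \<delta>_def)
    from Infinite_Sum.abs_summable_on_comparison_test'[OF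
        summable_on_cmult_right[OF gaussian_lattice_summable[OF this]] le]
    show ?thesis by simp
  qed
  moreover have "\<delta> > 0" using \<kappa> by (simp add: \<delta>_def)
  ultimately show ?thesis by blast
qed

lemma theta_series_summable:
  assumes "pos_im \<tau>" "poly_bounded c"
  shows "(\<lambda>n. c n * exp (theta_exponent \<tau> z n)) summable_on UNIV"
proof -
  obtain \<delta> where \<delta>: "\<delta> > 0" and s: "\<And>\<mu> z. (\<lambda>n. norm (c n) * exp (Re (theta_exponent \<tau> z n) +
      (\<mu> * norm (rvec n) + \<delta> * (norm (rvec n))\<^sup>2))) summable_on UNIV"
    using theta_series_majorant[OF assms] by blast
  have "(\<lambda>n. norm (c n * exp (theta_exponent \<tau> z n))) summable_on UNIV"
    by (rule Infinite_Sum.abs_summable_on_comparison_test'[OF s[of z 0]])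
      (use \<delta> in \<open>auto simp: norm_mult intro!: mult_left_mono\<close>)
  then show ?thesis by (rule abs_summable_summable)
qed

lemma theta_series_has_derivative:
  assumes "pos_im \<tau>" "poly_bounded c"
  shows "(theta_series c \<tau> has_derivative
    (\<lambda>h. theta_series (\<lambda>n. c n * (2 * of_real pi * \<i> * cbil (ivec n) h)) \<tau> z)) (at z)"
proof -
  obtain \<delta> where \<delta>: "\<delta> > 0" and s: "\<And>\<mu> z. (\<lambda>n. norm (c n) * exp (Re (theta_exponent \<tau> z n) +
      (\<mu> * norm (rvec n) + \<delta> * (norm (rvec n))\<^sup>2))) summable_on UNIV"
    using theta_series_majorant[OF assms] by blast
  let ?c = "\<lambda>n. c n * exp (of_real pi * \<i> * qform \<tau> n)"
  let ?L = "\<lambda>n z. 2 * of_real pi * \<i> * cbil (ivec n) z"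
  let ?M = "\<lambda>n. 2 * pi * norm (rvec n)"
  have sum: "(\<lambda>n. norm (?c n) * exp (Re (?L n z) + 1 * ?M n)) summable_on UNIV"
  proof -
    have "(\<lambda>n. norm (norm (?c n) * exp (Re (?L n z) + 1 * ?M n))) summable_on UNIV"
    proof (rule Infinite_Sum.abs_summable_on_comparison_test'[OF s[of z "2 * pi"]])
      fix n
      have "norm (norm (?c n) * exp (Re (?L n z) + 1 * ?M n)) =
        norm (c n) * exp (Re (theta_exponent \<tau> z n) + ?M n)"
        by (simp add: norm_mult theta_exponent_def exp_add[symmetric])
      also have "\<dots> \<le> norm (c n) * exp (Re (theta_exponent \<tau> z n) +
          (2 * pi * norm (rvec n) + \<delta> * (norm (rvec n))\<^sup>2))"
        using \<delta> by (intro mult_left_mono) auto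
      finally show "norm (norm (?c n) * exp (Re (?L n z) + 1 * ?M n)) \<le> norm (c n) *
        exp (Re (theta_exponent \<tau> z n) + (2 * pi * norm (rvec n) + \<delta> * (norm (rvec n))\<^sup>2))" .
    qed
    then show ?thesis by simp
  qed
  have "((\<lambda>y. \<Sum>\<^sub>\<infinity>n. ?c n * exp (?L n y)) has_derivative
           (\<lambda>h. \<Sum>\<^sub>\<infinity>n. ?c n * ?L n h * exp (?L n z))) (at z)"
  proof (rule exp_series_has_derivative[where M = ?M and \<delta> = 1])
    show "linear (?L n)" for n
      by (rule linearI) (simp_all add: cbil_simps algebra_simps scaleR_conv_of_real[where 'a = complex])
    show "norm (?L n h) \<le> ?M n * norm h" for n h
      using cbil_bound[of "ivec n" h] by (simp add: norm_mult)
  qed (use sum in auto)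
  moreover have "(\<lambda>y. \<Sum>\<^sub>\<infinity>n. ?c n * exp (?L n y)) = theta_series c \<tau>"
    by (simp add: theta_series_def theta_exponent_def exp_add mult.assoc fun_eq_iff)
  moreover have "(\<lambda>h. \<Sum>\<^sub>\<infinity>n. ?c n * ?L n h * exp (?L n z)) =
      (\<lambda>h. theta_series (\<lambda>n. c n * (2 * of_real pi * \<i> * cbil (ivec n) h)) \<tau> z)"
    by (simp add: theta_series_def theta_exponent_def exp_add mult_ac fun_eq_iff)
  ultimately show ?thesis by simp
qed

text \<open>Differentiation in the matrix multiplies the term of index \<^term>\<open>n\<close> by a quadratic form
  in \<^term>\<open>n\<close>, hence acts as a second derivative in \<^term>\<open>z\<close>: this is the heat equation.\<close>

lemma theta_series_has_derivative_matrix: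
  assumes "pos_im \<tau>" "poly_bounded c"
  shows "((\<lambda>\<tau>. theta_series c \<tau> z) has_derivative
    (\<lambda>\<eta>. theta_series (\<lambda>n. c n * (of_real pi * \<i> * qform \<eta> n)) \<tau> z)) (at \<tau>)"
proof -
  obtain \<delta> where \<delta>: "\<delta> > 0" and s: "\<And>\<mu> z. (\<lambda>n. norm (c n) * exp (Re (theta_exponent \<tau> z n) +
      (\<mu> * norm (rvec n) + \<delta> * (norm (rvec n))\<^sup>2))) summable_on UNIV"
    using theta_series_majorant[OF assms] by blast
  let ?c = "\<lambda>n. c n * exp (2 * of_real pi * \<i> * cbil (ivec n) z)"
  let ?L = "\<lambda>n \<tau>. of_real pi * \<i> * qform \<tau> n"
  let ?M = "\<lambda>n. pi * (norm (rvec n))\<^sup>2"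
  have "((\<lambda>y. \<Sum>\<^sub>\<infinity>n. ?c n * exp (?L n y)) has_derivative
           (\<lambda>h. \<Sum>\<^sub>\<infinity>n. ?c n * ?L n h * exp (?L n \<tau>))) (at \<tau>)"
  proof (rule exp_series_has_derivative[where M = ?M and \<delta> = "\<delta> / pi"])
    show "linear (?L n)" for n
    proof (rule linearI)
      show "?L n (a + b) = ?L n a + ?L n b" for a b
        by (simp add: linear_add[OF qform_linear] algebra_simps)
      show "?L n (r *\<^sub>R b) = r *\<^sub>R ?L n b" for r b
        by (simp add: qform_scaleR scaleR_conv_of_real[where 'a = complex])
    qed
    show "norm (?L n h) \<le> ?M n * norm h" for n h
      using qform_bound[of h n] by (simp add: norm_mult)
    have "norm (?c n) * exp (Re (?L n \<tau>) + \<delta> / pi * ?M n) = norm (c n) * exp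
      (Re (theta_exponent \<tau> z n) + (0 * norm (rvec n) + \<delta> * (norm (rvec n))\<^sup>2))" for n
      by (simp add: norm_mult theta_exponent_def exp_add[symmetric])
    then show "(\<lambda>n. norm (?c n) * exp (Re (?L n \<tau>) + \<delta> / pi * ?M n)) summable_on UNIV"
      using s[of z 0] by simp
  qed (use \<delta> in auto)
  moreover have "(\<lambda>y. \<Sum>\<^sub>\<infinity>n. ?c n * exp (?L n y)) = (\<lambda>\<tau>. theta_series c \<tau> z)"
    by (simp add: theta_series_def theta_exponent_def exp_add mult_ac fun_eq_iff)
  moreover have "(\<lambda>h. \<Sum>\<^sub>\<infinity>n. ?c n * ?L n h * exp (?L n \<tau>)) =
      (\<lambda>\<eta>. theta_series (\<lambda>n. c n * (of_real pi * \<i> * qform \<eta> n)) \<tau> z)"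
    by (simp add: theta_series_def theta_exponent_def exp_add mult_ac fun_eq_iff)
  ultimately show ?thesis by simp
qed

section \<open>Entire functions of several variables\<close>

text \<open>Continuity and holomorphy on every complex line, which by a lemma of Osgood is the usual notion.
  In this form it passes easily to quotients, where nothing is known beforehand about Frechet
  derivatives, and it is what the Fourier argument consumes.\<close>

definition entire :: "(complex^'g \<Rightarrow> complex) \<Rightarrow> bool" where
  "entire f \<longleftrightarrow> continuous_on UNIV f \<and> (\<forall>x v. (\<lambda>t. f (x + t *s v)) holomorphic_on UNIV)"

definition dir_deriv :: "complex^'g \<Rightarrow> (complex^'g \<Rightarrow> complex) \<Rightarrow> complex^'g \<Rightarrow> complex" where
  "dir_deriv v f z = deriv (\<lambda>t. f (z + t *s v)) 0"

lemma continuous_on_vector_scalar_mult [continuous_intros]: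
  fixes f :: "'a::topological_space \<Rightarrow> complex" and g :: "'a \<Rightarrow> complex^'n"
  assumes "continuous_on S f" "continuous_on S g"
  shows "continuous_on S (\<lambda>x. f x *s g x)"
  unfolding vector_scalar_mult_def using assms by (intro continuous_intros)

lemma continuous_on_cbil [continuous_intros]:
  assumes "continuous_on S f" "continuous_on S g"
  shows "continuous_on S (\<lambda>x. cbil (f x) (g x))"
  unfolding cbil_def using assms by (intro continuous_intros)

lemma continuous_on_matrix_vector_mult_complex [continuous_intros]:
  fixes A :: "complex^'n^'m"
  assumes "continuous_on S f"
  shows "continuous_on S (\<lambda>x. A *v f x)"
  unfolding matrix_vector_mult_def using assms by (intro continuous_intros)

lemma entire_line: "entire f \<Longrightarrow> (\<lambda>t. f (x + t *s v)) holomorphic_on S"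
  unfolding entire_def using holomorphic_on_subset by blast

lemma entire_continuous: "entire f \<Longrightarrow> continuous_on S f"
  unfolding entire_def using continuous_on_subset by blast

lemma entire_const [intro, simp]: "entire (\<lambda>z. a)"
  by (simp add: entire_def)

lemma entire_add [intro]: "entire f \<Longrightarrow> entire g \<Longrightarrow> entire (\<lambda>z. f z + g z)"
  unfolding entire_def by (auto intro!: continuous_intros holomorphic_intros)

lemma entire_diff [intro]: "entire f \<Longrightarrow> entire g \<Longrightarrow> entire (\<lambda>z. f z - g z)"
  unfolding entire_def by (auto intro!: continuous_intros holomorphic_intros)

lemma entire_mult [intro]: "entire f \<Longrightarrow> entire g \<Longrightarrow> entire (\<lambda>z. f z * g z)"
  unfolding entire_def by (auto intro!: continuous_intros holomorphic_intros)

lemma entire_exp [intro]: "entire f \<Longrightarrow> entire (\<lambda>z. exp (f z))"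
  unfolding entire_def by (auto intro!: continuous_intros holomorphic_intros)

lemma entire_cbil [intro]: "entire (\<lambda>z. cbil a z)"
  unfolding entire_def by (auto simp: cbil_simps intro!: continuous_intros holomorphic_intros)

lemma entire_quadratic [intro]: "entire (\<lambda>z. cbil z (A *v z))"
  unfolding entire_def
  by (auto simp: cbil_simps matrix_vector_right_distrib vector_scalar_commute
      intro!: continuous_intros holomorphic_intros)

lemma entire_affine [intro]:
  assumes "entire f"
  shows "entire (\<lambda>z. f (A *v z + b))"
  unfolding entire_def
proof (intro conjI allI)
  have "continuous_on UNIV f" using assms by (simp add: entire_def)
  then show "continuous_on UNIV (\<lambda>z. f (A *v z + b))"
    by (rule continuous_on_compose2) (auto intro!: continuous_intros)
  show "(\<lambda>t. f (A *v (x + t *s v) + b)) holomorphic_on UNIV" for x v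
    using entire_line[OF assms, of "A *v x + b" "A *v v"]
    by (simp add: matrix_vector_right_distrib vector_scalar_commute add_ac)
qed

lemma entire_translate [intro]: "entire f \<Longrightarrow> entire (\<lambda>z. f (z + b))"
  using entire_affine[of f "mat 1" b] by simp

lemma entire_line_derivative:
  assumes "entire f"
  shows "((\<lambda>t. f (z + t *s v)) has_field_derivative dir_deriv v f (z + t *s v)) (at t)"
proof -
  let ?g = "\<lambda>s. f ((z + t *s v) + s *s v)"
  have "(?g has_field_derivative deriv ?g 0) (at (t - t))"
    using holomorphic_derivI[OF entire_line[OF assms] open_UNIV UNIV_I, of _ _ 0] by simp
  then have "((\<lambda>s. ?g (s - t)) has_field_derivative deriv ?g 0) (at t)"
    by (rule DERIV_chain'[where f = "\<lambda>s. s - t" and D = 1, simplified, rotated])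
      (auto intro!: derivative_eq_intros)
  moreover have "(\<lambda>s. ?g (s - t)) = (\<lambda>t. f (z + t *s v))"
    by (auto simp: fun_eq_iff vec_eq_iff algebra_simps intro!: arg_cong[of _ _ f])
  ultimately show ?thesis by (simp add: dir_deriv_def)
qed

text \<open>The Cauchy integral over a unit circle in the given direction depends continuously on its centre.\<close>

lemma entire_dir_deriv_continuous:
  assumes "entire f"
  shows "continuous_on UNIV (dir_deriv v f)"
proof -
  have eq: "dir_deriv v f z = (1 / (2 * of_real pi * \<i>)) *
      integral (cbox 0 1) (\<lambda>s. f (z + exp (2 * of_real pi * \<i> * of_real s) *s v) /
        (exp (2 * of_real pi * \<i> * of_real s))\<^sup>2 *
        (2 * of_real pi * \<i> * exp (2 * of_real pi * \<i> * of_real s)))" for z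
  proof -
    let ?g = "\<lambda>t. f (z + t *s v)"
    have "(?g has_field_derivative (1 / (2 * of_real pi * \<i>) *
        contour_integral (circlepath 0 1) (\<lambda>u. ?g u / (u - 0)^2))) (at 0)"
      by (rule Cauchy_derivative_integral_circlepath)
        (use assms in \<open>auto intro: entire_line holomorphic_on_imp_continuous_on\<close>)
    then have "dir_deriv v f z = 1 / (2 * of_real pi * \<i>) *
        contour_integral (circlepath 0 1) (\<lambda>u. ?g u / (u - 0)^2)"
      unfolding dir_deriv_def by (rule DERIV_imp_deriv)
    then show ?thesis
      unfolding contour_integral_integral vector_derivative_circlepath
      by (simp add: circlepath mult_ac)
  qed
  have c: "continuous_on UNIV f" using assms by (simp add: entire_def)
  show ?thesis unfolding eq
    by (intro continuous_intros integral_continuous_on_param)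
      (auto simp: split_beta intro!: continuous_intros continuous_on_compose2[OF c])
qed

subsection \<open>Theta series are entire in the vector variable\<close>

lemma theta_series_cmult: "theta_series (\<lambda>n. a * c n) \<tau> z = a * theta_series c \<tau> z"
  by (simp add: theta_series_def mult.assoc infsum_cmult_right')

lemma theta_series_add:
  assumes "pos_im \<tau>" "poly_bounded c" "poly_bounded d"
  shows "theta_series (\<lambda>n. c n + d n) \<tau> z = theta_series c \<tau> z + theta_series d \<tau> z"
  using infsum_add[OF theta_series_summable[OF assms(1,2)] theta_series_summable[OF assms(1,3)]]
  by (simp add: theta_series_def distrib_right)

lemma theta_series_diff:
  assumes "pos_im \<tau>" "poly_bounded c" "poly_bounded d"
  shows "theta_series (\<lambda>n. c n - d n) \<tau> z = theta_series c \<tau> z - theta_series d \<tau> z"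
  using theta_series_add[OF assms(1,2) poly_bounded_cmult[OF assms(3), of "-1"]]
    theta_series_cmult[of "-1" d] by simp

lemma theta_series_zero [simp]: "theta_series (\<lambda>n. 0) \<tau> z = 0"
  by (simp add: theta_series_def)

lemma theta_series_sum:
  assumes "pos_im \<tau>" "\<And>a. a \<in> A \<Longrightarrow> poly_bounded (c a)"
  shows "theta_series (\<lambda>n. \<Sum>a\<in>A. c a n) \<tau> z = (\<Sum>a\<in>A. theta_series (c a) \<tau> z)"
  using assms(2)
proof (induction A rule: infinite_finite_induct)
  case (insert x A)
  then show ?case
    by (simp add: theta_series_add[OF assms(1)] poly_bounded_sum)
qed auto

lemma poly_bounded_deriv [intro]:
  "poly_bounded c \<Longrightarrow> poly_bounded (\<lambda>n. c n * (2 * of_real pi * \<i> * cbil (ivec n) v))"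
  by (intro poly_bounded_mult poly_bounded_cbil poly_bounded_const)

lemma bounded_linear_scale_vector: "bounded_linear (\<lambda>t. t *s v)" for v :: "complex^'n"
  by (rule bounded_linear_intro[where K = "norm v"])
    (auto simp: vec_eq_iff algebra_simps norm_vec_def norm_mult L2_set_right_distrib
      scaleR_conv_of_real[where 'a = complex])

lemma theta_series_line_derivative:
  assumes "pos_im \<tau>" "poly_bounded c"
  shows "((\<lambda>t. theta_series c \<tau> (z + t *s v)) has_field_derivative
    theta_series (\<lambda>n. c n * (2 * of_real pi * \<i> * cbil (ivec n) v)) \<tau> (z + t *s v)) (at t)"
proof -
  have "((\<lambda>t. z + t *s v) has_derivative (\<lambda>h. h *s v)) (at t)"
    using has_derivative_add[OF has_derivative_const bounded_linear_imp_has_derivative[OF bounded_linear_scale_vector]]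
    by simp
  from has_derivative_compose[OF this theta_series_has_derivative[OF assms]]
  have "((\<lambda>t. theta_series c \<tau> (z + t *s v)) has_derivative (\<lambda>h. theta_series
    (\<lambda>n. c n * (2 * of_real pi * \<i> * cbil (ivec n) (h *s v))) \<tau> (z + t *s v))) (at t)" .
  moreover have "theta_series (\<lambda>n. c n * (2 * of_real pi * \<i> * cbil (ivec n) (h *s v))) \<tau> w =
      theta_series (\<lambda>n. c n * (2 * of_real pi * \<i> * cbil (ivec n) v)) \<tau> w * h" for h w
    by (simp add: theta_series_cmult[symmetric] mult.commute[of _ h] cbil_scale_right mult_ac)
  ultimately show ?thesis by (simp add: has_field_derivative_def)
qed

lemma entire_theta_series [intro]:
  assumes "pos_im \<tau>" "poly_bounded c"
  shows "entire (theta_series c \<tau>)"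
  unfolding entire_def
proof (intro conjI allI)
  show "continuous_on UNIV (theta_series c \<tau>)"
    using theta_series_has_derivative[OF assms] has_derivative_continuous
    by (intro continuous_at_imp_continuous_on ballI) blast
  show "(\<lambda>t. theta_series c \<tau> (x + t *s v)) holomorphic_on UNIV" for x v
    using theta_series_line_derivative[OF assms]
    by (auto simp: holomorphic_on_def field_differentiable_def)
qed

lemma dir_deriv_theta_series:
  assumes "pos_im \<tau>" "poly_bounded c"
  shows "dir_deriv v (theta_series c \<tau>) =
    theta_series (\<lambda>n. c n * (2 * of_real pi * \<i> * cbil (ivec n) v)) \<tau>"
  using DERIV_imp_deriv[OF theta_series_line_derivative[OF assms, of _ v 0]]
  by (simp add: dir_deriv_def fun_eq_iff)

section \<open>Fourier coefficients of periodic entire functions\<close>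

definition cvec :: "real^'g \<Rightarrow> complex^'g" where
  "cvec x = (\<chi> i. complex_of_real (x $ i))"

lemma continuous_on_cvec [continuous_intros]:
  "continuous_on S f \<Longrightarrow> continuous_on S (\<lambda>x. cvec (f x))"
  unfolding cvec_def by (intro continuous_intros)

lemma cvec_simps [simp]:
  "cvec 0 = 0" "cvec (x + y) = cvec x + cvec y"
  "cvec (axis i r) = axis i (of_real r)" "cvec (r *\<^sub>R x) = of_real r *s cvec x"
  by (auto simp: cvec_def vec_eq_iff axis_def)

text \<open>The fundamental domain of the real torus that is centred at the origin, where the kernel used for
  uniqueness concentrates.\<close>

definition unit_box :: "(real^'g) set" where
  "unit_box = cbox (\<chi> i. -1/2) (\<chi> i. 1/2)"

lemma mem_unit_box: "x \<in> unit_box \<longleftrightarrow> (\<forall>i. \<bar>x $ i\<bar> \<le> 1/2)"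
proof -
  have "-1/2 \<le> y \<and> y \<le> 1/2 \<longleftrightarrow> \<bar>y\<bar> \<le> 1/2" for y :: real by auto
  then show ?thesis by (simp only: unit_box_def mem_box_cart vec_lambda_beta)
qed

lemma compact_unit_box: "compact unit_box"
  by (simp add: unit_box_def)

definition torus_mean :: "(complex^'g \<Rightarrow> complex) \<Rightarrow> complex^'g \<Rightarrow> complex" where
  "torus_mean G z = integral unit_box (\<lambda>x. G (z + cvec x))"

text \<open>The shifted box is cut at the old boundary, and the part outside is moved back by a period.\<close>

lemma integral_periodic_shift:
  fixes h :: "real^'g \<Rightarrow> complex"
  assumes cont: "continuous_on UNIV h" and per: "\<And>x. h (x + axis i 1) = h x"
    and s: "0 \<le> s" "s \<le> 1"
  shows "integral unit_box (\<lambda>x. h (x + axis i s)) = integral unit_box h"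
proof -
  define a b where "a = ((\<chi> j. -1/2) :: real^'g)" and "b = ((\<chi> j. 1/2) :: real^'g)"
  define e where "e = (axis i s :: real^'g)"
  define b' where "b' = ((\<chi> j. if j = i then s - 1/2 else 1/2) :: real^'g)"
  have int: "h integrable_on cbox u v" for u v
    by (rule integrable_continuous) (rule continuous_on_subset[OF cont], simp)
  define I1 I2 where "I1 = integral (cbox a b') h" and "I2 = integral (cbox (a + e) b) h"
  have ib: "axis i 1 \<in> (Basis :: (real^'g) set)" by (simp add: axis_in_Basis_iff)
  have shift: "integral (cbox u v) (\<lambda>x. h (x + w)) = integral (cbox (u + w) (v + w)) h" for u v w
    using integral_shift_cbox_plus[of u v h w] by (simp add: o_def add.commute)
  have "integral (cbox (a + axis i 1) (b' + axis i 1)) h = integral (cbox a b') (\<lambda>x. h (x + axis i 1))"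
    by (rule shift[symmetric])
  then have I1': "integral (cbox (a + axis i 1) (b' + axis i 1)) h = I1"
    by (simp add: per I1_def)
  have inner: "x \<bullet> axis i 1 = x $ i" for x :: "real^'g" by (simp add: inner_axis)
  have all_conj: "(\<forall>j. P j) \<and> Q \<longleftrightarrow> (\<forall>j. P j \<and> (j = i \<longrightarrow> Q))" for P :: "'g \<Rightarrow> bool" and Q
    by auto
  note box = set_eq_iff Int_iff mem_Collect_eq inner mem_box_cart all_conj
  have s1: "cbox a b \<inter> {x. x \<bullet> axis i 1 \<le> s - 1/2} = cbox a b'"
    unfolding box by (intro allI all_cong1) (use s in \<open>auto simp: a_def b_def b'_def e_def axis_def\<close>)
  have s2: "cbox a b \<inter> {x. x \<bullet> axis i 1 \<ge> s - 1/2} = cbox (a + e) b"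
    unfolding box by (intro allI all_cong1) (use s in \<open>auto simp: a_def b_def b'_def e_def axis_def\<close>)
  have s3: "cbox (a + e) (b + e) \<inter> {x. x \<bullet> axis i 1 \<le> 1/2} = cbox (a + e) b"
    unfolding box by (intro allI all_cong1) (use s in \<open>auto simp: a_def b_def b'_def e_def axis_def\<close>)
  have s4: "cbox (a + e) (b + e) \<inter> {x. x \<bullet> axis i 1 \<ge> 1/2} = cbox (a + axis i 1) (b' + axis i 1)"
    unfolding box by (intro allI all_cong1) (use s in \<open>auto simp: a_def b_def b'_def e_def axis_def\<close>)
  have "(h has_integral I1 + I2) (cbox a b)"
    by (rule has_integral_split[OF _ _ ib, where c = "s - 1/2"])
      (simp_all only: s1 s2 I1_def I2_def integrable_integral[OF int])
  moreover have "(h has_integral I2 + I1) (cbox (a + e) (b + e))"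
    by (rule has_integral_split[OF _ _ ib, where c = "1/2"])
      (simp_all only: s3 s4 I1'[symmetric] I2_def integrable_integral[OF int])
  ultimately have "integral (cbox (a + e) (b + e)) h = integral (cbox a b) h"
    by (simp add: integral_unique add.commute)
  then show ?thesis
    using shift[of a b e] by (simp add: unit_box_def a_def b_def e_def)
qed

text \<open>The mean over real translates does not see real translations, by periodicity; it depends
  holomorphically on each coordinate, so it does not see complex translations either.\<close>

lemma torus_mean_constant:
  fixes G :: "complex^'g \<Rightarrow> complex"
  assumes G: "entire G" and per: "\<And>z n. G (z + ivec n) = G z"
  shows "torus_mean G z = torus_mean G w"
proof -
  have coord: "torus_mean G (z + axis i t) = torus_mean G z" for z i t
  proof -
    let ?F = "\<lambda>s. torus_mean G (z + axis i s) - torus_mean G z"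
    have c: "continuous_on UNIV G" using entire_continuous[OF G] .
    have ax: "axis i s = s *s axis i (1::complex)" for s
      by (simp add: vec_eq_iff axis_def)
    have eq: "G (z + axis i s + cvec x) = G (z + cvec x + s *s axis i 1)" for s x
      by (subst ax) (simp only: ac_simps)
    have "(\<lambda>s. torus_mean G (z + axis i s)) holomorphic_on UNIV"
      unfolding torus_mean_def unit_box_def
    proof (rule leibniz_rule_holomorphic)
      show "((\<lambda>s. G (z + axis i s + cvec x)) has_field_derivative
          dir_deriv (axis i 1) G (z + cvec x + s *s axis i 1)) (at s within UNIV)" for s x
        using entire_line_derivative[OF G, of "z + cvec x" "axis i 1" s]
        unfolding eq by simp
      show "(\<lambda>x. G (z + axis i s + cvec x)) integrable_on cbox (\<chi> i. - 1 / 2) (\<chi> i. 1 / 2)" for s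
        unfolding eq
        by (intro integrable_continuous continuous_on_compose2[OF c] continuous_intros) auto
      show "continuous_on (UNIV \<times> cbox (\<chi> i. - 1 / 2) (\<chi> i. 1 / 2))
          (\<lambda>(s, x). dir_deriv (axis i 1) G (z + cvec x + s *s axis i 1))"
        unfolding split_beta
        by (intro continuous_on_compose2[OF entire_dir_deriv_continuous[OF G]] continuous_intros) auto
    qed simp
    then have hol: "?F holomorphic_on UNIV" by (intro holomorphic_intros)
    have real: "?F (of_real s) = 0" if "0 \<le> s" "s \<le> 1" for s :: real
    proof -
      have per': "G (z + cvec (x + axis i 1)) = G (z + cvec x)" for x
        using per[of "z + cvec x" "axis i 1"] by (simp add: add_ac)
      have "integral unit_box (\<lambda>x. G (z + cvec (x + axis i s))) = integral unit_box (\<lambda>x. G (z + cvec x))"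
        by (rule integral_periodic_shift[where h = "\<lambda>x. G (z + cvec x)", OF _ per' that])
          (intro continuous_on_compose2[OF c] continuous_intros, auto)
      then show ?thesis by (simp add: torus_mean_def add_ac)
    qed
    have "?F t = 0"
    proof (rule analytic_continuation[OF hol])
      show "0 islimpt (complex_of_real ` {0..1})"
        unfolding islimpt_approachable
      proof (intro allI impI)
        fix e :: real assume "e > 0"
        then show "\<exists>x'\<in>complex_of_real ` {0..1}. x' \<noteq> 0 \<and> dist x' 0 < e"
          by (intro bexI[of _ "complex_of_real (min 1 (e / 2))"]) (auto simp: min_def)
      qed
    qed (use real in auto)
    then show ?thesis by simp
  qed
  have all: "torus_mean G (u + (\<Sum>i\<in>A. axis i (v $ i))) = torus_mean G u"
    if "finite A" for A :: "'g set" and u v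
    using that
  proof (induction A)
    case (insert i A)
    then show ?case
      using coord[of "u + (\<Sum>i\<in>A. axis i (v $ i))" i "v $ i"] by (simp add: add_ac)
  qed simp
  have sum: "(\<Sum>i\<in>UNIV. axis i (v $ i)) = v" for v :: "complex^'g"
    by (simp add: vec_eq_iff axis_def)
  show ?thesis using all[of UNIV 0 z] all[of UNIV 0 w] by (simp add: sum)
qed

definition fourier_coeff :: "(complex^'g \<Rightarrow> complex) \<Rightarrow> int^'g \<Rightarrow> complex" where
  "fourier_coeff f n = torus_mean (\<lambda>z. f z * exp (- (2 * of_real pi * \<i> * cbil (ivec n) z))) 0"

lemma exp_cbil_period:
  "exp (- (2 * of_real pi * \<i> * cbil (ivec n) (z + ivec m))) =
    exp (- (2 * of_real pi * \<i> * cbil (ivec n) z))"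
proof -
  have "- (2 * of_real pi * \<i> * cbil (ivec n) (z + ivec m)) =
      - (2 * of_real pi * \<i> * cbil (ivec n) z) - 2 * of_real pi * \<i> * cbil (ivec n) (ivec m)"
    by (simp add: cbil_add_right algebra_simps)
  then show ?thesis by (simp only: exp_diff exp_cbil_ivec div_by_1)
qed

lemma fourier_coeff_at:
  assumes "entire f" "\<And>z n. f (z + ivec n) = f z"
  shows "torus_mean (\<lambda>z. f z * exp (- (2 * of_real pi * \<i> * cbil (ivec n) z))) w = fourier_coeff f n"
  unfolding fourier_coeff_def
proof (rule torus_mean_constant)
  have "entire (\<lambda>z. exp (cbil (- ((2 * of_real pi * \<i>) *s ivec n)) z))" by (intro entire_exp entire_cbil)
  then show "entire (\<lambda>z. f z * exp (- (2 * of_real pi * \<i> * cbil (ivec n) z)))"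
    using assms(1) by (auto simp: cbil_simps)
qed (simp only: assms(2) exp_cbil_period)

text \<open>Translation by half a period of a nontrivial character changes its sign but not its mean.\<close>

lemma integral_unit_box_exp:
  "integral unit_box (\<lambda>x. exp (2 * of_real pi * \<i> * cbil (ivec k) (cvec x))) = (if k = 0 then 1 else 0)"
proof (cases "k = 0")
  case True
  have "measure lborel (unit_box :: (real^'a) set) = 1"
    unfolding unit_box_def
    by (subst content_cbox_cart) (auto simp: interval_eq_empty_cart)
  then show ?thesis using True by (simp add: unit_box_def)
next
  case False
  then obtain i where i: "k $ i \<noteq> 0" by (auto simp: vec_eq_iff)
  let ?G = "\<lambda>z. exp (2 * of_real pi * \<i> * cbil (ivec k) z)"
  have "entire (\<lambda>z. exp (cbil ((2 * of_real pi * \<i>) *s ivec k) z))" by (intro entire_exp entire_cbil)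
  then have ent: "entire ?G" by (simp add: cbil_simps)
  define z :: "complex^'a" where "z = axis i (1 / (2 * of_int (k $ i)))"
  have neg: "?G (z + y) = - ?G y" for y
  proof -
    have "2 * of_real pi * \<i> * cbil (ivec k) z = of_real pi * \<i>"
      using i by (simp add: z_def cbil_axis ivec_def)
    then have "exp (2 * of_real pi * \<i> * cbil (ivec k) z) = -1" by (simp only: exp_pi_i)
    then show ?thesis by (simp only: cbil_add_right distrib_left exp_add mult_minus1)
  qed
  have "torus_mean ?G (0 + z) = - torus_mean ?G 0"
    by (simp only: torus_mean_def add_0 neg integral_neg)
  moreover have "torus_mean ?G (0 + z) = torus_mean ?G 0"
  proof (rule torus_mean_constant[OF ent])
    show "?G (z + ivec n) = ?G z" for z n
      by (simp only: cbil_add_right distrib_left exp_add exp_cbil_ivec mult_1_right)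
  qed
  ultimately have "torus_mean ?G 0 = 0" by simp
  then show ?thesis using False by (simp add: torus_mean_def)
qed

text \<open>On the real torus the series converges uniformly, so it can be integrated term by term.\<close>

lemma fourier_coeff_theta_series:
  assumes "pos_im \<tau>" "poly_bounded c"
  shows "fourier_coeff (theta_series c \<tau>) n = c n * exp (of_real pi * \<i> * qform \<tau> n)"
proof -
  define T where "T = (\<lambda>m x. c m * exp (of_real pi * \<i> * qform \<tau> m) *
    exp (2 * of_real pi * \<i> * cbil (ivec (m - n)) (cvec x)))"
  have bound: "norm (T m x) \<le> norm (c m * exp (theta_exponent \<tau> 0 m))" for m x
  proof -
    have "Re (2 * of_real pi * \<i> * cbil (ivec (m - n)) (cvec x)) = 0"
      by (simp add: cbil_def cvec_def ivec_def)
    then show ?thesis by (simp add: T_def norm_mult theta_exponent_def)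
  qed
  have sm: "(\<lambda>m. norm (c m * exp (theta_exponent \<tau> 0 m))) summable_on UNIV"
    using summable_on_iff_abs_summable_on_complex[THEN iffD1, OF theta_series_summable[OF assms]]
    by simp
  have ul: "uniform_limit (cbox (\<chi> i. -1/2) (\<chi> i. 1/2)) (\<lambda>X x. \<Sum>m\<in>X. T m x) (\<lambda>x. \<Sum>\<^sub>\<infinity>m. T m x)
      (finite_subsets_at_top UNIV)"
    by (rule Weierstrass_m_test_general[OF bound sm])
  obtain I J where IJ: "\<And>X. ((\<lambda>x. \<Sum>m\<in>X. T m x) has_integral I X) (cbox (\<chi> i. -1/2) (\<chi> i. 1/2))"
    "((\<lambda>x. \<Sum>\<^sub>\<infinity>m. T m x) has_integral J) (cbox (\<chi> i. -1/2) (\<chi> i. 1/2))"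
    "(I \<longlongrightarrow> J) (finite_subsets_at_top UNIV)"
    by (rule uniform_limit_integral_cbox[OF ul])
      (auto simp: T_def intro!: continuous_intros)
  have cont: "T m integrable_on unit_box" for m
    unfolding T_def unit_box_def by (intro integrable_continuous continuous_intros)
  have IT: "integral unit_box (T m) = (if m = n then c n * exp (of_real pi * \<i> * qform \<tau> n) else 0)" for m
    using integral_unit_box_exp[of "m - n"] by (simp add: T_def)
  have "I X = (\<Sum>m\<in>X. integral unit_box (T m))" if "finite X" for X
    using integral_unique[OF IJ(1)[of X]] integral_sum[OF that, of T unit_box] cont
    by (simp add: unit_box_def)
  then have "I X = c n * exp (of_real pi * \<i> * qform \<tau> n)" if "finite X" "n \<in> X" for X
    using that by (simp add: IT)
  then have "eventually (\<lambda>X. I X = c n * exp (of_real pi * \<i> * qform \<tau> n)) (finite_subsets_at_top UNIV)"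
    by (auto simp: eventually_finite_subsets_at_top intro!: exI[of _ "{n}"])
  then have "(I \<longlongrightarrow> c n * exp (of_real pi * \<i> * qform \<tau> n)) (finite_subsets_at_top UNIV)"
    by (rule tendsto_eventually)
  then have "J = c n * exp (of_real pi * \<i> * qform \<tau> n)"
    using tendsto_unique[OF _ IJ(3)] by simp
  moreover have "(\<Sum>\<^sub>\<infinity>m. T m x) = theta_series c \<tau> (cvec x) * exp (- (2 * of_real pi * \<i> * cbil (ivec n) (cvec x)))" for x
  proof -
    have "T m x = c m * exp (theta_exponent \<tau> (cvec x) m) *
        exp (- (2 * of_real pi * \<i> * cbil (ivec n) (cvec x)))" for m
      by (simp add: T_def theta_exponent_def cbil_simps exp_add[symmetric] mult.assoc
          right_diff_distrib add_diff_eq)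
    then show ?thesis by (simp add: theta_series_def infsum_cmult_left')
  qed
  ultimately show ?thesis
    using integral_unique[OF IJ(2)] by (simp add: fourier_coeff_def torus_mean_def unit_box_def)
qed

text \<open>Uniqueness of Fourier coefficients: powers of \<^term>\<open>\<Prod>i\<in>UNIV. (cos (pi * x $ i))\<^sup>2\<close> are
  trigonometric polynomials that concentrate at the centre of the unit box.\<close>

lemma vanishing_fourier_integrals_imp_zero:
  fixes h :: "real^'g \<Rightarrow> complex"
  assumes cont: "continuous_on UNIV h"
    and zero: "\<And>n. integral unit_box (\<lambda>x. h x * exp (2 * of_real pi * \<i> * cbil (ivec n) (cvec x))) = 0"
  shows "h 0 = 0"
proof (rule ccontr)
  assume h0: "h 0 \<noteq> 0"
  let ?e = "\<lambda>n x. exp (2 * of_real pi * \<i> * cbil (ivec n) (cvec x))"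
  define K where "K = (\<lambda>x::real^'g. \<Prod>i\<in>UNIV. (cos (pi * x $ i))\<^sup>2)"
  define annihilated where "annihilated = (\<lambda>\<phi>. continuous_on UNIV \<phi> \<and>
      (\<forall>n. integral unit_box (\<lambda>x. h x * \<phi> x * ?e n x) = 0))"
  have int: "f integrable_on unit_box" if "continuous_on UNIV f" for f :: "real^'g \<Rightarrow> complex"
    unfolding unit_box_def by (rule integrable_continuous) (rule continuous_on_subset[OF that], simp)
  have intr: "f integrable_on unit_box" if "continuous_on UNIV f" for f :: "real^'g \<Rightarrow> real"
    unfolding unit_box_def by (rule integrable_continuous) (rule continuous_on_subset[OF that], simp)
  \<comment> \<open>The squared cosine is a combination of characters, and multiplication by those permutes the
    integrals that vanish by hypothesis.\<close>
  have step: "annihilated (\<lambda>x. \<phi> x * of_real ((cos (pi * x $ i))\<^sup>2))" if "annihilated \<phi>" for \<phi> i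
  proof -
    have c: "continuous_on UNIV \<phi>" using that by (simp add: annihilated_def)
    have cos2: "of_real ((cos (pi * x $ i))\<^sup>2) = 1/2 + (?e (axis i 1) x + ?e (- axis i 1) x) / 4" for x
    proof -
      define a b where "a = exp (\<i> * of_real (pi * x $ i))" and "b = exp (- (\<i> * of_real (pi * x $ i)))"
      have ab: "a * b = 1" by (simp add: a_def b_def exp_minus)
      have "of_real (cos (pi * x $ i)) = (a + b) / 2"
        unfolding a_def b_def cos_of_real[symmetric] cos_exp_eq by simp
      then have "of_real ((cos (pi * x $ i))\<^sup>2) = ((a + b) / 2)\<^sup>2"
        by (simp only: of_real_power)
      also have "\<dots> = 1/2 + (a\<^sup>2 + b\<^sup>2) / 4"
        using ab by (simp add: power2_eq_square field_simps)
      also have "a\<^sup>2 = ?e (axis i 1) x"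
        unfolding a_def exp_double[symmetric] by (simp add: cbil_axis cvec_def mult_ac)
      also have "b\<^sup>2 = ?e (- axis i 1) x"
        unfolding b_def exp_double[symmetric] by (simp add: cbil_axis cvec_def cbil_minus_left mult_ac)
      finally show ?thesis .
    qed
    have e_add: "?e n x * ?e m x = ?e (n + m) x" for n m x
      by (simp add: cbil_simps distrib_left exp_add)
    have "integral unit_box (\<lambda>x. h x * (\<phi> x * of_real ((cos (pi * x $ i))\<^sup>2)) * ?e n x) = 0" for n
    proof -
      have eq: "h x * (\<phi> x * of_real ((cos (pi * x $ i))\<^sup>2)) * ?e n x =
          1/2 * (h x * \<phi> x * ?e n x) + (1/4 * (h x * \<phi> x * ?e (n + axis i 1) x)
            + 1/4 * (h x * \<phi> x * ?e (n + (- axis i 1)) x))" for x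
        unfolding cos2 e_add[symmetric] by (simp add: algebra_simps)
      have ci: "(\<lambda>x. h x * \<phi> x * ?e m x) integrable_on unit_box" for m
        by (intro int continuous_intros cont c)
      have "integral unit_box (\<lambda>x. a * (h x * \<phi> x * ?e m x)) = 0" for a m
        using that by (simp only: integral_mult_right annihilated_def mult_zero_right)
      then show ?thesis unfolding eq
        by (subst integral_add, (intro integrable_on_mult_right integrable_add ci)+)
          (subst integral_add, (intro integrable_on_mult_right integrable_add ci)+, simp only: add_0)
    qed
    then show ?thesis
      unfolding annihilated_def by (auto intro!: continuous_intros c)
  qed
  have stepK: "annihilated (\<lambda>x. \<phi> x * of_real (K x))" if "annihilated \<phi>" for \<phi>
  proof -
    have "annihilated (\<lambda>x. \<phi> x * of_real (\<Prod>i\<in>A. (cos (pi * x $ i))\<^sup>2))" if "finite A" for A :: "'g set"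
      using that
    proof (induction A)
      case empty
      then show ?case using \<open>annihilated \<phi>\<close> by simp
    next
      case (insert i A)
      from step[OF insert.IH, of i] show ?case
        using insert.hyps by (simp add: mult_ac)
    qed
    then show ?thesis by (simp add: K_def)
  qed
  have ann: "annihilated (\<lambda>x. of_real (K x ^ N))" for N
  proof (induction N)
    case 0
    then show ?case using zero by (simp add: annihilated_def)
  next
    case (Suc N)
    from stepK[OF this] show ?case by (simp add: mult.commute)
  qed
  have KN: "integral unit_box (\<lambda>x. h x * of_real (K x ^ N)) = 0" for N
  proof -
    have "integral unit_box (\<lambda>x. h x * of_real (K x ^ N) * ?e 0 x) = 0"
      using ann[of N] unfolding annihilated_def by blast
    then show ?thesis by simp
  qed
  define g where "g = (\<lambda>x. Re (h x / h 0))"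
  have contg: "continuous_on UNIV g"
    unfolding g_def by (intro continuous_intros cont) (use h0 in auto)
  have contK: "continuous_on UNIV K" unfolding K_def by (intro continuous_intros)
  have gK: "integral unit_box (\<lambda>x. g x * K x ^ N) = 0" for N
  proof -
    have i: "(\<lambda>x. h x * of_real (K x ^ N)) integrable_on unit_box"
      by (intro int continuous_intros cont contK)
    have "integral unit_box (\<lambda>x. (h x * of_real (K x ^ N)) / h 0) = 0"
      using KN[of N] by (simp only: integral_divide) simp
    moreover have "((\<lambda>x. (h x * of_real (K x ^ N)) / h 0) has_integral
       integral unit_box (\<lambda>x. (h x * of_real (K x ^ N)) / h 0)) unit_box"
      by (intro integrable_integral integrable_on_divide i)
    ultimately have "((Re \<circ> (\<lambda>x. (h x * of_real (K x ^ N)) / h 0)) has_integral Re 0) unit_box"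
      using has_integral_linear[OF _ bounded_linear_Re] by metis
    moreover have "Re ((h x * of_real (K x ^ N)) / h 0) = g x * K x ^ N" for x
    proof -
      have "(h x * of_real (K x ^ N)) / h 0 = of_real (K x ^ N) * (h x / h 0)" by simp
      then show ?thesis unfolding g_def by (simp only: Re_complex_of_real mult.commute times_complex.sel) simp
    qed
    ultimately show ?thesis by (simp add: o_def integral_unique)
  qed
  have K0: "0 \<le> K x" for x unfolding K_def by (intro prod_nonneg) auto
  have Kle1: "K x \<le> 1" for x
    unfolding K_def by (intro prod_le_1) (auto simp: abs_square_le_1)
  have Klt1: "K x < 1" if xbox: "x \<in> unit_box" and xne: "x \<noteq> 0" for x
  proof -
    obtain i where i: "x $ i \<noteq> 0" using xne by (auto simp: vec_eq_iff)
    have le: "\<bar>pi * x $ i\<bar> \<le> pi / 2"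
      using xbox mult_left_mono[of "\<bar>x $ i\<bar>" "1/2" pi] by (simp add: mem_unit_box abs_mult)
    have pos: "0 < \<bar>pi * x $ i\<bar>" using i by simp
    have "cos \<bar>pi * x $ i\<bar> < cos 0"
      by (rule cos_monotone_0_pi[OF order_refl pos]) (use le pi_gt_zero in linarith)
    moreover have "0 \<le> cos \<bar>pi * x $ i\<bar>"
      by (rule cos_ge_zero) (use le pos in linarith)+
    ultimately have "cos \<bar>pi * x $ i\<bar> < 1" "0 \<le> cos \<bar>pi * x $ i\<bar>" by simp_all
    then have "cos (pi * x $ i) < 1" "0 \<le> cos (pi * x $ i)" by (simp_all add: cos_abs_real)
    then have "(cos (pi * x $ i))\<^sup>2 < 1" by (simp add: power_less_one_iff abs_square_less_1)
    moreover have "K x \<le> (cos (pi * x $ i))\<^sup>2"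
    proof -
      have "K x = (cos (pi * x $ i))\<^sup>2 * (\<Prod>j\<in>UNIV - {i}. (cos (pi * x $ j))\<^sup>2)"
        unfolding K_def by (rule prod.remove) auto
      also have "\<dots> \<le> (cos (pi * x $ i))\<^sup>2 * 1"
        by (intro mult_left_mono prod_le_1) (auto simp: abs_square_le_1)
      finally show ?thesis by simp
    qed
    ultimately show ?thesis by linarith
  qed
  have gz: "g 0 = 1" using h0 by (simp add: g_def)
  have Kz: "K 0 = 1" by (simp add: K_def)
  \<comment> \<open>On a small cube the integrand is at least half the \<^term>\<open>N\<close>-th power of \<^term>\<open>\<kappa>'\<close>; away from the
    centre it is bounded by a multiple of the power of the smaller number \<^term>\<open>\<kappa>\<close>; in between it is
    not negative. So the integral cannot vanish for large \<^term>\<open>N\<close>.\<close>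
  obtain \<delta> where \<delta>: "\<delta> > 0" "\<And>x. norm x < \<delta> \<Longrightarrow> 1/2 \<le> g x"
  proof -
    have "isCont g 0" using contg by (simp add: continuous_on_eq_continuous_at)
    then obtain d where d: "d > 0" "\<And>x. norm x < d \<Longrightarrow> \<bar>g x - 1\<bar> < 1/2"
      unfolding continuous_at_eps_delta dist_norm
      by (auto simp: gz dest!: spec[of _ "1/2"])
    have "1/2 \<le> g x" if "norm x < d" for x using d(2)[OF that] by linarith
    then show ?thesis using d(1) that by blast
  qed
  define far where "far = unit_box - ball (0::real^'g) \<delta>"
  have cfar: "compact far" unfolding far_def by (rule compact_diff[OF compact_unit_box open_ball])
  obtain \<kappa> where \<kappa>: "0 \<le> \<kappa>" "\<kappa> < 1" "\<And>x. x \<in> far \<Longrightarrow> K x \<le> \<kappa>"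
  proof (cases "far = {}")
    case True
    then show ?thesis by (intro that[of 0]) auto
  next
    case False
    obtain u where u: "u \<in> far" "\<And>x. x \<in> far \<Longrightarrow> K x \<le> K u"
      using continuous_attains_sup[OF cfar False continuous_on_subset[OF contK]] by blast
    have "u \<in> unit_box" "u \<noteq> 0" using u(1) \<delta>(1) by (auto simp: far_def)
    then show ?thesis using K0 Klt1 u(2) that by blast
  qed
  define \<kappa>' where "\<kappa>' = (1 + \<kappa>) / 2"
  have \<kappa>': "\<kappa> < \<kappa>'" "\<kappa>' < 1" "0 < \<kappa>'" using \<kappa> by (auto simp: \<kappa>'_def)
  obtain \<rho> where \<rho>: "\<rho> > 0" "\<And>x. norm x < \<rho> \<Longrightarrow> \<kappa>' \<le> K x"
  proof -
    have "isCont K 0" using contK by (simp add: continuous_on_eq_continuous_at)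
    moreover have "1 - \<kappa>' > 0" using \<kappa>' by simp
    ultimately obtain d where d: "d > 0" "\<And>x. norm x < d \<Longrightarrow> \<bar>K x - 1\<bar> < 1 - \<kappa>'"
      unfolding continuous_at_eps_delta dist_norm Kz by (metis diff_zero real_norm_def)
    have "\<kappa>' \<le> K x" if "norm x < d" for x using d(2)[OF that] by linarith
    then show ?thesis using d(1) that by blast
  qed
  obtain r where r: "r > 0" "r \<le> 1/2" "\<And>x::real^'g. \<forall>i. \<bar>x $ i\<bar> \<le> r \<Longrightarrow> norm x < min \<rho> \<delta>"
  proof -
    define r where "r = min (1/2) (min \<rho> \<delta> / (2 * real CARD('g)))"
    have "norm x < min \<rho> \<delta>" if "\<forall>i. \<bar>x $ i\<bar> \<le> r" for x :: "real^'g"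
    proof -
      have "norm x \<le> (\<Sum>i\<in>UNIV. \<bar>x $ i\<bar>)" by (rule norm_le_l1_cart)
      also have "\<dots> \<le> (\<Sum>i\<in>(UNIV::'g set). r)" by (rule sum_mono) (use that in auto)
      also have "\<dots> = real CARD('g) * r" by simp
      also have "\<dots> \<le> real CARD('g) * (min \<rho> \<delta> / (2 * real CARD('g)))"
        by (rule mult_left_mono) (auto simp only: r_def min.cobounded2 of_nat_0_le_iff)
      also have "\<dots> < min \<rho> \<delta>" using \<rho>(1) \<delta>(1) by (simp add: min_def)
      finally show ?thesis .
    qed
    moreover have "r > 0" using \<rho> \<delta> by (simp add: r_def)
    ultimately show ?thesis by (intro that[of r]) (simp_all add: r_def)
  qed
  define cube where "cube = cbox (\<chi> i. - r) ((\<chi> i. r) :: real^'g)"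
  have mem_cube: "x \<in> cube \<longleftrightarrow> (\<forall>i. \<bar>x $ i\<bar> \<le> r)" for x
    by (simp only: cube_def mem_box_cart vec_lambda_beta abs_le_iff) (auto simp: minus_le_iff)
  have sub: "cube \<subseteq> unit_box"
  proof
    fix x assume "x \<in> cube"
    then have "\<bar>x $ i\<bar> \<le> 1/2" for i using r(2) order_trans unfolding mem_cube by blast
    then show "x \<in> unit_box" unfolding mem_unit_box by blast
  qed
  define V where "V = measure lborel cube"
  have V: "V > 0"
    unfolding V_def cube_def using r(1)
    by (subst content_cbox_cart) (auto simp: interval_eq_empty_cart intro!: prod_pos)
  obtain M where M: "M > 0" "\<And>x. x \<in> unit_box \<Longrightarrow> \<bar>g x\<bar> \<le> M"
  proof -
    have "bounded (g ` unit_box)"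
      by (intro compact_imp_bounded compact_continuous_image compact_unit_box continuous_on_subset[OF contg]) simp
    then show ?thesis using that by (auto simp: bounded_pos)
  qed
  have vol: "measure lborel (unit_box :: (real^'g) set) = 1"
    unfolding unit_box_def by (subst content_cbox_cart) (auto simp: interval_eq_empty_cart)
  have key: "(1/2) * \<kappa>' ^ N * V \<le> M * \<kappa> ^ N" for N
  proof -
    let ?low = "\<lambda>x. (if x \<in> cube then (1/2) * \<kappa>' ^ N else 0) - M * \<kappa> ^ N"
    have "((\<lambda>x. (1/2) * \<kappa>' ^ N) has_integral (V * ((1/2) * \<kappa>' ^ N))) cube"
      unfolding cube_def V_def using has_integral_const[of "(1/2) * \<kappa>' ^ N"] by simp
    then have 1: "((\<lambda>x. if x \<in> cube then (1/2) * \<kappa>' ^ N else 0) has_integral (V * ((1/2) * \<kappa>' ^ N))) unit_box"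
      by (simp only: has_integral_restrict[OF sub])
    have 2: "((\<lambda>x. M * \<kappa> ^ N) has_integral (M * \<kappa> ^ N)) (unit_box :: (real^'g) set)"
      using has_integral_const[of "M * \<kappa> ^ N" "(\<chi> i. -1/2) :: real^'g" "\<chi> i. 1/2"] vol
      by (simp add: unit_box_def)
    have low: "(?low has_integral (V * ((1/2) * \<kappa>' ^ N) - M * \<kappa> ^ N)) unit_box"
      by (rule has_integral_diff[OF 1 2])
    have "((\<lambda>x. g x * K x ^ N) has_integral 0) unit_box"
    proof -
      have "continuous_on UNIV (\<lambda>x. g x * K x ^ N)" by (intro continuous_intros contg contK)
      from integrable_integral[OF intr[OF this]] show ?thesis by (simp only: gK)
    qed
    from low this have "V * ((1/2) * \<kappa>' ^ N) - M * \<kappa> ^ N \<le> 0"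
    proof (rule has_integral_le)
      fix x :: "real^'g" assume x: "x \<in> unit_box"
      have Mk: "0 \<le> M * \<kappa> ^ N" using M(1) \<kappa>(1) by simp
      show "?low x \<le> g x * K x ^ N"
      proof (cases "x \<in> cube")
        case True
        then have "norm x < min \<rho> \<delta>" using r(3) mem_cube by blast
        then have "1/2 \<le> g x" "\<kappa>' \<le> K x" using \<delta>(2) \<rho>(2) by auto
        then have "(1/2) * \<kappa>' ^ N \<le> g x * K x ^ N"
          by (intro mult_mono power_mono) (use \<kappa>' in auto)
        then show ?thesis using True Mk by simp
      next
        case False
        show ?thesis
        proof (cases "norm x < \<delta>")
          case True
          then have "0 \<le> g x * K x ^ N" using \<delta>(2)[OF True] K0 by simp
          then show ?thesis using False Mk by simp
        next
          case nf: False
          then have "x \<in> far" using x by (simp add: far_def)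
          then have "\<bar>g x\<bar> * K x ^ N \<le> M * \<kappa> ^ N"
            by (intro mult_mono power_mono M(2)[OF x] \<kappa>(3)) (use K0 M in auto)
          moreover have "\<bar>g x * K x ^ N\<bar> = \<bar>g x\<bar> * K x ^ N" using K0 by (simp add: abs_mult)
          ultimately show ?thesis using False by (simp add: abs_le_iff)
        qed
      qed
    qed
    then show ?thesis by (simp add: mult_ac)
  qed
  have "(\<lambda>N. M * (\<kappa> / \<kappa>') ^ N) \<longlonglongrightarrow> M * 0"
    by (intro tendsto_intros LIMSEQ_power_zero) (use \<kappa> \<kappa>' in auto)
  moreover have "V / 2 \<le> M * (\<kappa> / \<kappa>') ^ N" for N
    using key[of N] \<kappa>'(3) by (simp add: power_divide field_simps)
  ultimately have "V / 2 \<le> M * 0"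
    by (intro LIMSEQ_le_const) auto
  then show False using V by simp
qed

lemma entire_eqI_fourier:
  assumes f: "entire f" "\<And>z n. f (z + ivec n) = f z"
    and g: "entire g" "\<And>z n. g (z + ivec n) = g z"
    and eq: "\<And>n. fourier_coeff f n = fourier_coeff g n"
  shows "f z = g z"
proof -
  define k where "k = (\<lambda>x. f (z + cvec x) - g (z + cvec x))"
  have c: "continuous_on UNIV f" "continuous_on UNIV g"
    using f g by (auto intro: entire_continuous)
  have contf: "continuous_on S (\<lambda>x. f (z + cvec x))" for S
    by (intro continuous_on_compose2[OF c(1)] continuous_intros) auto
  have contg: "continuous_on S (\<lambda>x. g (z + cvec x))" for S
    by (intro continuous_on_compose2[OF c(2)] continuous_intros) auto
  have "k 0 = 0"
  proof (rule vanishing_fourier_integrals_imp_zero)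
    show "continuous_on UNIV k" unfolding k_def by (intro continuous_intros contf contg)
    fix n :: "int^'a"
    let ?E = "\<lambda>y. exp (- (2 * of_real pi * \<i> * cbil (ivec (- n)) y))"
    have E: "?E (z + cvec x) = ?E z * exp (2 * of_real pi * \<i> * cbil (ivec n) (cvec x))" for x
    proof -
      have "- (2 * of_real pi * \<i> * cbil (ivec (- n)) (z + cvec x)) =
          - (2 * of_real pi * \<i> * cbil (ivec (- n)) z) + 2 * of_real pi * \<i> * cbil (ivec n) (cvec x)"
        by (simp add: cbil_simps algebra_simps)
      then show ?thesis by (simp only: exp_add)
    qed
    have cE: "continuous_on S (\<lambda>x. ?E (z + cvec x))" for S by (intro continuous_intros)
    have "integral unit_box (\<lambda>x. f (z + cvec x) * ?E (z + cvec x)) =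
        integral unit_box (\<lambda>x. g (z + cvec x) * ?E (z + cvec x))"
      using fourier_coeff_at[OF f, of "- n" z] fourier_coeff_at[OF g, of "- n" z] eq[of "- n"]
      by (simp add: torus_mean_def)
    then have "integral unit_box (\<lambda>x. f (z + cvec x) * ?E (z + cvec x) - g (z + cvec x) * ?E (z + cvec x)) = 0"
      unfolding unit_box_def
      by (subst integral_diff) (auto intro!: integrable_continuous continuous_intros contf contg cE)
    then have "integral unit_box (\<lambda>x. ?E z * (k x * exp (2 * of_real pi * \<i> * cbil (ivec n) (cvec x)))) = 0"
      unfolding E k_def by (simp add: algebra_simps)
    then show "integral unit_box (\<lambda>x. k x * exp (2 * of_real pi * \<i> * cbil (ivec n) (cvec x))) = 0"
      by simp
  qed
  then show ?thesis by (simp add: k_def)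
qed

section \<open>Quasi-periodic entire functions are theta series\<close>

lemma pos_im_scaleR:
  assumes "pos_im \<tau>" "r > 0"
  shows "pos_im (r *\<^sub>R \<tau>)"
  unfolding pos_im_def
proof (intro allI impI)
  fix x :: "real^'a" assume "x \<noteq> 0"
  then have "0 < x \<bullet> ((\<chi> i j. Im (\<tau> $ i $ j)) *v x)" using assms(1) by (simp add: pos_im_def)
  moreover have "(\<chi> i j. Im ((r *\<^sub>R \<tau>) $ i $ j)) *v x = r *\<^sub>R ((\<chi> i j. Im (\<tau> $ i $ j)) *v x)"
    by (simp add: vec_eq_iff matrix_vector_mult_def sum_distrib_left mult.assoc)
  ultimately show "0 < x \<bullet> ((\<chi> i j. Im ((r *\<^sub>R \<tau>) $ i $ j)) *v x)"
    using assms(2) by (simp add: inner_scaleR_right)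
qed

lemma pos_im_quarter: "\<tau> \<in> siegel_space \<Longrightarrow> pos_im ((1/4) *\<^sub>R \<tau>)"
  using pos_im_scaleR[of \<tau> "1/4"] by (simp add: siegel_space_iff)

definition lattice_periodic :: "nat \<Rightarrow> (int^'g \<Rightarrow> complex) \<Rightarrow> bool" where
  "lattice_periodic l c \<longleftrightarrow> (\<forall>n m. c (n + of_nat l *s m) = c n)"

lemma lattice_periodic_imp_poly_bounded:
  assumes "lattice_periodic l c" "l > 0"
  shows "poly_bounded c"
proof -
  define R where "R = {n :: int^'a. \<forall>i. n $ i \<in> {0..<int l}}"
  have "finite (PiE (UNIV::'a set) (\<lambda>_. {0..<int l}))" by (intro finite_PiE) auto
  moreover have "R \<subseteq> vec_lambda ` (PiE (UNIV::'a set) (\<lambda>_. {0..<int l}))"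
    unfolding R_def by (auto intro!: image_eqI[of _ _ "vec_nth _"])
  ultimately have fin: "finite R" by (rule finite_surj)
  have "norm (c n) \<le> Max ((norm \<circ> c) ` R)" for n
  proof -
    define r where "r = (\<chi> i. n $ i mod int l)"
    have "n = r + of_nat l *s (\<chi> i. n $ i div int l)"
      by (simp add: vec_eq_iff r_def)
    then have "c n = c r" using assms(1) unfolding lattice_periodic_def by metis
    moreover have "r \<in> R" using assms(2) by (simp add: R_def r_def)
    ultimately show ?thesis using fin by auto
  qed
  then show ?thesis by (rule poly_boundedI)
qed

lemma theta_series_periodic: "theta_series c \<tau> (z + ivec m) = theta_series c \<tau> z"
proof -
  have "theta_exponent \<tau> (z + ivec m) n =
      theta_exponent \<tau> z n + 2 * of_real pi * \<i> * cbil (ivec n) (ivec m)" for n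
    by (simp add: theta_exponent_def cbil_simps algebra_simps)
  then show ?thesis unfolding theta_series_def by (simp only: exp_add exp_cbil_ivec mult_1_right)
qed

text \<open>The factor by which the Riemann theta function changes under translation by a period.\<close>

definition automorphy :: "complex^'g^'g \<Rightarrow> int^'g \<Rightarrow> complex^'g \<Rightarrow> complex" where
  "automorphy \<tau> m z = exp (- (of_real pi * \<i> * qform \<tau> m + 2 * of_real pi * \<i> * cbil (ivec m) z))"

text \<open>Quasi-periodicity of weight \<^term>\<open>l\<close> is a recursion for the Fourier coefficients, with step
  in \<^term>\<open>l\<close> times the lattice; it says that they are Gaussian up to a periodic factor.\<close>

theorem quasi_periodic_imp_theta_series:
  assumes \<tau>: "\<tau> \<in> siegel_space" and l: "l > 0" and f: "entire f"
    and per: "\<And>z n. f (z + ivec n) = f z"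
    and quasi: "\<And>z m. f (z + \<tau> *v ivec m) = automorphy \<tau> m z ^ l * f z"
  shows "\<exists>c. lattice_periodic l c \<and> f = theta_series c ((1 / real l) *\<^sub>R \<tau>)"
proof -
  have sym: "transpose \<tau> = \<tau>" and pos: "pos_im \<tau>" using \<tau> by (auto simp: siegel_space_iff)
  let ?\<tau> = "(1 / real l) *\<^sub>R \<tau>"
  let ?E = "\<lambda>n z. exp (- (2 * of_real pi * \<i> * cbil (ivec n) z))"
  define a where "a = fourier_coeff f"
  define c where "c = (\<lambda>n. a n * exp (- (of_real pi * \<i> * qform ?\<tau> n)))"
  have rec: "a n = exp (- (of_nat l * (of_real pi * \<i> * qform \<tau> m)) -
      2 * of_real pi * \<i> * cbil (ivec n) (\<tau> *v ivec m)) * a (n + of_nat l *s m)" for n m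
  proof -
    have lm: "ivec (of_nat l *s m) = of_nat l *s ivec m"
      using ivec_simps(6)[of "int l" m] by simp
    have shift: "f (\<tau> *v ivec m + cvec x) * ?E n (\<tau> *v ivec m + cvec x) =
      exp (- (of_nat l * (of_real pi * \<i> * qform \<tau> m)) - 2 * of_real pi * \<i> * cbil (ivec n) (\<tau> *v ivec m)) *
      (f (cvec x) * ?E (n + of_nat l *s m) (cvec x))" for x
    proof -
      have 1: "f (\<tau> *v ivec m + cvec x) = exp (of_nat l * (- (of_real pi * \<i> * qform \<tau> m +
          2 * of_real pi * \<i> * cbil (ivec m) (cvec x)))) * f (cvec x)"
        using quasi[of "cvec x" m]
        by (simp only: automorphy_def exp_of_nat_mult[symmetric] add.commute[of "\<tau> *v ivec m"])
      have 2: "of_nat l * (- (of_real pi * \<i> * qform \<tau> m + 2 * of_real pi * \<i> * cbil (ivec m) (cvec x)))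
          + - (2 * of_real pi * \<i> * cbil (ivec n) (\<tau> *v ivec m + cvec x)) =
        (- (of_nat l * (of_real pi * \<i> * qform \<tau> m)) - 2 * of_real pi * \<i> * cbil (ivec n) (\<tau> *v ivec m))
          + - (2 * of_real pi * \<i> * cbil (ivec (n + of_nat l *s m)) (cvec x))"
        by (simp add: lm cbil_simps algebra_simps)
      show ?thesis
        unfolding 1 using arg_cong[OF 2, of exp] by (simp only: exp_add mult_ac)
    qed
    have "a n = torus_mean (\<lambda>z. f z * ?E n z) (\<tau> *v ivec m)"
      using fourier_coeff_at[OF f per] by (simp add: a_def)
    also have "\<dots> = exp (- (of_nat l * (of_real pi * \<i> * qform \<tau> m)) -
      2 * of_real pi * \<i> * cbil (ivec n) (\<tau> *v ivec m)) * a (n + of_nat l *s m)"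
      unfolding torus_mean_def shift a_def fourier_coeff_def
      by (simp only: integral_mult_right add_0)
    finally show ?thesis .
  qed
  have perc: "lattice_periodic l c"
    unfolding lattice_periodic_def
  proof (intro allI)
    fix n m :: "int^'a"
    let ?X = "- (of_nat l * (of_real pi * \<i> * qform \<tau> m)) -
      2 * of_real pi * \<i> * cbil (ivec n) (\<tau> *v ivec m)"
    have "ivec (of_nat l *s m) = of_nat l *s ivec m"
      using ivec_simps(6)[of "int l" m] by simp
    then have "qform \<tau> (n + of_nat l *s m) = qform \<tau> n + of_nat l * of_nat l * qform \<tau> m +
        2 * of_nat l * cbil (ivec n) (\<tau> *v ivec m)"
      using cbil_symmetric[OF sym, of "ivec m" "ivec n"]
      by (simp add: qform_def cbil_simps matrix_vector_right_distrib
          vector_scalar_commute algebra_simps)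
    then have q: "qform ?\<tau> (n + of_nat l *s m) = qform ?\<tau> n + of_nat l * qform \<tau> m +
        2 * cbil (ivec n) (\<tau> *v ivec m)"
      using l by (simp add: qform_scaleR field_simps)
    have "- (of_real pi * \<i> * qform ?\<tau> n) = - ?X - of_real pi * \<i> * qform ?\<tau> (n + of_nat l *s m) "
      unfolding q by (simp add: algebra_simps)
    then have "c n = exp ?X * a (n + of_nat l *s m) *
        exp (- ?X - of_real pi * \<i> * qform ?\<tau> (n + of_nat l *s m))"
      unfolding c_def by (simp only: rec[of n m])
    also have "\<dots> = c (n + of_nat l *s m)"
    proof -
      have "exp x * b * exp (- x - q) = b * exp (- q)" for x b q :: complex
        by (simp add: exp_diff exp_minus field_simps)
      then show ?thesis by (simp only: c_def)
    qed
    finally show "c (n + of_nat l *s m) = c n" ..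
  qed
  have pb: "poly_bounded c" by (rule lattice_periodic_imp_poly_bounded[OF perc l])
  have pos': "pos_im ?\<tau>" using pos_im_scaleR[OF pos] l by simp
  have "f z = theta_series c ?\<tau> z" for z
  proof (rule entire_eqI_fourier[OF f per entire_theta_series[OF pos' pb] theta_series_periodic])
    fix n
    have "fourier_coeff (theta_series c ?\<tau>) n = c n * exp (of_real pi * \<i> * qform ?\<tau> n)"
      by (rule fourier_coeff_theta_series[OF pos' pb])
    also have "\<dots> = a n" by (simp add: c_def exp_minus)
    finally show "fourier_coeff f n = fourier_coeff (theta_series c ?\<tau>) n" by (simp only: a_def)
  qed
  then show ?thesis using perc by blast
qed

section \<open>The Riemann theta function\<close>

definition rtheta :: "complex^'g^'g \<Rightarrow> complex^'g \<Rightarrow> complex" where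
  "rtheta \<tau> = theta_series (\<lambda>n. 1) \<tau>"

lemma entire_rtheta: "\<tau> \<in> siegel_space \<Longrightarrow> entire (rtheta \<tau>)"
  unfolding rtheta_def by (intro entire_theta_series) (auto simp: siegel_space_iff)

lemma rtheta_periodic: "rtheta \<tau> (z + ivec n) = rtheta \<tau> z"
  by (simp add: rtheta_def theta_series_periodic)

lemma rtheta_quasi_periodic:
  assumes "\<tau> \<in> siegel_space"
  shows "rtheta \<tau> (z + \<tau> *v ivec m) = automorphy \<tau> m z * rtheta \<tau> z"
proof -
  have sym: "transpose \<tau> = \<tau>" using assms by (simp add: siegel_space_iff)
  have "theta_exponent \<tau> (z + \<tau> *v ivec m) n = theta_exponent \<tau> z (n + m) +
      - (of_real pi * \<i> * qform \<tau> m + 2 * of_real pi * \<i> * cbil (ivec m) z)" for n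
    using cbil_symmetric[OF sym, of "ivec m" "ivec n"]
    by (simp add: theta_exponent_def qform_add[OF sym] cbil_simps algebra_simps)
  then have "rtheta \<tau> (z + \<tau> *v ivec m) =
      automorphy \<tau> m z * (\<Sum>\<^sub>\<infinity>n. exp (theta_exponent \<tau> z (n + m)))"
    unfolding rtheta_def theta_series_def automorphy_def
    by (simp only: exp_add mult_1_left infsum_cmult_left' mult.commute)
  moreover have "bij_betw (\<lambda>n. n + m) UNIV UNIV"
    by (rule bij_betw_byWitness[where f' = "\<lambda>n. n - m"]) auto
  then have "(\<Sum>\<^sub>\<infinity>n. exp (theta_exponent \<tau> z (n + m))) = rtheta \<tau> z"
    unfolding rtheta_def theta_series_def
    using infsum_reindex_bij_betw[of "\<lambda>n. n + m" UNIV UNIV "\<lambda>n. exp (theta_exponent \<tau> z n)"]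
    by simp
  ultimately show ?thesis by simp
qed

lemma rtheta_not_identically_zero:
  assumes "\<tau> \<in> siegel_space"
  shows "\<exists>z. rtheta \<tau> z \<noteq> 0"
proof (rule ccontr)
  assume "\<not> ?thesis"
  then have "rtheta \<tau> = (\<lambda>z. 0)" by auto
  moreover have "fourier_coeff (rtheta \<tau>) 0 = exp (of_real pi * \<i> * qform \<tau> 0)"
    unfolding rtheta_def using assms
    by (subst fourier_coeff_theta_series) (auto simp: siegel_space_iff)
  ultimately show False by (simp add: fourier_coeff_def torus_mean_def)
qed

text \<open>The theta function spans the functions with its own quasi-periods: weight one leaves a
  constant as periodic factor.\<close>

corollary quasi_periodic_imp_multiple_of_rtheta:
  assumes \<tau>: "\<tau> \<in> siegel_space" and f: "entire f"
    and per: "\<And>z n. f (z + ivec n) = f z"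
    and quasi: "\<And>z m. f (z + \<tau> *v ivec m) = automorphy \<tau> m z * f z"
  shows "\<exists>a. \<forall>z. f z = a * rtheta \<tau> z"
proof -
  obtain c where c: "lattice_periodic 1 c" "f = theta_series c ((1 / real 1) *\<^sub>R \<tau>)"
    using quasi_periodic_imp_theta_series[OF \<tau>, of 1 f] assms by auto
  have "c n = c 0" for n
  proof -
    have "c (0 + of_nat 1 *s n) = c 0" using c(1) unfolding lattice_periodic_def by blast
    then show ?thesis by (simp add: vector_scalar_mult_def)
  qed
  then have "c = (\<lambda>n. c 0 * 1)" by auto
  then have "f z = c 0 * rtheta \<tau> z" for z
    using c(2) theta_series_cmult[of "c 0" "\<lambda>n. 1" \<tau> z] by (simp add: rtheta_def)
  then show ?thesis by blast
qed

text \<open>On the line through a point of the open set and the given nonzero, the identity theorem applies.\<close>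

lemma entire_nonzero_dense:
  assumes f: "entire f" and "f z0 \<noteq> 0" and U: "open U" "x \<in> U"
  shows "\<exists>y\<in>U. f y \<noteq> 0"
proof (rule ccontr)
  assume neg: "\<not> ?thesis"
  let ?l = "\<lambda>t. x + t *s (z0 - x)"
  have "open (?l -` U)"
    by (intro open_vimage U(1) continuous_intros)
  moreover have "0 \<in> ?l -` U" using U(2) by simp
  ultimately obtain e where e: "e > 0" "ball 0 e \<subseteq> ?l -` U"
    using open_contains_ball by blast
  have "f (?l 1) = 0"
  proof (rule analytic_continuation_open[of "ball 0 e" UNIV "\<lambda>t. f (?l t)" "\<lambda>t. 0"])
    show "f (?l t) = 0" if "t \<in> ball 0 e" for t using that e neg by auto
    show "(\<lambda>t. f (?l t)) holomorphic_on UNIV" by (rule entire_line[OF f])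
  qed (use e in auto)
  then show False using assms(2) by simp
qed

section \<open>Logarithmic derivatives and transverse zeros\<close>

text \<open>The set where the two factors differ is open, so it meets the dense set where \<^term>\<open>f\<close> does not vanish.\<close>

lemma entire_cancel:
  assumes "entire f" "f z0 \<noteq> 0" and A: "continuous_on UNIV A" and B: "continuous_on UNIV B"
    and eq: "\<And>z. A z * f z = B z * f z"
  shows "A x = B x"
proof (rule ccontr)
  assume "A x \<noteq> B x"
  have "open {z. A z \<noteq> B z}" by (rule open_Collect_neq[OF A B])
  then obtain y where "A y \<noteq> B y" "f y \<noteq> 0"
    using entire_nonzero_dense[OF assms(1,2), of "{z. A z \<noteq> B z}" x] \<open>A x \<noteq> B x\<close> by auto
  then show False using eq[of y] by simp
qed

lemma entire_nonzero_punctured_line: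
  assumes f: "entire f" and ne: "f (x + t1 *s v) \<noteq> 0"
  shows "\<exists>r>0. \<forall>t\<in>ball t0 r - {t0}. f (x + t *s v) \<noteq> 0"
proof (cases "f (x + t0 *s v) = 0")
  case True
  show ?thesis
  proof (rule isolated_zeros[OF entire_line[OF f, of x v UNIV] open_UNIV connected_UNIV UNIV_I True UNIV_I ne])
    fix r :: real
    assume "0 < r" "\<And>t. t \<in> ball t0 r - {t0} \<Longrightarrow> f (x + t *s v) \<noteq> 0"
    then show ?thesis by blast
  qed
next
  case False
  have "open {t. f (x + t *s v) \<noteq> 0}"
    by (intro open_Collect_neq holomorphic_on_imp_continuous_on[OF entire_line[OF f]] continuous_intros)
  then obtain r where "r > 0" "ball t0 r \<subseteq> {t. f (x + t *s v) \<noteq> 0}"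
    using False open_contains_ball[of "{t. f (x + t *s v) \<noteq> 0}"] by force
  then show ?thesis by blast
qed

text \<open>Quotients by an entire function that exist locally and continuously are globally entire:
  the local quotients agree where the denominator does not vanish, which is dense. On the lines
  inside the zero set holomorphy is inherited by uniform limits from nearby parallel lines.\<close>

lemma entire_quotient_local_to_global:
  fixes f G :: "complex^'g \<Rightarrow> complex"
  assumes f: "entire f" and f0: "f z0 \<noteq> 0" and G: "entire G"
    and loc: "\<And>p. \<exists>N F. open N \<and> p \<in> N \<and> continuous_on N F \<and> (\<forall>x\<in>N. F x * f x = G x)"
  shows "\<exists>F. entire F \<and> (\<forall>x. F x * f x = G x)"
proof -
  obtain N F0 where N: "\<And>p. open (N p)" "\<And>p. p \<in> N p" "\<And>p. continuous_on (N p) (F0 p)"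
      "\<And>p x. x \<in> N p \<Longrightarrow> F0 p x * f x = G x"
    using loc by metis
  define F where "F = (\<lambda>x. F0 x x)"
  have agree: "F x = F0 p x" if x: "x \<in> N p" for x p
  proof (rule ccontr)
    assume ne: "F x \<noteq> F0 p x"
    let ?U = "(N x \<inter> N p) \<inter> (\<lambda>y. F0 x y - F0 p y) -` (- {0})"
    have "continuous_on (N x \<inter> N p) (\<lambda>y. F0 x y - F0 p y)"
      by (intro continuous_intros continuous_on_subset[OF N(3)]) auto
    then have op: "open ?U" by (rule continuous_open_preimage) (use N(1) in auto)
    have "x \<in> ?U" using x ne N(2) by (simp add: F_def)
    from entire_nonzero_dense[OF f f0 op this] obtain y where "y \<in> ?U" "f y \<noteq> 0" by blast
    then have "F0 x y * f y = F0 p y * f y" "F0 x y \<noteq> F0 p y"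
      using N(4)[of y x] N(4)[of y p] by auto
    with \<open>f y \<noteq> 0\<close> show False by simp
  qed
  have Ff: "F x * f x = G x" for x using N(4)[OF N(2)] by (simp add: F_def)
  have contF: "continuous_on UNIV F"
  proof -
    have "continuous_on (N p) F" for p
      using N(3)[of p] by (rule continuous_on_eq) (use agree in auto)
    then have "isCont F p" for p
      using N(1,2) continuous_on_eq_continuous_at by blast
    then show ?thesis by (simp add: continuous_at_imp_continuous_on)
  qed
  have line: "continuous_on S (\<lambda>t. F (x + t *s v))" for S x v
    by (intro continuous_on_compose2[OF contF] continuous_intros) auto
  have hol1: "(\<lambda>t. F (x + t *s v)) holomorphic_on UNIV" if ne: "f (x + t1 *s v) \<noteq> 0" for x v t1
  proof -
    have u: "(\<lambda>t. f (x + t *s v)) holomorphic_on S" for S by (rule entire_line[OF f])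
    have "(\<lambda>t. F (x + t *s v)) field_differentiable at t0" for t0
    proof -
      obtain r where r: "r > 0" "\<And>t. t \<in> ball t0 r - {t0} \<Longrightarrow> f (x + t *s v) \<noteq> 0"
        using entire_nonzero_punctured_line[OF f ne, of t0] by blast
      have "(\<lambda>t. F (x + t *s v)) holomorphic_on ball t0 r"
      proof (rule no_isolated_singularity[where K = "{t0}"])
        have "(\<lambda>t. G (x + t *s v) / f (x + t *s v)) holomorphic_on ball t0 r - {t0}"
          using r(2) by (intro holomorphic_intros u entire_line[OF G]) auto
        then show "(\<lambda>t. F (x + t *s v)) holomorphic_on ball t0 r - {t0}"
          by (rule holomorphic_transform) (use r(2) Ff in \<open>auto simp: field_simps\<close>)
      qed (use line in auto)
      then show ?thesis using r(1) holomorphic_on_imp_differentiable_at by auto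
    qed
    then show ?thesis by (simp add: holomorphic_on_def)
  qed
  have hol: "(\<lambda>t. F (x + t *s v)) holomorphic_on UNIV" for x v
  proof -
    define w where "w = z0 - x"
    have "f (x + 1 *s w) \<noteq> 0" using f0 by (simp add: w_def)
    from entire_nonzero_punctured_line[OF f this, of 0]
    have "\<exists>e>0. \<forall>s. s \<noteq> 0 \<and> norm s < e \<longrightarrow> f (x + s *s w) \<noteq> 0" by (simp add: Ball_def conj_commute)
    then obtain e where e: "e > 0" "\<And>s. s \<noteq> 0 \<Longrightarrow> norm s < e \<Longrightarrow> f (x + s *s w) \<noteq> 0" by blast
    define s where "s = (\<lambda>n. complex_of_real (min 1 (e / 2) / real (Suc n)))"
    have s: "s n \<noteq> 0" "norm (s n) < e" "norm (s n) \<le> 1" for n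
    proof -
      have pos: "min 1 (e / 2) / real (Suc n) > 0" using e(1) by simp
      then show "s n \<noteq> 0" unfolding s_def of_real_eq_0_iff by linarith
      have "norm (s n) = min 1 (e / 2) / real (Suc n)"
        unfolding s_def norm_of_real using pos by linarith
      also have "\<dots> \<le> min 1 (e / 2) / 1" using e(1) by (intro divide_left_mono) auto
      finally show "norm (s n) < e" "norm (s n) \<le> 1" using e(1) by (auto simp: min_def split: if_splits)
    qed
    have s0: "s \<longlonglongrightarrow> 0"
    proof -
      have "(\<lambda>n. min 1 (e / 2) * inverse (real (Suc n))) \<longlonglongrightarrow> min 1 (e / 2) * 0"
        by (rule tendsto_mult[OF tendsto_const LIMSEQ_inverse_real_of_nat])
      then have "(\<lambda>n. complex_of_real (min 1 (e / 2) / real (Suc n))) \<longlonglongrightarrow> complex_of_real 0"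
        by (intro tendsto_of_real) (simp only: divide_inverse mult_zero_right)
      then show ?thesis by (simp only: s_def of_real_0)
    qed
    show ?thesis
    proof (rule holomorphic_uniform_sequence[OF open_UNIV])
      show "(\<lambda>t. F ((x + s n *s w) + t *s v)) holomorphic_on UNIV" for n
        by (rule hol1[of _ 0]) (use e(2) s in simp)
      fix t0 :: complex
      have "uniform_limit (cball t0 1) (\<lambda>n t. F ((x + s n *s w) + t *s v)) (\<lambda>t. F (x + t *s v)) sequentially"
      proof (rule uniform_limitI)
        fix \<epsilon> :: real assume \<epsilon>: "\<epsilon> > 0"
        have "uniformly_continuous_on (cball 0 1 \<times> cball t0 1) (\<lambda>(a, t). F ((x + a *s w) + t *s v))"
          unfolding split_beta
          by (intro compact_uniformly_continuous compact_Times compact_cball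
              continuous_on_compose2[OF contF] continuous_intros) auto
        then obtain d where d: "d > 0" "\<And>y y'. y \<in> cball 0 1 \<times> cball t0 1 \<Longrightarrow>
            y' \<in> cball 0 1 \<times> cball t0 1 \<Longrightarrow> dist y' y < d \<Longrightarrow>
            dist ((\<lambda>(a, t). F ((x + a *s w) + t *s v)) y') ((\<lambda>(a, t). F ((x + a *s w) + t *s v)) y) < \<epsilon>"
          using \<epsilon> by (rule uniformly_continuous_onE) blast
        have "eventually (\<lambda>n. dist (s n) 0 < d) sequentially" using s0 d(1) by (rule tendstoD)
        then show "\<forall>\<^sub>F n in sequentially. \<forall>t\<in>cball t0 1.
            dist (F ((x + s n *s w) + t *s v)) (F (x + t *s v)) < \<epsilon>"
        proof eventually_elim
          case (elim n)
          show ?case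
          proof
            fix t assume "t \<in> cball t0 1"
            with d(2)[of "(0, t)" "(s n, t)"] elim s(3)[of n]
            show "dist (F ((x + s n *s w) + t *s v)) (F (x + t *s v)) < \<epsilon>"
              by (simp add: dist_Pair_Pair)
          qed
        qed
      qed
      then show "\<exists>d>0. cball t0 d \<subseteq> UNIV \<and> uniform_limit (cball t0 d)
          (\<lambda>n t. F ((x + s n *s w) + t *s v)) (\<lambda>t. F (x + t *s v)) sequentially"
        by (intro exI[of _ 1]) simp
    qed
  qed
  have "entire F" using contF hol by (simp add: entire_def)
  then show ?thesis using Ff by blast
qed

text \<open>In one variable a logarithmic derivative has simple poles, whatever the multiplicities of the
  zeros; a factor that vanishes at the zeros removes them.\<close>

lemma logarithmic_derivative_times_vanishing:
  assumes u: "u holomorphic_on UNIV" and u0: "u t0 \<noteq> 0" and w: "w holomorphic_on UNIV"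
    and van: "\<And>t. u t = 0 \<Longrightarrow> w t = 0"
  shows "\<exists>\<omega>. \<omega> holomorphic_on UNIV \<and> (\<forall>t. \<omega> t * u t = w t * deriv u t)"
proof -
  have local: "\<exists>r h. 0 < r \<and> h holomorphic_on ball t r \<and> (\<forall>s\<in>ball t r. h s * u s = w s * deriv u s) \<and>
      (\<forall>s\<in>ball t r - {t}. u s \<noteq> 0)" for t
  proof (cases "u t = 0")
    case True
    have nc: "\<not> u constant_on UNIV" using True u0 unfolding constant_on_def by (metis UNIV_I)
    obtain g r n where g: "0 < n" "0 < r" "g holomorphic_on ball t r"
        "\<And>s. s \<in> ball t r \<Longrightarrow> u s = (s - t) ^ n * g s" "\<And>s. s \<in> ball t r \<Longrightarrow> g s \<noteq> 0"
      using holomorphic_factor_zero_nonconstant[OF u open_UNIV connected_UNIV UNIV_I True nc]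
      by metis
    have zero: "w t = 0" using van True by simp
    obtain w1 where w1: "w1 holomorphic_on UNIV" "\<And>s. w s = (s - t) * w1 s"
    proof
      let ?w1 = "\<lambda>s. if s = t then deriv w t else (w s - w t) / (s - t)"
      show "?w1 holomorphic_on UNIV"
        by (rule pole_lemma_open[OF w open_UNIV])
      show "w s = (s - t) * ?w1 s" for s using zero by simp
    qed
    define h where "h = (\<lambda>s. w1 s * (of_nat n * g s + (s - t) * deriv g s) / g s)"
    have "h holomorphic_on ball t r" unfolding h_def
      by (intro holomorphic_intros holomorphic_deriv g(3) holomorphic_on_subset[OF w1(1)])
        (use g(5) in auto)
    moreover have "h s * u s = w s * deriv u s" if s: "s \<in> ball t r" for s
    proof -
      have "((\<lambda>s. (s - t) ^ n * g s) has_field_derivative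
          (of_nat n * (s - t) ^ (n - 1) * g s + (s - t) ^ n * deriv g s)) (at s)"
        using holomorphic_derivI[OF g(3) open_ball s]
        by (auto intro!: derivative_eq_intros)
      then have "(u has_field_derivative
          (of_nat n * (s - t) ^ (n - 1) * g s + (s - t) ^ n * deriv g s)) (at s)"
        by (rule has_field_derivative_transform_within_open[OF _ open_ball s]) (use g(4) in auto)
      then have d: "deriv u s = of_nat n * (s - t) ^ (n - 1) * g s + (s - t) ^ n * deriv g s"
        by (rule DERIV_imp_deriv)
      have p: "(s - t) ^ n = (s - t) * (s - t) ^ (n - 1)" using g(1) by (simp add: power_eq_if)
      show ?thesis using g(5)[OF s] unfolding d g(4)[OF s] w1(2)[of s] h_def p
        by (simp add: field_simps)
    qed
    moreover have "u s \<noteq> 0" if "s \<in> ball t r - {t}" for s using that g(4,5) by auto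
    ultimately show ?thesis using g(2) by blast
  next
    case False
    have "open {s. u s \<noteq> 0}"
      by (intro open_Collect_neq holomorphic_on_imp_continuous_on[OF u] continuous_intros)
    then obtain r where r: "r > 0" "ball t r \<subseteq> {s. u s \<noteq> 0}"
      using False open_contains_ball[of "{s. u s \<noteq> 0}"] by force
    have "(\<lambda>s. w s * deriv u s / u s) holomorphic_on ball t r"
      by (intro holomorphic_intros holomorphic_on_subset[OF w] holomorphic_on_subset[OF u]
          holomorphic_on_subset[OF holomorphic_deriv[OF u open_UNIV]]) (use r in auto)
    then show ?thesis
      by (intro exI[of _ r] exI[of _ "\<lambda>s. w s * deriv u s / u s"]) (use r in auto)
  qed
  obtain r h where rh: "\<And>t. 0 < r t" "\<And>t. h t holomorphic_on ball t (r t)"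
      "\<And>t s. s \<in> ball t (r t) \<Longrightarrow> h t s * u s = w s * deriv u s"
      "\<And>t s. s \<in> ball t (r t) - {t} \<Longrightarrow> u s \<noteq> 0"
    using local by metis
  define \<omega> where "\<omega> = (\<lambda>t. h t t)"
  have eq: "\<omega> s = h t s" if s: "s \<in> ball t (r t)" for s t
  proof (cases "s = t")
    case False
    have "u s \<noteq> 0" using rh(4)[of s t] s False by simp
    moreover have "h s s * u s = h t s * u s" using rh(3)[of s s] rh(3)[OF s] rh(1)[of s] by simp
    ultimately show ?thesis by (simp add: \<omega>_def)
  qed (simp add: \<omega>_def)
  have "\<omega> field_differentiable at t" for t
  proof -
    have "\<omega> holomorphic_on ball t (r t)"
      by (rule holomorphic_transform[OF rh(2)]) (use eq in auto)
    then show ?thesis using rh(1)[of t] holomorphic_on_imp_differentiable_at by auto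
  qed
  then have "\<omega> holomorphic_on UNIV" by (simp add: holomorphic_on_def)
  moreover have "\<omega> t * u t = w t * deriv u t" for t
    using rh(3)[of t t] rh(1)[of t] by (simp add: \<omega>_def)
  ultimately show ?thesis by blast
qed

lemma entire_continuous_compose:
  "entire f \<Longrightarrow> continuous_on S g \<Longrightarrow> continuous_on S (\<lambda>x. f (g x))"
  using continuous_on_compose2[OF entire_continuous] by blast

text \<open>The local quotient in a direction in which the zero set is isolated, as a Cauchy integral over
  a circle that avoids the zero set and therefore still avoids it for nearby lines.\<close>

lemma local_quotient_direction:
  fixes f w :: "complex^'g \<Rightarrow> complex"
  assumes f: "entire f" and w: "entire w" and van: "\<And>x. f x = 0 \<Longrightarrow> w x = 0"
    and ne: "f (p + v) \<noteq> 0"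
  shows "\<exists>N F. open N \<and> p \<in> N \<and> continuous_on N F \<and> (\<forall>x\<in>N. F x * f x = w x * dir_deriv v f x)"
proof -
  have u: "(\<lambda>t. f (x + t *s v)) holomorphic_on S" for x S by (rule entire_line[OF f])
  have "\<exists>r>0. \<forall>t\<in>sphere 0 r. f (p + t *s v) \<noteq> 0"
  proof -
    have "f (p + 1 *s v) \<noteq> 0" using ne by simp
    from entire_nonzero_punctured_line[OF f this, of 0] obtain r
      where "r > 0" "\<And>t. t \<in> ball 0 r - {0} \<Longrightarrow> f (p + t *s v) \<noteq> 0" by blast
    then show ?thesis by (intro exI[of _ "r / 2"]) auto
  qed
  then obtain r where r: "r > 0" "\<And>t. t \<in> sphere 0 r \<Longrightarrow> f (p + t *s v) \<noteq> 0" by blast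
  define W where "W = {y :: (complex^'g) \<times> complex. f (fst y + snd y *s v) \<noteq> 0}"
  have "open W" unfolding W_def
    by (intro open_Collect_neq entire_continuous_compose[OF f] continuous_intros)
  moreover have "{p} \<times> sphere 0 r \<subseteq> W" using r(2) by (auto simp: W_def)
  ultimately obtain N where N: "p \<in> N" "open N" "N \<times> sphere 0 r \<subseteq> W"
    using Elementary_Topology.tube_lemma[OF compact_sphere] by metis
  have ne': "f (x + t *s v) \<noteq> 0" if "x \<in> N" "norm t = r" for x t
  proof -
    have "(x, t) \<in> N \<times> sphere 0 r" using that by simp
    then have "(x, t) \<in> W" using N(3) by blast
    then show ?thesis by (simp add: W_def)
  qed
  define G where "G = (\<lambda>y. w y * dir_deriv v f y / f y)"
  define c where "c = (\<lambda>s::real. complex_of_real r * exp (2 * of_real pi * \<i> * of_real s))"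
  have nc: "norm (c s) = r" for s using r(1) by (simp add: c_def norm_mult)
  have c0: "c s \<noteq> 0" for s using nc[of s] r(1) by auto
  define F where "F = (\<lambda>x. (1 / (2 * of_real pi * \<i>)) *
    integral (cbox 0 1) (\<lambda>s. G (x + c s *s v) / c s * (2 * of_real pi * \<i> * c s)))"
  have contc: "continuous_on S c" for S unfolding c_def by (intro continuous_intros)
  have "continuous_on N F"
    unfolding F_def
  proof (intro continuous_intros integral_continuous_on_param)
    have pair: "continuous_on (N \<times> cbox 0 1) (\<lambda>y. fst y + c (snd y) *s v)"
      by (intro continuous_intros continuous_on_compose2[OF contc]) auto
    have "continuous_on (N \<times> cbox 0 1) (\<lambda>y. G (fst y + c (snd y) *s v))"
      unfolding G_def
      by (intro continuous_intros entire_continuous_compose[OF f pair]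
          entire_continuous_compose[OF w pair] continuous_on_compose2[OF entire_dir_deriv_continuous[OF f] pair])
        (use ne' nc in auto)
    then show "continuous_on (N \<times> cbox 0 1)
        (\<lambda>(x, s). G (x + c s *s v) / c s * (2 * of_real pi * \<i> * c s))"
      unfolding split_beta
      by (intro continuous_intros continuous_on_compose2[OF contc[of UNIV]]) (use c0 in auto)
  qed
  moreover have "F x * f x = w x * dir_deriv v f x" if x: "x \<in> N" for x
  proof -
    have du: "deriv (\<lambda>t. f (x + t *s v)) t = dir_deriv v f (x + t *s v)" for t
      by (rule DERIV_imp_deriv[OF entire_line_derivative[OF f]])
    obtain \<omega> where \<omega>: "\<omega> holomorphic_on UNIV"
        "\<And>t. \<omega> t * f (x + t *s v) = w (x + t *s v) * dir_deriv v f (x + t *s v)"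
      using logarithmic_derivative_times_vanishing[OF u[of x UNIV], of "of_real r" "\<lambda>t. w (x + t *s v)"]
        ne'[OF x, of "of_real r"] r(1) van entire_line[OF w] unfolding du by auto
    have "((\<lambda>t. \<omega> t / (t - 0)) has_contour_integral (2 * of_real pi * \<i> * \<omega> 0)) (circlepath 0 r)"
      by (rule Cauchy_integral_circlepath_simple) (use \<omega>(1) r(1) holomorphic_on_subset in auto)
    then have "2 * of_real pi * \<i> * \<omega> 0 = contour_integral (circlepath 0 r) (\<lambda>t. \<omega> t / (t - 0))"
      by (rule contour_integral_unique[symmetric])
    also have "\<dots> = integral {0..1} (\<lambda>s. \<omega> (c s) / c s * (2 * of_real pi * \<i> * c s))"
      unfolding contour_integral_integral vector_derivative_circlepath
      by (simp add: circlepath c_def mult_ac)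
    finally have int: "2 * of_real pi * \<i> * \<omega> 0 =
        integral {0..1} (\<lambda>s. \<omega> (c s) / c s * (2 * of_real pi * \<i> * c s))" .
    have "\<omega> (c s) = G (x + c s *s v)" for s
      using \<omega>(2)[of "c s"] ne'[OF x nc] by (simp add: G_def field_simps)
    then have "F x = (1 / (2 * of_real pi * \<i>)) * (2 * of_real pi * \<i> * \<omega> 0)"
      unfolding F_def int by (simp only: cbox_interval)
    then have "\<omega> 0 = F x" by simp
    then show ?thesis using \<omega>(2)[of 0] by simp
  qed
  ultimately show ?thesis using N by blast
qed

text \<open>If \<^term>\<open>w\<close> vanishes on the zero set of \<^term>\<open>f\<close>, all the functions
  \<^term>\<open>\<lambda>x. w x * dir_deriv v f x / f x\<close> are entire. Near a point this is the previous lemma for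
  those directions whose line through the point leaves the zero set; they form an open nonempty
  set, hence span, and the quotient is linear in the direction.\<close>

lemma entire_quotient_gradient:
  fixes f w :: "complex^'g \<Rightarrow> complex"
  assumes f: "entire f" and f0: "f z0 \<noteq> 0" and w: "entire w" and van: "\<And>x. f x = 0 \<Longrightarrow> w x = 0"
    and lin: "\<And>a s b x. dir_deriv (a + s *s b) f x = dir_deriv a f x + s * dir_deriv b f x"
    and ent: "entire (dir_deriv v f)"
  shows "\<exists>F. entire F \<and> (\<forall>x. F x * f x = w x * dir_deriv v f x)"
proof (rule entire_quotient_local_to_global[OF f f0])
  show "entire (\<lambda>x. w x * dir_deriv v f x)" by (intro entire_mult w ent)
  fix p
  define a where "a = z0 - p"
  have "open {s. f (p + a + s *s v) \<noteq> 0}"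
    by (intro open_Collect_neq holomorphic_on_imp_continuous_on[OF entire_line[OF f]] continuous_intros)
  moreover have "0 \<in> {s. f (p + a + s *s v) \<noteq> 0}" using f0 by (simp add: a_def)
  ultimately obtain e where e: "e > 0" "ball 0 e \<subseteq> {s. f (p + a + s *s v) \<noteq> 0}"
    using open_contains_ball by blast
  define s where "s = complex_of_real (e / 2)"
  have s: "s \<noteq> 0" "f (p + (a + s *s v)) \<noteq> 0"
  proof -
    show "s \<noteq> 0" using e(1) by (simp add: s_def)
    have "s \<in> ball 0 e" using e(1) by (simp add: s_def)
    then show "f (p + (a + s *s v)) \<noteq> 0" using e(2) by (auto simp: add.assoc)
  qed
  have a: "f (p + a) \<noteq> 0" using f0 by (simp add: a_def)
  obtain N1 F1 where 1: "open N1" "p \<in> N1" "continuous_on N1 F1"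
      "\<And>x. x \<in> N1 \<Longrightarrow> F1 x * f x = w x * dir_deriv a f x"
    using local_quotient_direction[OF f w van a] by blast
  obtain N2 F2 where 2: "open N2" "p \<in> N2" "continuous_on N2 F2"
      "\<And>x. x \<in> N2 \<Longrightarrow> F2 x * f x = w x * dir_deriv (a + s *s v) f x"
    using local_quotient_direction[OF f w van s(2)] by blast
  show "\<exists>N F. open N \<and> p \<in> N \<and> continuous_on N F \<and> (\<forall>x\<in>N. F x * f x = w x * dir_deriv v f x)"
  proof (intro exI conjI ballI)
    show "open (N1 \<inter> N2)" "p \<in> N1 \<inter> N2" using 1 2 by auto
    show "continuous_on (N1 \<inter> N2) (\<lambda>x. (F2 x - F1 x) / s)"
      by (intro continuous_intros continuous_on_subset[OF 1(3)] continuous_on_subset[OF 2(3)])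
        (use s in auto)
    fix x assume "x \<in> N1 \<inter> N2"
    then have "(F2 x - F1 x) * f x = s * (w x * dir_deriv v f x)"
      using 1(4)[of x] 2(4)[of x] by (simp add: lin algebra_simps)
    then show "(F2 x - F1 x) / s * f x = w x * dir_deriv v f x"
      using s(1) by (simp add: field_simps)
  qed
qed

text \<open>Where \<^term>\<open>u\<close> does not vanish, the hypothesis says that \<open>w / u\<close> has derivative \<^term>\<open>c\<close>; the
  resulting identity persists by analytic continuation.\<close>

lemma quotient_of_constant_wronskian:
  fixes u w :: "complex \<Rightarrow> complex"
  assumes u: "\<And>t. (u has_field_derivative u' t) (at t)" and w: "\<And>t. (w has_field_derivative w' t) (at t)"
    and eq: "\<And>t. u t * w' t - w t * u' t = c * (u t)\<^sup>2" and u0: "u 0 \<noteq> 0"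
  shows "w t = (w 0 / u 0 + c * t) * u t"
proof -
  have "\<exists>D. (u has_field_derivative D) (at t)" for t by (rule exI[of _ "u' t"], rule u)
  moreover have "\<exists>D. (w has_field_derivative D) (at t)" for t by (rule exI[of _ "w' t"], rule w)
  ultimately have hu: "u holomorphic_on UNIV" and hw: "w holomorphic_on UNIV"
    by (simp_all add: holomorphic_on_open)
  have "open {t. u t \<noteq> 0}"
    by (intro open_Collect_neq holomorphic_on_imp_continuous_on[OF hu] continuous_intros)
  then obtain e where e: "e > 0" "ball 0 e \<subseteq> {t. u t \<noteq> 0}"
    using u0 open_contains_ball[of "{t. u t \<noteq> 0}"] by force
  have "\<exists>k. \<forall>t\<in>ball 0 e. w t / u t - c * t = k"
  proof (rule has_field_derivative_zero_constant)
    fix t assume "t \<in> ball (0::complex) e"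
    then have ut: "u t \<noteq> 0" using e by auto
    have "((\<lambda>t. w t / u t - c * t) has_field_derivative ((w' t * u t - w t * u' t) / (u t * u t) - c)) (at t)"
      using ut by (auto intro!: derivative_eq_intros u w)
    moreover have "(w' t * u t - w t * u' t) / (u t * u t) - c = 0"
      using eq[of t] ut by (simp add: field_simps power2_eq_square)
    ultimately show "((\<lambda>t. w t / u t - c * t) has_field_derivative 0) (at t within ball 0 e)"
      by (simp add: has_field_derivative_at_within)
  qed simp
  then obtain k where k: "\<And>t. t \<in> ball 0 e \<Longrightarrow> w t / u t - c * t = k" by blast
  have "k = w 0 / u 0" using k[of 0] e(1) by simp
  then have near: "w t = (w 0 / u 0 + c * t) * u t" if "t \<in> ball 0 e" for t
    using k[OF that] e(2) that by (auto simp: field_simps)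
  show ?thesis
  proof (rule analytic_continuation_open[of "ball 0 e" UNIV w "\<lambda>t. (w 0 / u 0 + c * t) * u t"])
    show "ball (0::complex) e \<noteq> {}" using e(1) by simp
    show "(\<lambda>t. (w 0 / u 0 + c * t) * u t) holomorphic_on UNIV" by (intro holomorphic_intros hu)
    show "w t = (w 0 / u 0 + c * t) * u t" if "t \<in> ball 0 e" for t by (rule near[OF that])
  qed (simp_all add: hw connected_UNIV)
qed

lemma rtheta_dir_deriv_linear:
  assumes "\<tau> \<in> siegel_space"
  shows "dir_deriv (a + s *s b) (rtheta \<tau>) x = dir_deriv a (rtheta \<tau>) x + s * dir_deriv b (rtheta \<tau>) x"
proof -
  have pos: "pos_im \<tau>" using assms by (simp add: siegel_space_iff)
  have pb: "poly_bounded (\<lambda>n. 1 * (2 * of_real pi * \<i> * cbil (ivec n) v))" for v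
    by (intro poly_bounded_deriv poly_bounded_const)
  show ?thesis
    unfolding rtheta_def dir_deriv_theta_series[OF pos poly_bounded_const]
    by (subst theta_series_cmult[symmetric], subst theta_series_add[OF pos, symmetric])
      (use pb in \<open>auto simp: cbil_simps algebra_simps intro!: poly_bounded_cmult\<close>)
qed

lemma entire_rtheta_dir_deriv:
  assumes "\<tau> \<in> siegel_space"
  shows "entire (dir_deriv a (rtheta \<tau>))" "entire (dir_deriv b (dir_deriv a (rtheta \<tau>)))"
proof -
  have pos: "pos_im \<tau>" using assms by (simp add: siegel_space_iff)
  have pb: "poly_bounded (\<lambda>n. 1 * (2 * of_real pi * \<i> * cbil (ivec n) v))" for v
    by (intro poly_bounded_deriv poly_bounded_const)
  show "entire (dir_deriv a (rtheta \<tau>))"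
    unfolding rtheta_def dir_deriv_theta_series[OF pos poly_bounded_const]
    by (rule entire_theta_series[OF pos pb])
  show "entire (dir_deriv b (dir_deriv a (rtheta \<tau>)))"
    unfolding rtheta_def dir_deriv_theta_series[OF pos poly_bounded_const] dir_deriv_theta_series[OF pos pb]
    by (rule entire_theta_series[OF pos poly_bounded_deriv[OF pb]])
qed

lemma dir_deriv_translate: "dir_deriv v (\<lambda>z. f (z + b)) z = dir_deriv v f (z + b)"
  by (simp add: dir_deriv_def add_ac)

lemma dir_deriv_quasi_periodic:
  assumes g: "entire g"
    and eq: "\<And>z. f (z + \<tau> *v ivec m) = automorphy \<tau> m z * g z"
  shows "dir_deriv v f (z + \<tau> *v ivec m) =
    automorphy \<tau> m z * (dir_deriv v g z - 2 * of_real pi * \<i> * cbil (ivec m) v * g z)"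
proof -
  have a: "automorphy \<tau> m (z + t *s v) =
      automorphy \<tau> m z * exp (- (2 * of_real pi * \<i> * cbil (ivec m) v) * t)" for t
    by (simp add: automorphy_def exp_add[symmetric] cbil_simps algebra_simps)
  have "f (z + \<tau> *v ivec m + t *s v) = automorphy \<tau> m z *
      (exp (- (2 * of_real pi * \<i> * cbil (ivec m) v) * t) * g (z + t *s v))" for t
    using eq[of "z + t *s v"] by (simp add: a add_ac mult_ac)
  moreover have "((\<lambda>t. automorphy \<tau> m z *
      (exp (- (2 * of_real pi * \<i> * cbil (ivec m) v) * t) * g (z + t *s v))) has_field_derivative
    automorphy \<tau> m z * (dir_deriv v g z - 2 * of_real pi * \<i> * cbil (ivec m) v * g z)) (at 0)"
    using entire_line_derivative[OF g, of z v 0]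
    by (auto intro!: derivative_eq_intros simp: algebra_simps)
  ultimately show ?thesis unfolding dir_deriv_def by (simp add: DERIV_imp_deriv)
qed

text \<open>Otherwise the derivative of \<open>\<theta>\<close> in the direction \<^term>\<open>k\<close> vanishes on the divisor, so that the functions
  \<open>\<theta> \<partial>\<^sub>k \<partial>\<^sub>v log \<theta>\<close> are entire. They have the quasi-periods of \<open>\<theta>\<close>, hence are multiples of it, and
  \<open>\<partial>\<^sub>k log \<theta>\<close> is affine. Being invariant under integral translations it is constant, which contradicts
  its behaviour under translation by the other periods.\<close>

theorem rtheta_transverse_zero:
  fixes \<tau> :: "complex^'g^'g"
  assumes \<tau>: "\<tau> \<in> siegel_space" and k: "k \<noteq> 0"
  shows "\<exists>p. rtheta \<tau> p = 0 \<and> dir_deriv k (rtheta \<tau>) p \<noteq> 0"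
proof (rule ccontr)
  assume "\<not> ?thesis"
  then have van: "\<And>x. rtheta \<tau> x = 0 \<Longrightarrow> dir_deriv k (rtheta \<tau>) x = 0" by blast
  define th where "th = rtheta \<tau>"
  define D where "D = (\<lambda>v. dir_deriv v th)"
  define DD where "DD = (\<lambda>v. dir_deriv v (D k))"
  let ?c = "\<lambda>m v. 2 * of_real pi * \<i> * cbil (ivec m) v"
  have ent: "entire th" "entire (D v)" "entire (DD v)" for v
    unfolding th_def D_def DD_def by (intro entire_rtheta entire_rtheta_dir_deriv \<tau>)+
  obtain z0 where z0: "th z0 \<noteq> 0" using rtheta_not_identically_zero[OF \<tau>] by (auto simp: th_def)
  have per: "th (z + ivec n) = th z" for z n by (simp add: th_def rtheta_periodic)
  have perD: "D v (z + ivec n) = D v z" for v z n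
    unfolding D_def by (subst dir_deriv_translate[symmetric]) (simp add: per)
  have perDD: "DD v (z + ivec n) = DD v z" for v z n
    unfolding DD_def by (subst dir_deriv_translate[symmetric]) (simp add: perD)
  have quasi: "th (z + \<tau> *v ivec m) = automorphy \<tau> m z * th z" for z m
    unfolding th_def by (rule rtheta_quasi_periodic[OF \<tau>])
  have quasiD: "D v (z + \<tau> *v ivec m) = automorphy \<tau> m z * (D v z - ?c m v * th z)" for v z m
    unfolding D_def by (rule dir_deriv_quasi_periodic[OF ent(1) quasi])
  have quasiDD: "DD v (z + \<tau> *v ivec m) = automorphy \<tau> m z *
      (DD v z - ?c m k * D v z - ?c m v * (D k z - ?c m k * th z))" for v z m
  proof -
    have e: "entire (\<lambda>z. D k z - ?c m k * th z)" by (intro entire_diff entire_mult entire_const ent)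
    have "dir_deriv v (\<lambda>z. D k z - ?c m k * th z) z = DD v z - ?c m k * D v z"
    proof -
      have "((\<lambda>t. D k (z + t *s v) - ?c m k * th (z + t *s v)) has_field_derivative
          DD v z - ?c m k * D v z) (at 0)"
        using entire_line_derivative[OF ent(2)[of k], of z v 0] entire_line_derivative[OF ent(1), of z v 0]
        by (auto intro!: derivative_eq_intros simp: D_def DD_def)
      then show ?thesis by (simp add: dir_deriv_def DERIV_imp_deriv)
    qed
    moreover have "dir_deriv v (D k) (z + \<tau> *v ivec m) = automorphy \<tau> m z *
        (dir_deriv v (\<lambda>z. D k z - ?c m k * th z) z - ?c m v * (D k z - ?c m k * th z))"
      by (rule dir_deriv_quasi_periodic[OF e]) (rule quasiD)
    ultimately show ?thesis by (simp add: DD_def)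
  qed
  \<comment> \<open>The entire function \<open>F\<close> is \<open>\<partial>\<^sub>k \<theta> \<partial>\<^sub>v \<theta> / \<theta>\<close>. It and the second derivative fail to be quasi-periodic
    by the same terms, so their difference is quasi-periodic.\<close>
  have wronskian: "\<exists>c. \<forall>x. th x * DD v x - D k x * D v x = c * (th x)\<^sup>2" for v
  proof -
    obtain F where F: "entire F" "\<And>x. F x * th x = D k x * D v x"
      using entire_quotient_gradient[OF ent(1) z0 ent(2)[of k], of v] van
        rtheta_dir_deriv_linear[OF \<tau>] ent(2)[of v] by (auto simp: th_def D_def)
    have cF: "continuous_on UNIV (\<lambda>z. F (z + b))" for b
      by (intro entire_continuous_compose[OF F(1)] continuous_intros)
    have perF: "F (z + ivec n) = F z" for z n
    proof (rule entire_cancel[OF ent(1) z0 cF entire_continuous[OF F(1)]])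
      show "F (z + ivec n) * th z = F z * th z" for z
        using F(2)[of "z + ivec n"] F(2)[of z] by (simp add: per perD)
    qed
    have quasiF: "F (z + \<tau> *v ivec m) = automorphy \<tau> m z *
        (F z - ?c m k * D v z - ?c m v * D k z + ?c m k * ?c m v * th z)" for z m
    proof (rule entire_cancel[OF ent(1) z0 cF])
      have "continuous_on UNIV (automorphy \<tau> m)"
        unfolding automorphy_def by (intro continuous_intros)
      then show "continuous_on UNIV (\<lambda>z. automorphy \<tau> m z *
          (F z - ?c m k * D v z - ?c m v * D k z + ?c m k * ?c m v * th z))"
        by (rule continuous_on_mult)
          (intro entire_continuous entire_add entire_diff entire_mult entire_const ent F(1))
      fix z
      have a0: "automorphy \<tau> m z \<noteq> 0" by (simp add: automorphy_def)
      have "F (z + \<tau> *v ivec m) * (automorphy \<tau> m z * th z) =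
         automorphy \<tau> m z * (D k z - ?c m k * th z) * (automorphy \<tau> m z * (D v z - ?c m v * th z))"
        using F(2)[of "z + \<tau> *v ivec m"] unfolding quasi quasiD .
      then have "F (z + \<tau> *v ivec m) * th z =
         automorphy \<tau> m z * ((D k z - ?c m k * th z) * (D v z - ?c m v * th z))"
        using a0 by (simp add: mult_ac)
      also have "\<dots> = automorphy \<tau> m z * (D k z * D v z - ?c m k * D v z * th z
          - ?c m v * D k z * th z + ?c m k * ?c m v * th z * th z)"
        by (simp add: algebra_simps)
      finally show "F (z + \<tau> *v ivec m) * th z = automorphy \<tau> m z *
          (F z - ?c m k * D v z - ?c m v * D k z + ?c m k * ?c m v * th z) * th z"
        unfolding F(2)[symmetric] by (simp add: algebra_simps)
    qed
    have "\<exists>a. \<forall>z. DD v z - F z = a * rtheta \<tau> z"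
    proof (rule quasi_periodic_imp_multiple_of_rtheta[OF \<tau>])
      show "entire (\<lambda>z. DD v z - F z)" by (intro entire_diff ent F(1))
      show "DD v (z + ivec n) - F (z + ivec n) = DD v z - F z" for z n
        by (simp add: perDD perF)
      show "DD v (z + \<tau> *v ivec m) - F (z + \<tau> *v ivec m) =
          automorphy \<tau> m z * (DD v z - F z)" for z m
        unfolding quasiDD quasiF by (simp add: algebra_simps)
    qed
    then obtain a where a: "\<And>z. DD v z - F z = a * th z" by (auto simp: th_def)
    have "th x * DD v x - D k x * D v x = a * (th x)\<^sup>2" for x
    proof -
      have "th x * DD v x - D k x * D v x = th x * (DD v x - F x)"
        unfolding F(2)[symmetric] by (simp add: algebra_simps)
      then show ?thesis unfolding a by (simp add: power2_eq_square)
    qed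
    then show ?thesis by blast
  qed
  have along: "D k (z0 + v) = (D k z0 / th z0 + c) * th (z0 + v)"
    if "\<forall>x. th x * DD v x - D k x * D v x = c * (th x)\<^sup>2" for v c
  proof -
    have "D k (z0 + 1 *s v) = (D k (z0 + 0 *s v) / th (z0 + 0 *s v) + c * 1) * th (z0 + 1 *s v)"
    proof (rule quotient_of_constant_wronskian[where u = "\<lambda>t. th (z0 + t *s v)"
          and w = "\<lambda>t. D k (z0 + t *s v)" and u' = "\<lambda>t. D v (z0 + t *s v)"
          and w' = "\<lambda>t. DD v (z0 + t *s v)"])
      show "((\<lambda>t. th (z0 + t *s v)) has_field_derivative D v (z0 + t *s v)) (at t)" for t
        unfolding D_def by (rule entire_line_derivative[OF ent(1)])
      show "((\<lambda>t. D k (z0 + t *s v)) has_field_derivative DD v (z0 + t *s v)) (at t)" for t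
        unfolding DD_def by (rule entire_line_derivative[OF ent(2)])
    qed (use that z0 in auto)
    then show ?thesis by simp
  qed
  have axis0: "th x * DD (axis i 1) x - D k x * D (axis i 1) x = 0" for i x
  proof -
    obtain c where c: "\<forall>x. th x * DD (axis i 1) x - D k x * D (axis i 1) x = c * (th x)\<^sup>2"
      using wronskian by blast
    have "D k z0 = (D k z0 / th z0 + c) * th z0"
      using along[OF c] perD[of k z0 "axis i 1"] per[of z0 "axis i 1"] by simp
    then have "c = 0" using z0 by (simp add: field_simps)
    then show ?thesis using c by simp
  qed
  have linD: "D (a + s *s b) x = D a x + s * D b x" for a b s x
    unfolding D_def th_def by (rule rtheta_dir_deriv_linear[OF \<tau>])
  have linDD: "DD (a + s *s b) x = DD a x + s * DD b x" for a b s x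
  proof -
    have pos: "pos_im \<tau>" using \<tau> by (simp add: siegel_space_iff)
    have pb: "poly_bounded (\<lambda>n. 1 * (2 * of_real pi * \<i> * cbil (ivec n) (k :: complex^'g)))"
      by (intro poly_bounded_deriv poly_bounded_const)
    have DDk: "DD v = theta_series
      (\<lambda>n. 1 * (2 * of_real pi * \<i> * cbil (ivec n) k) * (2 * of_real pi * \<i> * cbil (ivec n) v)) \<tau>" for v
      unfolding DD_def D_def th_def rtheta_def
        dir_deriv_theta_series[OF pos poly_bounded_const] dir_deriv_theta_series[OF pos pb] ..
    show ?thesis unfolding DDk
      by (subst theta_series_cmult[symmetric],
          subst theta_series_add[OF pos poly_bounded_deriv[OF pb]
            poly_bounded_cmult[OF poly_bounded_deriv[OF pb]], symmetric])
        (simp add: cbil_simps algebra_simps)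
  qed
  have all0: "th x * DD v x - D k x * D v x = 0" for v x
  proof -
    have zero: "th x * DD 0 x - D k x * D 0 x = 0"
    proof -
      have "D 0 x = 0" using linD[of 0 1 0 x] by simp
      moreover have "DD 0 x = 0" using linDD[of 0 1 0 x] by simp
      ultimately show ?thesis by simp
    qed
    have fin: "th x * DD (\<Sum>i\<in>A. v $ i *s axis i 1) x - D k x * D (\<Sum>i\<in>A. v $ i *s axis i 1) x = 0"
      if "finite A" for A
      using that
    proof (induction A)
      case empty
      then show ?case using zero by simp
    next
      case (insert i A)
      have "(\<Sum>i\<in>insert i A. v $ i *s axis i 1) = (\<Sum>i\<in>A. v $ i *s axis i 1) + v $ i *s axis i 1"
        using insert.hyps by (simp add: add.commute)
      then have "th x * DD (\<Sum>i\<in>insert i A. v $ i *s axis i 1) x -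
          D k x * D (\<Sum>i\<in>insert i A. v $ i *s axis i 1) x =
        (th x * DD (\<Sum>i\<in>A. v $ i *s axis i 1) x - D k x * D (\<Sum>i\<in>A. v $ i *s axis i 1) x) +
        v $ i * (th x * DD (axis i 1) x - D k x * D (axis i 1) x)"
        by (simp only: linD linDD) (simp add: algebra_simps)
      then show ?case using insert.IH axis0[of x i] by simp
    qed
    have "(\<Sum>i\<in>UNIV. v $ i *s axis i 1) = v"
      by (simp add: vec_eq_iff axis_def if_distrib cong: if_cong)
    then show ?thesis using fin[of UNIV] by simp
  qed
  have const: "D k x = (D k z0 / th z0) * th x" for x
    using along[of "x - z0" 0] all0 by simp
  have "cbil (ivec m) k = 0" for m
  proof -
    have "automorphy \<tau> m z0 * (D k z0 - ?c m k * th z0) = automorphy \<tau> m z0 * D k z0"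
      using const[of "z0 + \<tau> *v ivec m"] z0 unfolding quasi quasiD by simp
    then show ?thesis using z0 by (simp add: automorphy_def)
  qed
  then have "k $ i = 0" for i
    using cbil_axis(2)[of i 1 k] by (metis ivec_simps(5) mult_1)
  then show False using k by (simp add: vec_eq_iff)
qed

section \<open>Theta functions of order four\<close>

subsection \<open>Theta functions with characteristics as Fourier components\<close>

definition bint :: "bool^'g \<Rightarrow> int^'g" where
  "bint \<epsilon> = (\<chi> i. of_bool (\<epsilon> $ i))"

text \<open>The coefficients of the theta function with characteristic, as a series over the lattice rescaled
  by two: characters of order four on one class modulo two.\<close>

definition char_coeff :: "bool^'g \<Rightarrow> bool^'g \<Rightarrow> int^'g \<Rightarrow> complex" where
  "char_coeff \<epsilon> \<delta> n = (if \<forall>i. odd (n $ i) = \<epsilon> $ i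
     then exp (of_real pi * \<i> / 2 * cbil (ivec n) (ivec (bint \<delta>))) else 0)"

lemma poly_bounded_char_coeff: "poly_bounded (char_coeff \<epsilon> \<delta>)"
proof (rule poly_boundedI)
  fix n :: "int^'a"
  have "Re (of_real pi * \<i> / 2 * cbil (ivec n) (ivec (bint \<delta>))) = 0"
    unfolding cbil_ivec_ivec by simp
  then show "norm (char_coeff \<epsilon> \<delta> n) \<le> 1" by (simp add: char_coeff_def)
qed

lemma exp_of_int_times_2pi_i: "exp (of_int j * (2 * of_real pi * \<i>) :: complex) = 1"
  unfolding exp_eq_1 by (intro conjI exI[of _ j]) simp_all

lemma exp_of_int_times_pi_i: "exp (of_int l * (of_real pi * \<i>)) = (if even l then 1 else -1 :: complex)"
proof (cases "even l")
  case True
  then obtain j where "l = 2 * j" by (rule evenE)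
  then have "of_int l * (of_real pi * \<i>) = of_int j * (2 * of_real pi * \<i>)" by simp
  then show ?thesis using True by (simp only: exp_of_int_times_2pi_i if_True)
next
  case False
  then obtain j where "l = 2 * j + 1" by (rule oddE)
  then have "of_int l * (of_real pi * \<i>) = of_int j * (2 * of_real pi * \<i>) + of_real pi * \<i>"
    by (simp add: algebra_simps)
  then show ?thesis using False by (simp add: exp_add exp_of_int_times_2pi_i)
qed

text \<open>On the support of the coefficient, \<^term>\<open>n\<close> has the parity of \<^term>\<open>\<epsilon>\<close>, and the two exponents differ
  by \<open>\<pi> \<i>\<close> times the pairing of \<^term>\<open>n\<close> with \<^term>\<open>\<delta>\<close>.\<close>

lemma char_coeff_uminus:
  "char_coeff \<epsilon> \<delta> (- n) = (if odd_pair (\<epsilon>, \<delta>) then -1 else 1) * char_coeff \<epsilon> \<delta> n"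
proof (cases "\<forall>i. odd (n $ i) = \<epsilon> $ i")
  case True
  define S where "S = (\<Sum>i\<in>UNIV. n $ i * bint \<delta> $ i)"
  let ?T = "\<Sum>i\<in>UNIV. bint \<epsilon> $ i * bint \<delta> $ i"
  have "S - ?T = (\<Sum>i\<in>UNIV. (n $ i - bint \<epsilon> $ i) * bint \<delta> $ i)"
    by (simp add: S_def sum_subtractf left_diff_distrib)
  moreover have "even \<dots>"
    by (rule dvd_sum) (use True in \<open>auto simp: bint_def\<close>)
  ultimately have "even (S - ?T)" by simp
  moreover have "?T = int (\<Sum>i\<in>UNIV. of_bool (\<epsilon> $ i) * of_bool (\<delta> $ i))"
    by (simp add: bint_def)
  then have "odd ?T \<longleftrightarrow> odd_pair (\<epsilon>, \<delta>)" by (simp only: odd_pair_def fst_conv snd_conv even_of_nat)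
  ultimately have par: "odd S \<longleftrightarrow> odd_pair (\<epsilon>, \<delta>)" by simp
  have S: "cbil (ivec n) (ivec (bint \<delta>)) = of_int S" by (simp add: cbil_ivec_ivec S_def)
  have "of_real pi * \<i> / 2 * - of_int S = of_real pi * \<i> / 2 * of_int S + of_int (- S) * (of_real pi * \<i>)"
    by simp
  from arg_cong[OF this, of exp]
  have "exp (of_real pi * \<i> / 2 * - of_int S) = exp (of_real pi * \<i> / 2 * of_int S) * (if odd S then -1 else 1)"
    by (simp only: exp_add exp_of_int_times_pi_i) simp
  then show ?thesis using True by (simp add: char_coeff_def cbil_minus_left S par)
qed (auto simp: char_coeff_def)

lemma theta_series_reflect:
  "theta_series (\<lambda>n. c (- n)) \<tau> (- z) = theta_series c \<tau> z"
proof -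
  have ex: "theta_exponent \<tau> (- z) n = theta_exponent \<tau> z (- n)" for n
    by (simp add: theta_exponent_def qform_def cbil_simps matrix_vector_mult_uminus)
  have "bij_betw (\<lambda>n::int^'a. - n) UNIV UNIV" by (rule bij_betw_byWitness[where f' = uminus]) auto
  from infsum_reindex_bij_betw[OF this, of "\<lambda>n. c n * exp (theta_exponent \<tau> z n)"]
  show ?thesis
    unfolding theta_series_def ex .
qed

lemma sum_bool_vec_prod:
  fixes f :: "'g::finite \<Rightarrow> bool \<Rightarrow> complex"
  shows "(\<Sum>\<delta>\<in>(UNIV :: (bool^'g) set). \<Prod>i\<in>UNIV. f i (\<delta> $ i)) = (\<Prod>i\<in>UNIV. f i False + f i True)"
proof -
  have "bij_betw (\<lambda>d :: 'g \<Rightarrow> bool. vec_lambda d) UNIV (UNIV :: (bool^'g) set)"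
    by (rule bij_betw_byWitness[where f' = "\<lambda>v i. v $ i"]) auto
  then have "(\<Sum>\<delta>\<in>(UNIV :: (bool^'g) set). \<Prod>i\<in>UNIV. f i (\<delta> $ i)) =
      (\<Sum>d\<in>(UNIV :: ('g \<Rightarrow> bool) set). \<Prod>i\<in>UNIV. f i (d i))"
    by (subst sum.reindex_bij_betw[symmetric]) auto
  also have "\<dots> = (\<Prod>i\<in>(UNIV :: 'g set). \<Sum>b\<in>(UNIV :: bool set). f i b)"
    by (subst prod_sum_PiE) auto
  finally show ?thesis by (simp add: UNIV_bool)
qed

text \<open>Orthogonality of the characters of the even vectors modulo four.\<close>

lemma character_sum:
  fixes k :: "int^'g"
  assumes "\<forall>i. even (k $ i)"
  shows "(\<Sum>\<delta>\<in>UNIV. exp (of_real pi * \<i> / 2 * cbil (ivec k) (ivec (bint \<delta>)))) =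
    (if \<forall>i. 4 dvd k $ i then 2 ^ CARD('g) else 0)"
proof -
  let ?e = "\<lambda>i b. if b then exp (of_real pi * \<i> / 2 * of_int (k $ i)) else 1 :: complex"
  have "exp (of_real pi * \<i> / 2 * cbil (ivec k) (ivec (bint \<delta>))) = (\<Prod>i\<in>UNIV. ?e i (\<delta> $ i))"
    for \<delta> :: "bool^'g"
  proof -
    have "of_real pi * \<i> / 2 * cbil (ivec k) (ivec (bint \<delta>)) =
        (\<Sum>i\<in>UNIV. if \<delta> $ i then of_real pi * \<i> / 2 * of_int (k $ i) else 0)"
      unfolding cbil_def sum_distrib_left by (rule sum.cong) (auto simp: ivec_def bint_def)
    then have "exp (of_real pi * \<i> / 2 * cbil (ivec k) (ivec (bint \<delta>))) =
        (\<Prod>i\<in>UNIV. exp (if \<delta> $ i then of_real pi * \<i> / 2 * of_int (k $ i) else 0))"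
      by (simp only: exp_sum finite_class.finite_UNIV)
    then show ?thesis by (simp add: if_distrib cong: if_cong)
  qed
  then have s: "(\<Sum>\<delta>\<in>UNIV. exp (of_real pi * \<i> / 2 * cbil (ivec k) (ivec (bint \<delta>)))) =
      (\<Prod>i\<in>UNIV. ?e i False + ?e i True)"
    using sum_bool_vec_prod[of ?e] by (simp only:)
  have e: "?e i False + ?e i True = (if 4 dvd k $ i then 2 else 0)" for i
  proof -
    obtain l where l: "k $ i = 2 * l" using assms by (metis evenE)
    have "exp (of_real pi * \<i> / 2 * of_int (k $ i)) = exp (of_int l * (of_real pi * \<i>))"
      by (simp add: l mult_ac)
    also have "\<dots> = (if even l then 1 else -1)" by (rule exp_of_int_times_pi_i)
    finally show ?thesis using l by auto
  qed
  show ?thesis unfolding s e by (auto simp: prod_zero_iff)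
qed

text \<open>Fourier inversion on vectors modulo four: on each class modulo two, all functions of period four are
  combinations of the characters that the \<^term>\<open>\<delta>\<close> provide.\<close>

lemma char_coeff_span:
  fixes c :: "int^'g \<Rightarrow> complex"
  assumes c: "lattice_periodic 4 c"
  shows "\<exists>(R :: (int^'g) set) b. finite R \<and> (\<forall>n. c n = (\<Sum>r\<in>R. \<Sum>\<delta>\<in>UNIV. b r \<delta> * char_coeff (\<chi> i. odd (r $ i)) \<delta> n))"
proof -
  define R where "R = {n :: int^'g. \<forall>i. n $ i \<in> {0..<4}}"
  have "finite (PiE (UNIV::'g set) (\<lambda>_. {0..<4::int}))" by (intro finite_PiE) auto
  moreover have "R \<subseteq> vec_lambda ` (PiE (UNIV::'g set) (\<lambda>_. {0..<4}))"
    unfolding R_def by (auto intro!: image_eqI[of _ _ "vec_nth _"])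
  ultimately have fin: "finite R" by (rule finite_surj)
  let ?e = "\<lambda>n \<delta>. exp (of_real pi * \<i> / 2 * cbil (ivec n) (ivec (bint \<delta>)))"
  define b where "b = (\<lambda>r \<delta>. c r / 2 ^ CARD('g) * ?e (- r) \<delta>)"
  have inner: "(\<Sum>\<delta>\<in>UNIV. b r \<delta> * char_coeff (\<chi> i. odd (r $ i)) \<delta> n) =
      (if \<forall>i. 4 dvd n $ i - r $ i then c r else 0)" for r n
  proof (cases "\<forall>i. odd (n $ i) = odd (r $ i)")
    case True
    have "(\<Sum>\<delta>\<in>UNIV. b r \<delta> * char_coeff (\<chi> i. odd (r $ i)) \<delta> n) =
        c r / 2 ^ CARD('g) * (\<Sum>\<delta>\<in>UNIV. ?e (n - r) \<delta>)"
      unfolding sum_distrib_left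
    proof (rule sum.cong)
      fix \<delta> :: "bool^'g"
      have "?e (- r) \<delta> * ?e n \<delta> = ?e (n - r) \<delta>"
        by (simp add: exp_add[symmetric] cbil_simps algebra_simps)
      moreover have "char_coeff (\<chi> i. odd (r $ i)) \<delta> n = ?e n \<delta>"
        using True by (simp add: char_coeff_def)
      ultimately show "b r \<delta> * char_coeff (\<chi> i. odd (r $ i)) \<delta> n = c r / 2 ^ CARD('g) * ?e (n - r) \<delta>"
        by (simp only: b_def mult.assoc)
    qed simp
    then show ?thesis using True by (subst (asm) character_sum) auto
  next
    case False
    have parity: "odd x = odd y" if "4 dvd x - y" for x y :: int using that by presburger
    have no: "\<not> (\<forall>i. 4 dvd n $ i - r $ i)" using False parity by blast
    have "char_coeff (\<chi> i. odd (r $ i)) \<delta> n = 0" for \<delta>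
      using False by (auto simp only: char_coeff_def vec_lambda_beta if_False)
    then show ?thesis using no by (simp only: mult_zero_right sum.neutral_const if_False)
  qed
  have expand: "c n = (\<Sum>r\<in>R. \<Sum>\<delta>\<in>UNIV. b r \<delta> * char_coeff (\<chi> i. odd (r $ i)) \<delta> n)" for n
  proof -
    define r0 where "r0 = (\<chi> i. n $ i mod 4)"
    have r0: "r0 \<in> R" by (simp add: R_def r0_def)
    have unique: "r = r0" if "r \<in> R" "\<forall>i. 4 dvd n $ i - r $ i" for r
    proof -
      have "r $ i = n $ i mod 4" for i
        using that by (simp add: R_def mod_eq_dvd_iff[symmetric])
      then show ?thesis by (simp add: r0_def vec_eq_iff)
    qed
    have d: "\<forall>i. 4 dvd n $ i - r0 $ i" by (simp add: r0_def)
    have "n = r0 + of_nat 4 *s (\<chi> i. n $ i div 4)" by (simp add: vec_eq_iff r0_def)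
    then have "c n = c r0" using c unfolding lattice_periodic_def by metis
    also have "\<dots> = (\<Sum>r\<in>R. if r = r0 then c r0 else 0)" using fin r0 by simp
    also have "\<dots> = (\<Sum>r\<in>R. if \<forall>i. 4 dvd n $ i - r $ i then c r else 0)"
    proof (rule sum.cong[OF refl])
      fix r assume r: "r \<in> R"
      have "r = r0 \<longleftrightarrow> (\<forall>i. 4 dvd n $ i - r $ i)" using unique[OF r] d by blast
      then show "(if r = r0 then c r0 else 0) = (if \<forall>i. 4 dvd n $ i - r $ i then c r else 0)"
        by (metis (full_types))
    qed
    finally show ?thesis by (simp only: inner)
  qed
  show ?thesis
    by (rule exI[of _ R], rule exI[of _ b]) (intro conjI fin allI expand)
qed

text \<open>The even characteristics come for free, since their coefficients are even functions of the index and the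
  terms of the series cancel in pairs. Together the characteristics span the coefficients of period four.\<close>

lemma vanishing_on_characteristics:
  fixes P :: "int^'g \<Rightarrow> complex"
  assumes \<tau>: "pos_im \<tau>" and P: "poly_bounded P" and Podd: "\<And>n. P (- n) = - P n"
    and odd_zero: "\<And>\<epsilon> \<delta>. odd_pair (\<epsilon>, \<delta>) \<Longrightarrow> theta_series (\<lambda>n. char_coeff \<epsilon> \<delta> n * P n) \<tau> 0 = 0"
    and c: "lattice_periodic 4 c"
  shows "theta_series (\<lambda>n. c n * P n) \<tau> 0 = 0"
proof -
  have zero: "theta_series (\<lambda>n. char_coeff \<epsilon> \<delta> n * P n) \<tau> 0 = 0" for \<epsilon> \<delta>
  proof (cases "odd_pair (\<epsilon>, \<delta>)")
    case False
    have "theta_series (\<lambda>n. -1 * (char_coeff \<epsilon> \<delta> n * P n)) \<tau> 0 = theta_series (\<lambda>n. char_coeff \<epsilon> \<delta> n * P n) \<tau> 0"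
      using theta_series_reflect[of "\<lambda>n. char_coeff \<epsilon> \<delta> n * P n" \<tau> 0] False
      by (simp add: char_coeff_uminus Podd)
    then show ?thesis unfolding theta_series_cmult by simp
  qed (use odd_zero in auto)
  obtain R :: "(int^'g) set" and b where R: "finite R"
      "\<And>n. c n = (\<Sum>r\<in>R. \<Sum>\<delta>\<in>UNIV. b r \<delta> * char_coeff (\<chi> i. odd (r $ i)) \<delta> n)"
    using char_coeff_span[OF c] by blast
  have pb: "poly_bounded (\<lambda>n. b r \<delta> * (char_coeff \<epsilon> \<delta> n * P n))" for r :: "int^'g" and \<delta> \<epsilon>
    by (intro poly_bounded_cmult poly_bounded_mult poly_bounded_char_coeff P)
  have "(\<lambda>n. c n * P n) =
      (\<lambda>n. \<Sum>r\<in>R. \<Sum>\<delta>\<in>UNIV. b r \<delta> * (char_coeff (\<chi> i. odd (r $ i)) \<delta> n * P n))"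
    by (simp add: R(2) sum_distrib_right mult.assoc)
  then have "theta_series (\<lambda>n. c n * P n) \<tau> 0 =
      (\<Sum>r\<in>R. \<Sum>\<delta>\<in>UNIV. theta_series (\<lambda>n. b r \<delta> * (char_coeff (\<chi> i. odd (r $ i)) \<delta> n * P n)) \<tau> 0)"
    by (simp only: theta_series_sum[OF \<tau> poly_bounded_sum[OF pb]] theta_series_sum[OF \<tau> pb])
  then show ?thesis by (simp only: theta_series_cmult zero mult_zero_right sum.neutral_const)
qed

subsection \<open>Products of four translates\<close>

lemma poly_bounded_power [intro]: "poly_bounded c \<Longrightarrow> poly_bounded (\<lambda>n. c n ^ k)"
  by (induction k) auto

lemma higher_deriv_theta_series_line:
  assumes "pos_im \<tau>" "poly_bounded c"
  shows "(deriv ^^ k) (\<lambda>t. theta_series c \<tau> (z + t *s v)) =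
    (\<lambda>t. theta_series (\<lambda>n. c n * (2 * of_real pi * \<i> * cbil (ivec n) v) ^ k) \<tau> (z + t *s v))"
proof (induction k)
  case (Suc k)
  have pb: "poly_bounded (\<lambda>n. c n * (2 * of_real pi * \<i> * cbil (ivec n) v) ^ k)"
    by (intro poly_bounded_mult poly_bounded_power poly_bounded_const poly_bounded_cbil assms(2))
  have "deriv (\<lambda>t. theta_series (\<lambda>n. c n * (2 * of_real pi * \<i> * cbil (ivec n) v) ^ k) \<tau> (z + t *s v)) t =
      theta_series (\<lambda>n. c n * (2 * of_real pi * \<i> * cbil (ivec n) v) ^ Suc k) \<tau> (z + t *s v)" for t
    using DERIV_imp_deriv[OF theta_series_line_derivative[OF assms(1) pb, of z v t]]
    by (simp add: mult_ac)
  then show ?case unfolding funpow.simps(2) o_apply Suc by (rule ext)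
qed simp

text \<open>By the Leibniz rule only the terms survive in which each vanishing factor is differentiated.\<close>

lemma deriv_product_four_zeros:
  assumes hol: "a holomorphic_on UNIV" "b holomorphic_on UNIV" "c holomorphic_on UNIV" "d holomorphic_on UNIV"
    and zero: "a (0::complex) = 0" "b 0 = 0"
  shows "deriv (\<lambda>t. (a t * b t) * (c t * d t)) 0 = 0"
    and "c 0 = 0 \<Longrightarrow> (deriv ^^ 3) (\<lambda>t. (a t * b t) * (c t * d t)) 0 = 6 * deriv a 0 * deriv b 0 * deriv c 0 * d 0"
proof -
  have ab: "(\<lambda>t. a t * b t) holomorphic_on UNIV" and cd: "(\<lambda>t. c t * d t) holomorphic_on UNIV"
    by (intro holomorphic_intros hol)+
  note leibniz = higher_deriv_mult[OF _ _ open_UNIV UNIV_I]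
  have 1: "(deriv ^^ 1) (\<lambda>t. (a t * b t) * (c t * d t)) 0 = 0"
    unfolding leibniz[OF ab cd] leibniz[OF hol(1,2)]
    using zero by (simp add: numeral_eq_Suc)
  then show "deriv (\<lambda>t. (a t * b t) * (c t * d t)) 0 = 0" by simp
  show "(deriv ^^ 3) (\<lambda>t. (a t * b t) * (c t * d t)) 0 = 6 * deriv a 0 * deriv b 0 * deriv c 0 * d 0"
    if "c 0 = 0"
    unfolding leibniz[OF ab cd] leibniz[OF hol(1,2)] leibniz[OF hol(3,4)]
    using zero that by (simp add: numeral_eq_Suc)
qed

text \<open>The sum of the four translations is zero, so the factors of automorphy of the translates multiply to
  that of the fourth power.\<close>

lemma product_of_translates:
  fixes \<tau> :: "complex^'g^'g"
  assumes \<tau>: "\<tau> \<in> siegel_space"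
  shows "\<exists>c. lattice_periodic 4 c \<and> (\<forall>z. (rtheta \<tau> (p + z) * rtheta \<tau> (q + z)) *
    (rtheta \<tau> (r + z) * rtheta \<tau> (- (p + q + r) + z)) = theta_series c ((1/4) *\<^sub>R \<tau>) z)"
proof -
  let ?f = "\<lambda>z. (rtheta \<tau> (p + z) * rtheta \<tau> (q + z)) * (rtheta \<tau> (r + z) * rtheta \<tau> (- (p + q + r) + z))"
  have tr: "entire (\<lambda>z. rtheta \<tau> (a + z))" for a
    using entire_translate[OF entire_rtheta[OF \<tau>], of a] by (simp add: add.commute)
  have per: "rtheta \<tau> (a + (z + ivec n)) = rtheta \<tau> (a + z)" for a z n
    using rtheta_periodic[of \<tau> "a + z" n] by (simp add: add.assoc)
  have quasi: "rtheta \<tau> (a + (z + \<tau> *v ivec m)) = automorphy \<tau> m (a + z) * rtheta \<tau> (a + z)" for a z m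
    using rtheta_quasi_periodic[OF \<tau>, of "a + z" m] by (simp add: add.assoc)
  have aut: "(automorphy \<tau> m (p + z) * automorphy \<tau> m (q + z)) *
     (automorphy \<tau> m (r + z) * automorphy \<tau> m (- (p + q + r) + z)) = automorphy \<tau> m z ^ 4" for m z
    unfolding automorphy_def exp_add[symmetric] exp_of_nat_mult[symmetric]
    by (rule arg_cong[of _ _ exp]) (simp add: cbil_simps algebra_simps)
  have "\<exists>c. lattice_periodic 4 c \<and> ?f = theta_series c ((1 / real 4) *\<^sub>R \<tau>)"
  proof (rule quasi_periodic_imp_theta_series[OF \<tau>])
    show "entire ?f" by (intro entire_mult tr)
    show "?f (z + ivec n) = ?f z" for z n by (simp only: per)
    show "?f (z + \<tau> *v ivec m) = automorphy \<tau> m z ^ 4 * ?f z" for z m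
      unfolding quasi aut[symmetric] by (simp only: mult_ac)
  qed simp
  then show ?thesis by (auto simp: fun_eq_iff)
qed

section \<open>Jets of theta functions of order four at the origin\<close>

definition rtheta_grad :: "complex^'g^'g \<Rightarrow> complex^'g \<Rightarrow> complex^'g" where
  "rtheta_grad \<tau> p = (\<chi> i. dir_deriv (axis i 1) (rtheta \<tau>) p)"

lemma theta_series_cbil_expand:
  assumes "pos_im \<tau>" "poly_bounded c"
  shows "theta_series (\<lambda>n. c n * cbil (ivec n) v) \<tau> z =
    (\<Sum>i\<in>UNIV. v $ i * theta_series (\<lambda>n. c n * cbil (ivec n) (axis i 1)) \<tau> z)"
proof -
  have pb: "poly_bounded (\<lambda>n. v $ i * (c n * cbil (ivec n) (axis i 1)))" for i
    by (intro poly_bounded_cmult poly_bounded_mult poly_bounded_cbil assms(2))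
  have "(\<lambda>n. c n * cbil (ivec n) v) = (\<lambda>n. \<Sum>i\<in>UNIV. v $ i * (c n * cbil (ivec n) (axis i 1)))"
    unfolding cbil_axis by (simp add: cbil_def sum_distrib_left mult_ac)
  then show ?thesis
    by (simp only: theta_series_sum[OF assms(1) pb] theta_series_cmult)
qed

lemma dir_deriv_rtheta:
  assumes "\<tau> \<in> siegel_space"
  shows "dir_deriv v (rtheta \<tau>) p = cbil (rtheta_grad \<tau> p) v"
proof -
  have pos: "pos_im \<tau>" using assms by (simp add: siegel_space_iff)
  have D: "dir_deriv v (rtheta \<tau>) p = 2 * of_real pi * \<i> * theta_series (\<lambda>n. 1 * cbil (ivec n) v) \<tau> p" for v
    unfolding rtheta_def dir_deriv_theta_series[OF pos poly_bounded_const] theta_series_cmult[symmetric]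
    by (simp add: mult_ac)
  have "dir_deriv v (rtheta \<tau>) p = (\<Sum>i\<in>UNIV. v $ i * dir_deriv (axis i 1) (rtheta \<tau>) p)"
    unfolding D theta_series_cbil_expand[OF pos poly_bounded_const, of 1 v]
    by (simp add: sum_distrib_left mult_ac)
  then show ?thesis by (simp add: cbil_def rtheta_grad_def mult.commute)
qed

lemma rtheta_has_derivative:
  assumes "\<tau> \<in> siegel_space"
  shows "(rtheta \<tau> has_derivative (\<lambda>h. cbil (rtheta_grad \<tau> p) h)) (at p)"
proof -
  have pos: "pos_im \<tau>" using assms by (simp add: siegel_space_iff)
  have "theta_series (\<lambda>n. 1 * (2 * of_real pi * \<i> * cbil (ivec n) h)) \<tau> p = cbil (rtheta_grad \<tau> p) h" for h
    using dir_deriv_rtheta[OF assms, of h p]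
    unfolding rtheta_def dir_deriv_theta_series[OF pos poly_bounded_const] .
  then show ?thesis
    using theta_series_has_derivative[OF pos poly_bounded_const[of 1], of p] by (simp add: rtheta_def)
qed

lemma continuous_rtheta_grad:
  assumes "\<tau> \<in> siegel_space"
  shows "continuous_on UNIV (rtheta_grad \<tau>)"
  unfolding rtheta_grad_def
  by (intro continuous_intros entire_continuous entire_rtheta_dir_deriv assms)

lemma deriv_rtheta_line:
  assumes "\<tau> \<in> siegel_space"
  shows "deriv (\<lambda>t. rtheta \<tau> (p + t *s v)) 0 = cbil (rtheta_grad \<tau> p) v"
  using dir_deriv_rtheta[OF assms, of v p] by (simp add: dir_deriv_def)

lemma higher_deriv_of_order_four:
  assumes \<tau>: "\<tau> \<in> siegel_space" and c: "lattice_periodic 4 c"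
    and eq: "\<And>z. f z = theta_series c ((1/4) *\<^sub>R \<tau>) z"
  shows "(deriv ^^ k) (\<lambda>t. f (t *s v)) 0 =
    (2 * of_real pi * \<i>) ^ k * theta_series (\<lambda>n. c n * cbil (ivec n) v ^ k) ((1/4) *\<^sub>R \<tau>) 0"
proof -
  note pos = pos_im_quarter[OF \<tau>]
  have pb: "poly_bounded c" by (rule lattice_periodic_imp_poly_bounded[OF c]) simp
  have "(deriv ^^ k) (\<lambda>t. f (t *s v)) 0 = (deriv ^^ k) (\<lambda>t. theta_series c ((1/4) *\<^sub>R \<tau>) (0 + t *s v)) 0"
    by (simp only: eq add_0)
  also have "\<dots> = theta_series (\<lambda>n. c n * (2 * of_real pi * \<i> * cbil (ivec n) v) ^ k) ((1/4) *\<^sub>R \<tau>) (0 + 0 *s v)"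
    by (simp only: higher_deriv_theta_series_line[OF pos pb])
  also have "\<dots> = (2 * of_real pi * \<i>) ^ k * theta_series (\<lambda>n. c n * cbil (ivec n) v ^ k) ((1/4) *\<^sub>R \<tau>) 0"
    unfolding theta_series_cmult[symmetric] by (simp add: power_mult_distrib mult_ac)
  finally show ?thesis .
qed

text \<open>The product of four translates with sum zero detects tangent directions at the origin: with one
  factor vanishing there, its derivative is that of this factor up to a nonzero constant.\<close>

theorem order_four_separates_tangent_vectors:
  fixes \<tau> :: "complex^'g^'g"
  assumes \<tau>: "\<tau> \<in> siegel_space"
    and kill: "\<And>c. lattice_periodic 4 c \<Longrightarrow>
      theta_series (\<lambda>n. c n * cbil (ivec n) k) ((1/4) *\<^sub>R \<tau>) 0 = 0"
  shows "k = 0"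
proof (rule ccontr)
  assume "k \<noteq> 0"
  then obtain p where p: "rtheta \<tau> p = 0" "cbil (rtheta_grad \<tau> p) k \<noteq> 0"
    using rtheta_transverse_zero[OF \<tau>] dir_deriv_rtheta[OF \<tau>] by metis
  obtain q where q: "rtheta \<tau> q \<noteq> 0" using rtheta_not_identically_zero[OF \<tau>] by blast
  obtain r where r: "rtheta \<tau> r \<noteq> 0" "rtheta \<tau> (- (p + q + r)) \<noteq> 0"
  proof -
    let ?U = "{r. rtheta \<tau> (- (p + q + r)) \<noteq> 0}"
    have "open ?U"
      by (intro open_Collect_neq entire_continuous_compose[OF entire_rtheta[OF \<tau>]] continuous_intros)
    moreover have "- (p + q) - q \<in> ?U" using q by simp
    ultimately show ?thesis
      using entire_nonzero_dense[of "rtheta \<tau>" q ?U] entire_rtheta[OF \<tau>] q that by blast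
  qed
  obtain c where c: "lattice_periodic 4 c" "\<And>z. (rtheta \<tau> (p + z) * rtheta \<tau> (q + z)) *
    (rtheta \<tau> (r + z) * rtheta \<tau> (- (p + q + r) + z)) = theta_series c ((1/4) *\<^sub>R \<tau>) z"
    using product_of_translates[OF \<tau>] by blast
  let ?l = "\<lambda>a t. rtheta \<tau> (a + t *s k)"
  have hol: "?l a holomorphic_on UNIV" for a by (rule entire_line[OF entire_rtheta[OF \<tau>]])
  have D: "(?l a has_field_derivative cbil (rtheta_grad \<tau> a) k) (at 0)" for a
    using holomorphic_derivI[OF hol open_UNIV UNIV_I, of a 0] deriv_rtheta_line[OF \<tau>, of a k] by simp
  have "((\<lambda>t. (?l p t * ?l q t) * (?l r t * ?l (- (p + q + r)) t)) has_field_derivative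
      cbil (rtheta_grad \<tau> p) k * rtheta \<tau> q * rtheta \<tau> r * rtheta \<tau> (- (p + q + r))) (at 0)"
    by (rule derivative_eq_intros D refl)+ (use p(1) in simp)
  then have "deriv (\<lambda>t. (?l p t * ?l q t) * (?l r t * ?l (- (p + q + r)) t)) 0 =
      cbil (rtheta_grad \<tau> p) k * rtheta \<tau> q * rtheta \<tau> r * rtheta \<tau> (- (p + q + r))"
    by (rule DERIV_imp_deriv)
  moreover have "(deriv ^^ 1) (\<lambda>t. (?l p t * ?l q t) * (?l r t * ?l (- (p + q + r)) t)) 0 = 0"
    using higher_deriv_of_order_four[OF \<tau> c(1) c(2), of 1 k] kill[OF c(1)] by simp
  ultimately show False using p q r by simp
qed

lemma cbil_bilinear_expand:
  "cbil x (\<eta> *v y) = (\<Sum>a\<in>UNIV. \<Sum>b\<in>UNIV. \<eta> $ a $ b * (x $ a * y $ b))"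
  by (simp add: cbil_def matrix_vector_mult_def sum_distrib_left mult_ac)

text \<open>The first derivatives of the product vanish at the origin, so the vector field in the operator
  contributes nothing; its third derivative is that of the product of the three gradients.\<close>

lemma cubic_symbol_on_gradients:
  fixes \<tau> \<eta> :: "complex^'g^'g"
  assumes \<tau>: "\<tau> \<in> siegel_space" and sym: "transpose \<eta> = \<eta>"
    and kill: "\<And>i. \<exists>b. \<forall>c. lattice_periodic 4 c \<longrightarrow> theta_series
      (\<lambda>n. c n * (qform \<eta> n * cbil (ivec n) (axis i 1) - cbil (ivec n) b)) ((1/4) *\<^sub>R \<tau>) 0 = 0"
    and p: "rtheta \<tau> p = 0" and q: "rtheta \<tau> q = 0" and r: "rtheta \<tau> r = 0"
    and \<alpha>: "\<alpha> = rtheta_grad \<tau> p" and \<beta>: "\<beta> = rtheta_grad \<tau> q" and \<gamma>: "\<gamma> = rtheta_grad \<tau> r"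
  shows "(cbil \<alpha> (\<eta> *v \<beta>) * \<gamma> $ i + cbil \<alpha> (\<eta> *v \<gamma>) * \<beta> $ i + cbil \<beta> (\<eta> *v \<gamma>) * \<alpha> $ i)
    * rtheta \<tau> (- (p + q + r)) = 0"
proof -
  let ?\<tau> = "(1/4) *\<^sub>R \<tau>"
  define w where "w = rtheta \<tau> (- (p + q + r))"
  note pos = pos_im_quarter[OF \<tau>]
  obtain c where c: "lattice_periodic 4 c" "\<And>z. (rtheta \<tau> (p + z) * rtheta \<tau> (q + z)) *
    (rtheta \<tau> (r + z) * rtheta \<tau> (- (p + q + r) + z)) = theta_series c ?\<tau> z"
    using product_of_translates[OF \<tau>] by blast
  have pb: "poly_bounded c" by (rule lattice_periodic_imp_poly_bounded[OF c(1)]) simp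
  define L where "L = (\<lambda>P. theta_series (\<lambda>n. c n * P n) ?\<tau> 0)"
  have L_add: "L (\<lambda>n. P n + Q n) = L P + L Q" if "poly_bounded P" "poly_bounded Q" for P Q
    unfolding L_def using theta_series_add[OF pos poly_bounded_mult[OF pb that(1)] poly_bounded_mult[OF pb that(2)]]
    by (simp add: distrib_left)
  have L_cmult: "L (\<lambda>n. a * P n) = a * L P" for a P
    unfolding L_def theta_series_cmult[symmetric] by (simp add: mult_ac)
  have L_diff: "L (\<lambda>n. P n - Q n) = L P - L Q" if "poly_bounded P" "poly_bounded Q" for P Q
    using L_add[OF that(1) poly_bounded_cmult[OF that(2), of "-1"]] L_cmult[of "-1" Q] by simp
  have L_sum: "L (\<lambda>n. \<Sum>a\<in>A. P a n) = (\<Sum>a\<in>A. L (P a))" if "\<And>a. poly_bounded (P a)" for P and A :: "'g set"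
    unfolding L_def sum_distrib_left
    by (rule theta_series_sum[OF pos]) (intro poly_bounded_mult pb that)
  let ?l = "\<lambda>v a t. rtheta \<tau> (a + t *s v)"
  have hol: "?l v a holomorphic_on UNIV" for v a by (rule entire_line[OF entire_rtheta[OF \<tau>]])
  have zeros: "?l v p 0 = 0" "?l v q 0 = 0" "?l v r 0 = 0" for v using p q r by simp_all
  have first: "L (\<lambda>n. cbil (ivec n) v) = 0" for v
    using higher_deriv_of_order_four[OF \<tau> c(1) c(2), of 1 v]
      deriv_product_four_zeros(1)[OF hol[of p v] hol[of q v] hol[of r v] hol[of "- (p + q + r)" v] zeros(1,2)]
    by (simp add: L_def)
  define \<kappa> where "\<kappa> = 6 / (2 * of_real pi * \<i>) ^ 3 * w"
  have third: "L (\<lambda>n. cbil (ivec n) v ^ 3) = \<kappa> * (cbil \<alpha> v * cbil \<beta> v * cbil \<gamma> v)" for v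
    using higher_deriv_of_order_four[OF \<tau> c(1) c(2), of 3 v]
      deriv_product_four_zeros(2)[OF hol[of p v] hol[of q v] hol[of r v] hol[of "- (p + q + r)" v] zeros]
    by (simp add: L_def \<kappa>_def w_def deriv_rtheta_line[OF \<tau>] \<alpha> \<beta> \<gamma> field_simps)
  have pc: "poly_bounded (\<lambda>n. cbil (ivec n) v ^ 3)" for v :: "complex^'g"
    by (intro poly_bounded_power poly_bounded_cbil)
  \<comment> \<open>Polarization of the cube: a product of three linear forms is a combination of four cubes.\<close>
  have polar: "24 * L (\<lambda>n. cbil (ivec n) x * cbil (ivec n) y * cbil (ivec n) z) =
     4 * \<kappa> * (cbil \<alpha> x * cbil \<beta> y * cbil \<gamma> z + cbil \<alpha> y * cbil \<beta> x * cbil \<gamma> z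
       + cbil \<alpha> x * cbil \<beta> z * cbil \<gamma> y + cbil \<alpha> z * cbil \<beta> x * cbil \<gamma> y
       + cbil \<alpha> y * cbil \<beta> z * cbil \<gamma> x + cbil \<alpha> z * cbil \<beta> y * cbil \<gamma> x)" for x y z
  proof -
    have "(\<lambda>n. 24 * (cbil (ivec n) x * cbil (ivec n) y * cbil (ivec n) z)) =
      (\<lambda>n. cbil (ivec n) (x + y + z) ^ 3 - cbil (ivec n) (x + y - z) ^ 3
         - cbil (ivec n) (x - y + z) ^ 3 - cbil (ivec n) (- x + y + z) ^ 3)"
      by (simp add: cbil_simps power3_eq_cube algebra_simps fun_eq_iff)
    then have "24 * L (\<lambda>n. cbil (ivec n) x * cbil (ivec n) y * cbil (ivec n) z) =
      L (\<lambda>n. cbil (ivec n) (x + y + z) ^ 3 - cbil (ivec n) (x + y - z) ^ 3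
         - cbil (ivec n) (x - y + z) ^ 3 - cbil (ivec n) (- x + y + z) ^ 3)"
      by (simp only: L_cmult[symmetric])
    also have "\<dots> = \<kappa> * (cbil \<alpha> (x + y + z) * cbil \<beta> (x + y + z) * cbil \<gamma> (x + y + z))
       - \<kappa> * (cbil \<alpha> (x + y - z) * cbil \<beta> (x + y - z) * cbil \<gamma> (x + y - z))
       - \<kappa> * (cbil \<alpha> (x - y + z) * cbil \<beta> (x - y + z) * cbil \<gamma> (x - y + z))
       - \<kappa> * (cbil \<alpha> (- x + y + z) * cbil \<beta> (- x + y + z) * cbil \<gamma> (- x + y + z))"
      by (simp only: L_diff poly_bounded_diff pc third)
    also have "\<dots> = 4 * \<kappa> * (cbil \<alpha> x * cbil \<beta> y * cbil \<gamma> z + cbil \<alpha> y * cbil \<beta> x * cbil \<gamma> z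
       + cbil \<alpha> x * cbil \<beta> z * cbil \<gamma> y + cbil \<alpha> z * cbil \<beta> x * cbil \<gamma> y
       + cbil \<alpha> y * cbil \<beta> z * cbil \<gamma> x + cbil \<alpha> z * cbil \<beta> y * cbil \<gamma> x)"
      by (simp add: cbil_simps algebra_simps)
    finally show ?thesis .
  qed
  obtain b where b: "theta_series (\<lambda>n. c n * (qform \<eta> n * cbil (ivec n) (axis i 1) - cbil (ivec n) b)) ?\<tau> 0 = 0"
    using kill[of i] c(1) by blast
  have pq: "poly_bounded (\<lambda>n. qform \<eta> n * cbil (ivec n) (axis i 1))"
    by (intro poly_bounded_mult poly_bounded_qform poly_bounded_cbil)
  have "L (\<lambda>n. qform \<eta> n * cbil (ivec n) (axis i 1) - cbil (ivec n) b) = 0"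
    using b by (simp add: L_def)
  then have "L (\<lambda>n. qform \<eta> n * cbil (ivec n) (axis i 1)) = 0"
    using L_diff[OF pq poly_bounded_cbil, of b] first[of b] by simp
  moreover have "(\<lambda>n. qform \<eta> n * cbil (ivec n) (axis i 1)) = (\<lambda>n. \<Sum>a\<in>UNIV. \<Sum>b\<in>UNIV.
      \<eta> $ a $ b * (cbil (ivec n) (axis a 1) * cbil (ivec n) (axis b 1) * cbil (ivec n) (axis i 1)))"
    unfolding qform_def cbil_bilinear_expand cbil_axis
    by (simp add: sum_distrib_left mult_ac)
  ultimately have "L (\<lambda>n. \<Sum>a\<in>UNIV. \<Sum>b\<in>UNIV. \<eta> $ a $ b *
      (cbil (ivec n) (axis a 1) * cbil (ivec n) (axis b 1) * cbil (ivec n) (axis i 1))) = 0"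
    by simp
  moreover have pm: "poly_bounded (\<lambda>n. \<eta> $ a $ b *
      (cbil (ivec n) (axis a 1) * cbil (ivec n) (axis b 1) * cbil (ivec n) (axis i 1)))" for a b
    by (intro poly_bounded_cmult poly_bounded_mult poly_bounded_cbil)
  ultimately have "(\<Sum>a\<in>UNIV. \<Sum>b\<in>UNIV. \<eta> $ a $ b *
      L (\<lambda>n. cbil (ivec n) (axis a 1) * cbil (ivec n) (axis b 1) * cbil (ivec n) (axis i 1))) = 0"
    by (simp only: L_sum poly_bounded_sum pm L_cmult)
  then have "0 = (\<Sum>a\<in>UNIV. \<Sum>b\<in>UNIV. \<eta> $ a $ b *
      (24 * L (\<lambda>n. cbil (ivec n) (axis a 1) * cbil (ivec n) (axis b 1) * cbil (ivec n) (axis i 1))))"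
    by (simp add: sum_distrib_left[symmetric] mult.left_commute[of _ 24])
  also have "\<dots> = (\<Sum>a\<in>UNIV. \<Sum>b\<in>UNIV. 4 * \<kappa> * (
      \<gamma> $ i * (\<eta> $ a $ b * (\<alpha> $ a * \<beta> $ b)) + \<gamma> $ i * (\<eta> $ a $ b * (\<beta> $ a * \<alpha> $ b))
    + \<beta> $ i * (\<eta> $ a $ b * (\<alpha> $ a * \<gamma> $ b)) + \<beta> $ i * (\<eta> $ a $ b * (\<gamma> $ a * \<alpha> $ b))
    + \<alpha> $ i * (\<eta> $ a $ b * (\<gamma> $ a * \<beta> $ b)) + \<alpha> $ i * (\<eta> $ a $ b * (\<beta> $ a * \<gamma> $ b))))"
    unfolding polar unfolding cbil_axis by (intro sum.cong refl) (simp add: algebra_simps)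
  also have "\<dots> = 4 * \<kappa> * (\<gamma> $ i * cbil \<alpha> (\<eta> *v \<beta>) + \<gamma> $ i * cbil \<beta> (\<eta> *v \<alpha>)
    + \<beta> $ i * cbil \<alpha> (\<eta> *v \<gamma>) + \<beta> $ i * cbil \<gamma> (\<eta> *v \<alpha>)
    + \<alpha> $ i * cbil \<gamma> (\<eta> *v \<beta>) + \<alpha> $ i * cbil \<beta> (\<eta> *v \<gamma>))"
    unfolding cbil_bilinear_expand by (simp only: sum_distrib_left[symmetric] sum.distrib)
  also have "\<dots> = 8 * \<kappa> * (cbil \<alpha> (\<eta> *v \<beta>) * \<gamma> $ i + cbil \<alpha> (\<eta> *v \<gamma>) * \<beta> $ i + cbil \<beta> (\<eta> *v \<gamma>) * \<alpha> $ i)"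
    unfolding cbil_symmetric[OF sym, of \<beta> \<alpha>] cbil_symmetric[OF sym, of \<gamma> \<alpha>] cbil_symmetric[OF sym, of \<gamma> \<beta>]
    by (simp add: algebra_simps)
  finally show ?thesis by (auto simp: \<kappa>_def w_def)
qed

text \<open>Two hypersurfaces that meet transversally, one of them translated and reflected, still meet after a small
  displacement. So sums of nearby zeros fill a neighbourhood, and this neighbourhood is not contained in a
  translate of the zero set.\<close>

lemma sums_of_transverse_zeros:
  fixes \<tau> :: "complex^'g^'g"
  assumes \<tau>: "\<tau> \<in> siegel_space" and p: "rtheta \<tau> p = 0" and q: "rtheta \<tau> q = 0"
    and dual: "cbil (rtheta_grad \<tau> p) v = 1" "cbil (rtheta_grad \<tau> p) w = 0"
      "cbil (rtheta_grad \<tau> q) v = 0" "cbil (rtheta_grad \<tau> q) w = 1"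
    and U: "open U" "p \<in> U" and V: "open V" "q \<in> V"
  shows "\<exists>p'\<in>U. \<exists>q'\<in>V. rtheta \<tau> p' = 0 \<and> rtheta \<tau> q' = 0 \<and> rtheta \<tau> (- (p' + q' + r)) \<noteq> 0"
proof -
  let ?P = "\<lambda>y::((complex^'g) \<times> complex) \<times> complex. p + (snd (fst y) *s v + snd y *s w)"
  let ?Q = "\<lambda>y. fst (fst y) - ?P y"
  \<comment> \<open>The map sends a sum and two further coordinates to this sum and the values at two points with that
    sum. Its derivative has a right inverse, so it is open at the given pair of zeros.\<close>
  define \<Psi> where "\<Psi> = (\<lambda>y. ((fst (fst y), rtheta \<tau> (?P y)), rtheta \<tau> (?Q y)))"
  define y0 :: "((complex^'g) \<times> complex) \<times> complex" where "y0 = ((p + q, 0), 0)"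
  define \<alpha> where "\<alpha> = rtheta_grad \<tau> p"
  define \<beta> where "\<beta> = rtheta_grad \<tau> q"
  let ?d = "\<lambda>y::((complex^'g) \<times> complex) \<times> complex. snd (fst y) *s v + snd y *s w"
  have cb: "bounded_linear (cbil a)" for a :: "complex^'g"
    by (rule bounded_linear_intro[where K = "norm a"])
      (use cbil_bound[of a] in \<open>auto simp: cbil_simps scaleR_conv_of_real[where 'a = complex] mult.commute\<close>)
  have bd: "bounded_linear ?d"
    by (intro bounded_linear_add bounded_linear_compose[OF bounded_linear_scale_vector] bounded_linear_intros
        bounded_linear_compose[OF bounded_linear_snd bounded_linear_fst] bounded_linear_snd)
  have dP: "(?P has_derivative ?d) (at y0)"
    using has_derivative_add[OF has_derivative_const bounded_linear_imp_has_derivative[OF bd]] by simp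
  have bff: "bounded_linear (\<lambda>y::((complex^'g) \<times> complex) \<times> complex. fst (fst y))"
    by (rule bounded_linear_compose[OF bounded_linear_fst bounded_linear_fst])
  have dQ: "(?Q has_derivative (\<lambda>y. fst (fst y) - ?d y)) (at y0)"
    by (rule has_derivative_diff[OF bounded_linear_imp_has_derivative[OF bff] dP])
  have P0: "?P y0 = p" and Q0: "?Q y0 = q" by (simp_all add: y0_def)
  let ?L = "\<lambda>y. ((fst (fst y), cbil \<alpha> (?d y)), cbil \<beta> (fst (fst y) - ?d y))"
  have d1: "(rtheta \<tau> has_derivative cbil \<alpha>) (at (?P y0))"
    unfolding P0 \<alpha>_def by (rule rtheta_has_derivative[OF \<tau>])
  have d2: "(rtheta \<tau> has_derivative cbil \<beta>) (at (?Q y0))"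
    unfolding Q0 \<beta>_def by (rule rtheta_has_derivative[OF \<tau>])
  have dPsi: "(\<Psi> has_derivative ?L) (at y0)"
    unfolding \<Psi>_def
    by (intro has_derivative_Pair bounded_linear_imp_has_derivative[OF bff]
        has_derivative_compose[OF dP d1] has_derivative_compose[OF dQ d2])
  let ?G = "\<lambda>y::((complex^'g) \<times> complex) \<times> complex. (fst y, cbil \<beta> (fst (fst y)) - snd y)"
  have blG: "bounded_linear ?G"
    by (intro bounded_linear_Pair bounded_linear_fst bounded_linear_sub bounded_linear_snd
        bounded_linear_compose[OF cb bff])
  have inv: "?L \<circ> ?G = id"
    using dual unfolding \<alpha>_def[symmetric] \<beta>_def[symmetric]
    by (auto simp: fun_eq_iff cbil_simps)
  define T where "T = {y. ?P y \<in> U} \<inter> {y. ?Q y \<in> V}"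
  have cP: "continuous_on UNIV ?P" and cQ: "continuous_on UNIV ?Q" by (intro continuous_intros)+
  have oT: "open T"
    unfolding T_def using open_vimage[OF U(1) cP] open_vimage[OF V(1) cQ]
    by (simp add: vimage_def open_Int)
  have y0T: "y0 \<in> T" using U V P0 Q0 by (simp add: T_def)
  have "\<Psi> y0 \<in> interior (\<Psi> ` T)"
  proof (rule sussmann_open_mapping[OF open_UNIV _ UNIV_I dPsi blG inv])
    have "continuous_on UNIV (\<lambda>y. rtheta \<tau> (?P y))" "continuous_on UNIV (\<lambda>y. rtheta \<tau> (?Q y))"
      by (intro entire_continuous_compose[OF entire_rtheta[OF \<tau>]] cP cQ)+
    then show "continuous_on UNIV \<Psi>" unfolding \<Psi>_def by (intro continuous_intros)
    show "y0 \<in> interior T" using oT y0T by (simp add: interior_open)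
  qed simp
  then have in0: "((p + q, 0), 0) \<in> interior (\<Psi> ` T)"
    using P0 Q0 p q by (simp add: \<Psi>_def y0_def)
  let ?h = "\<lambda>s::complex^'g. ((- s - r, 0::complex), 0::complex)"
  have "open (?h -` interior (\<Psi> ` T))"
    by (intro open_vimage open_interior continuous_intros)
  moreover have "- (p + q + r) \<in> ?h -` interior (\<Psi> ` T)" using in0 by simp
  moreover obtain z0 where "rtheta \<tau> z0 \<noteq> 0" using rtheta_not_identically_zero[OF \<tau>] by blast
  ultimately obtain s where s: "?h s \<in> interior (\<Psi> ` T)" "rtheta \<tau> s \<noteq> 0"
    using entire_nonzero_dense[OF entire_rtheta[OF \<tau>]] by blast
  then have "?h s \<in> \<Psi> ` T" using interior_subset by blast
  then obtain y where y: "y \<in> T" "\<Psi> y = ?h s" by auto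
  have "rtheta \<tau> (?P y) = 0" "rtheta \<tau> (?Q y) = 0" "fst (fst y) = - s - r"
    using y(2)[unfolded \<Psi>_def prod.inject] by blast+
  moreover have "- (?P y + ?Q y + r) = s" using calculation(3) by simp
  moreover have "?P y \<in> U" "?Q y \<in> V" using y(1) by (simp_all add: T_def)
  ultimately show ?thesis using s(2) by metis
qed

lemma dual_basis_of_gradients:
  fixes \<tau> :: "complex^'g^'g"
  assumes \<tau>: "\<tau> \<in> siegel_space" and \<alpha>: "\<alpha> = rtheta_grad \<tau> p" and \<beta>: "\<beta> = rtheta_grad \<tau> q"
    and k: "cbil \<alpha> k = 0" "cbil \<beta> k \<noteq> 0" and ne: "\<alpha> \<noteq> 0"
  obtains v w where "cbil \<alpha> v = 1" "cbil \<alpha> w = 0" "cbil \<beta> v = 0" "cbil \<beta> w = 1"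
proof -
  obtain i where i: "\<alpha> $ i \<noteq> 0" using ne by (auto simp: vec_eq_iff)
  define w where "w = (1 / cbil \<beta> k) *s k"
  define x where "x = axis i (1 / \<alpha> $ i)"
  have w: "cbil \<alpha> w = 0" "cbil \<beta> w = 1" using k by (simp_all add: w_def cbil_simps)
  have x: "cbil \<alpha> x = 1" using i by (simp add: x_def cbil_axis)
  show thesis
    by (rule that[of "x - cbil \<beta> x *s w" w]) (use w x in \<open>simp_all add: cbil_simps\<close>)
qed

text \<open>For two zeros with independent gradients the third gradient in the cubic relation can be taken equal to
  the first; comparing coefficients, the quadratic form vanishes on the first gradient and on the pair.
  As a zero transverse to any given direction exists, the form has every gradient in its kernel, and then
  every vector.\<close>

theorem order_four_no_divisible_cubic_symbol:
  fixes \<tau> \<eta> :: "complex^'g^'g"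
  assumes g: "2 \<le> CARD('g)" and \<tau>: "\<tau> \<in> siegel_space" and sym: "transpose \<eta> = \<eta>"
    and kill: "\<And>i. \<exists>b. \<forall>c. lattice_periodic 4 c \<longrightarrow> theta_series
      (\<lambda>n. c n * (qform \<eta> n * cbil (ivec n) (axis i 1) - cbil (ivec n) b)) ((1/4) *\<^sub>R \<tau>) 0 = 0"
  shows "\<eta> = 0"
proof -
  let ?g = "rtheta_grad \<tau>"
  define cub where "cub = (\<lambda>p q r i. cbil (?g p) (\<eta> *v ?g q) * ?g r $ i
      + cbil (?g p) (\<eta> *v ?g r) * ?g q $ i + cbil (?g q) (\<eta> *v ?g r) * ?g p $ i)"
  have transverse: "\<exists>q. rtheta \<tau> q = 0 \<and> cbil (?g q) k \<noteq> 0" if "k \<noteq> 0" for k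
    using rtheta_transverse_zero[OF \<tau> that] dir_deriv_rtheta[OF \<tau>] by metis
  have cubic: "cub p q r i = 0"
    if p: "rtheta \<tau> p = 0" and q: "rtheta \<tau> q = 0" and r: "rtheta \<tau> r = 0"
      and dual: "cbil (?g p) v = 1" "cbil (?g p) w = 0" "cbil (?g q) v = 0" "cbil (?g q) w = 1"
    for p q r v w i
  proof (rule ccontr)
    assume ne: "cub p q r i \<noteq> 0"
    have "continuous_on UNIV (\<lambda>y. cub (fst y) (snd y) r i)"
    proof -
      have c: "continuous_on UNIV (\<lambda>y. ?g (fst y))" "continuous_on UNIV (\<lambda>y. ?g (snd y))"
        by (intro continuous_on_compose2[OF continuous_rtheta_grad[OF \<tau>]] continuous_intros; simp)+
      show ?thesis unfolding cub_def by (intro continuous_intros c)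
    qed
    then have "open {y. cub (fst y) (snd y) r i \<noteq> 0}" by (intro open_Collect_neq continuous_intros)
    then obtain U V where UV: "open U" "open V" "(p, q) \<in> U \<times> V"
        "U \<times> V \<subseteq> {y. cub (fst y) (snd y) r i \<noteq> 0}"
      by (rule open_prod_elim) (use ne in auto)
    then have UVpq: "p \<in> U" "q \<in> V" by simp_all
    obtain p' q' where pq: "p' \<in> U" "q' \<in> V" "rtheta \<tau> p' = 0" "rtheta \<tau> q' = 0"
        "rtheta \<tau> (- (p' + q' + r)) \<noteq> 0"
      using sums_of_transverse_zeros[OF \<tau> p q dual UV(1) UVpq(1) UV(2) UVpq(2)] by blast
    have "(p', q') \<in> U \<times> V" using pq by simp
    then have "cub p' q' r i \<noteq> 0" using UV(4) by auto
    moreover have "cub p' q' r i * rtheta \<tau> (- (p' + q' + r)) = 0"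
      unfolding cub_def
      by (rule cubic_symbol_on_gradients[OF \<tau> sym kill pq(3,4) r refl refl refl])
    ultimately show False using pq(5) by simp
  qed
  \<comment> \<open>The vector \<^term>\<open>k\<close> witnesses that the gradients at \<^term>\<open>p\<close> and \<^term>\<open>q\<close> are independent.\<close>
  have indep: "cbil (?g p) (\<eta> *v ?g q) = 0 \<and> cbil (?g p) (\<eta> *v ?g p) = 0"
    if p: "rtheta \<tau> p = 0" and q: "rtheta \<tau> q = 0" and ne: "?g p \<noteq> 0"
      and k: "cbil (?g p) k = 0" "cbil (?g q) k \<noteq> 0" for p q k
  proof -
    obtain v w where dual: "cbil (?g p) v = 1" "cbil (?g p) w = 0" "cbil (?g q) v = 0" "cbil (?g q) w = 1"
      using dual_basis_of_gradients[OF \<tau> refl refl k ne] by metis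
    have comb: "2 * cbil (?g p) (\<eta> *v ?g q) * cbil (?g p) x + cbil (?g p) (\<eta> *v ?g p) * cbil (?g q) x = 0" for x
    proof -
      have "(\<Sum>i\<in>UNIV. cub p q p i * x $ i) = 0"
        by (simp add: cubic[OF p q p dual])
      moreover have "(\<Sum>i\<in>UNIV. cub p q p i * x $ i) = cbil (?g p) (\<eta> *v ?g q) * cbil (?g p) x +
          cbil (?g p) (\<eta> *v ?g p) * cbil (?g q) x + cbil (?g q) (\<eta> *v ?g p) * cbil (?g p) x"
        unfolding cub_def cbil_def[of _ x] by (simp add: sum.distrib distrib_right sum_distrib_left mult.assoc)
      ultimately show ?thesis using cbil_symmetric[OF sym, of "?g q" "?g p"] by (simp add: algebra_simps)
    qed
    show ?thesis using comb[of v] comb[of w] dual by simp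
  qed
  have alpha0: "\<eta> *v ?g p = 0" if p: "rtheta \<tau> p = 0" for p
  proof (rule ccontr)
    assume ne: "\<eta> *v ?g p \<noteq> 0"
    then have ap: "?g p \<noteq> 0" by auto
    obtain i where i: "?g p $ i \<noteq> 0" using ap by (auto simp: vec_eq_iff)
    have "\<exists>j. j \<noteq> i"
    proof (rule ccontr)
      assume "\<nexists>j. j \<noteq> i"
      then have "(UNIV :: 'g set) = {i}" by auto
      then have "CARD('g) = 1" by (metis card.empty card.insert empty_iff finite.emptyI One_nat_def)
      then show False using g by simp
    qed
    then obtain j where j: "j \<noteq> i" by blast
    \<comment> \<open>These vectors span the space on which the gradient at \<^term>\<open>p\<close> vanishes.\<close>
    define perp where "perp = (\<lambda>j. axis j (?g p $ i) - axis i (?g p $ j))"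
    have perp: "cbil x (perp j) = x $ j * ?g p $ i - x $ i * ?g p $ j" for x j
      by (simp add: perp_def cbil_simps cbil_axis)
    have "perp j $ j \<noteq> 0" using i j by (simp add: perp_def axis_def)
    then have "perp j \<noteq> 0" by (metis zero_index)
    then obtain q0 where q0: "rtheta \<tau> q0 = 0" "cbil (?g q0) (perp j) \<noteq> 0" using transverse by blast
    have self: "cbil (?g p) (\<eta> *v ?g p) = 0"
      using indep[OF p q0(1) ap _ q0(2)] perp[of "?g p" j] by (simp add: mult.commute)
    obtain q where q: "rtheta \<tau> q = 0" "cbil (?g q) (\<eta> *v ?g p) \<noteq> 0" using transverse[OF ne] by blast
    have "cbil (?g q) (perp l) = 0" for l
    proof (rule ccontr)
      assume "cbil (?g q) (perp l) \<noteq> 0"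
      then have "cbil (?g p) (\<eta> *v ?g q) = 0"
        using indep[OF p q(1) ap _ _, of "perp l"] perp[of "?g p" l] by (simp add: mult.commute)
      then show False using q(2) cbil_symmetric[OF sym, of "?g q" "?g p"] by simp
    qed
    then have "?g q $ l * ?g p $ i = ?g q $ i * ?g p $ l" for l
      using perp[of "?g q" l] by simp
    then have "?g q = (?g q $ i / ?g p $ i) *s ?g p"
      using i by (simp add: vec_eq_iff field_simps)
    then have "cbil (?g q) (\<eta> *v ?g p) = (?g q $ i / ?g p $ i) * cbil (?g p) (\<eta> *v ?g p)"
      by (metis cbil_scale_left)
    then show False using self q(2) by simp
  qed
  show ?thesis
  proof (rule ccontr)
    assume "\<eta> \<noteq> 0"
    then obtain i where i: "\<eta> $ i \<noteq> 0" by (auto simp: vec_eq_iff)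
    then obtain q where q: "rtheta \<tau> q = 0" "cbil (?g q) (\<eta> $ i) \<noteq> 0" using transverse by blast
    have "cbil (?g q) (\<eta> $ i) = (\<eta> *v ?g q) $ i"
      by (simp add: cbil_def matrix_vector_mult_def mult.commute)
    then show False using alpha0[OF q(1)] q(2) by simp
  qed
qed

section \<open>The action of the symplectic group\<close>

lemma sum_over_sum_type:
  "(\<Sum>k\<in>(UNIV :: ('a::finite + 'b::finite) set). f k) = (\<Sum>k\<in>UNIV. f (Inl k)) + (\<Sum>k\<in>UNIV. f (Inr k))"
  using sum.Plus[of "UNIV :: 'a set" "UNIV :: 'b set" f] by (simp add: o_def)

lemma cmat_mult: "cmat (A ** B) = cmat A ** cmat B"
  by (simp add: cmat_def matrix_matrix_mult_def vec_eq_iff)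

lemma cmat_mat_1: "cmat (mat 1) = mat 1"
  by (simp add: cmat_def mat_def vec_eq_iff)

lemma cmat_transpose: "cmat (transpose A) = transpose (cmat A)"
  by (simp add: cmat_def transpose_def vec_eq_iff)

lemma ivec_matrix_vector: "ivec (A *v n) = cmat A *v ivec n"
  by (simp add: ivec_def cmat_def matrix_vector_mult_def vec_eq_iff)

text \<open>The symplectic relations between the blocks of a matrix.\<close>

definition block_relations :: "complex^'g^'g \<Rightarrow> complex^'g^'g \<Rightarrow> complex^'g^'g \<Rightarrow> complex^'g^'g \<Rightarrow> bool" where
  "block_relations a b c d \<longleftrightarrow> transpose a ** c = transpose c ** a \<and> transpose b ** d = transpose d ** b \<and>
    transpose a ** d - transpose c ** b = mat 1"

lemma block_relations_of_symplectic:
  fixes M :: "complex^('g::finite+'g)^('g+'g)"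
  assumes "transpose M ** cmat symplectic_form ** M = cmat symplectic_form"
  shows "block_relations (\<chi> i j. M $ Inl i $ Inl j) (\<chi> i j. M $ Inl i $ Inr j)
    (\<chi> i j. M $ Inr i $ Inl j) (\<chi> i j. M $ Inr i $ Inr j)"
proof -
  have JM: "(cmat symplectic_form ** M) $ Inl k $ j = M $ Inr k $ j"
    "(cmat symplectic_form ** M) $ Inr k $ j = - M $ Inl k $ j" for k :: 'g and j
    by (simp_all add: matrix_matrix_mult_def sum_over_sum_type cmat_def symplectic_form_def
        of_bool_def[symmetric] if_distrib[of of_int] if_distribR sum.delta sum.delta' if_distrib[of "\<lambda>x. x * _"]
        cong: if_cong)
  have entry: "(\<Sum>k\<in>UNIV. M $ Inl k $ i * M $ Inr k $ j) - (\<Sum>k\<in>UNIV. M $ Inr k $ i * M $ Inl k $ j) =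
      cmat symplectic_form $ i $ j" for i j
  proof -
    have "cmat symplectic_form $ i $ j = (transpose M ** (cmat symplectic_form ** M)) $ i $ j"
      using assms by (simp add: matrix_mul_assoc)
    also have "\<dots> = (\<Sum>k\<in>UNIV. M $ Inl k $ i * (cmat symplectic_form ** M) $ Inl k $ j)
        + (\<Sum>k\<in>UNIV. M $ Inr k $ i * (cmat symplectic_form ** M) $ Inr k $ j)"
    proof -
      have "(A ** B) $ i $ j = (\<Sum>k\<in>UNIV. A $ i $ k * B $ k $ j)"
        for A B :: "complex^('g+'g)^('g+'g)" by (simp add: matrix_matrix_mult_def)
      then show ?thesis by (simp only: sum_over_sum_type) (simp add: transpose_def)
    qed
    finally show ?thesis by (simp add: JM sum_negf)
  qed
  show ?thesis
    unfolding block_relations_def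
    using entry[of "Inl _" "Inl _"] entry[of "Inr _" "Inr _"] entry[of "Inl _" "Inr _"]
    by (simp add: vec_eq_iff matrix_matrix_mult_def transpose_def cmat_def symplectic_form_def mat_def
        mult.commute algebra_simps)
qed

lemma Sp_int_block_relations:
  fixes \<gamma> :: "int^('g::finite+'g)^('g+'g)"
  assumes "\<gamma> \<in> Sp_int"
  shows "block_relations (cmat (blk_a \<gamma>)) (cmat (blk_b \<gamma>)) (cmat (blk_c \<gamma>)) (cmat (blk_d \<gamma>))"
    and "block_relations (transpose (cmat (blk_a \<gamma>))) (transpose (cmat (blk_c \<gamma>)))
      (transpose (cmat (blk_b \<gamma>))) (transpose (cmat (blk_d \<gamma>)))"
proof -
  let ?M = "cmat \<gamma>" and ?J = "cmat (symplectic_form :: int^('g+'g)^('g+'g))"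
  have blocks: "(\<chi> i j. ?M $ Inl i $ Inl j) = cmat (blk_a \<gamma>)" "(\<chi> i j. ?M $ Inl i $ Inr j) = cmat (blk_b \<gamma>)"
    "(\<chi> i j. ?M $ Inr i $ Inl j) = cmat (blk_c \<gamma>)" "(\<chi> i j. ?M $ Inr i $ Inr j) = cmat (blk_d \<gamma>)"
    by (simp_all add: cmat_def blk_a_def blk_b_def blk_c_def blk_d_def vec_eq_iff)
  have "cmat (transpose \<gamma> ** symplectic_form ** \<gamma>) = ?J"
    using assms by (simp add: Sp_int_def)
  then have sp: "transpose ?M ** ?J ** ?M = ?J" by (simp add: cmat_mult cmat_transpose)
  show "block_relations (cmat (blk_a \<gamma>)) (cmat (blk_b \<gamma>)) (cmat (blk_c \<gamma>)) (cmat (blk_d \<gamma>))"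
    using block_relations_of_symplectic[OF sp] unfolding blocks .
  \<comment> \<open>The transpose of a symplectic matrix is symplectic, because a left inverse is a right inverse.\<close>
  have JJ: "?J ** ?J = - mat 1"
  proof -
    have "(?J ** ?J) $ i $ j = (- mat 1) $ i $ j" for i j
      by (cases i; cases j)
        (auto simp: matrix_matrix_mult_def sum_over_sum_type cmat_def symplectic_form_def mat_def
          if_distrib[of of_int] if_distrib[of "\<lambda>x. x * _"] sum.delta sum.delta' cong: if_cong)
    then show ?thesis by (simp add: vec_eq_iff)
  qed
  have neg: "(- A) ** B = - (A ** B)" "A ** (- B) = - (A ** B)" for A B :: "complex^('g+'g)^('g+'g)"
    by (simp_all add: matrix_matrix_mult_def vec_eq_iff sum_negf)
  have "(- (?J ** transpose ?M ** ?J)) ** ?M = mat 1"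
    using arg_cong[OF sp, of "\<lambda>A. - (?J ** A)"] JJ by (simp add: matrix_mul_assoc neg)
  then have "?M ** (- (?J ** transpose ?M ** ?J)) = mat 1"
    by (simp only: matrix_left_right_inverse)
  then have "- (?M ** ?J ** transpose ?M ** ?J) = mat 1" by (simp add: neg matrix_mul_assoc)
  then have "- (?M ** ?J ** transpose ?M ** ?J) ** ?J = ?J" by simp
  then have "- (?M ** ?J ** transpose ?M ** (?J ** ?J)) = ?J" by (simp add: neg matrix_mul_assoc)
  then have "transpose (transpose ?M) ** ?J ** transpose ?M = ?J"
    unfolding JJ by (simp add: neg)
  from block_relations_of_symplectic[OF this]
  show "block_relations (transpose (cmat (blk_a \<gamma>))) (transpose (cmat (blk_c \<gamma>)))
      (transpose (cmat (blk_b \<gamma>))) (transpose (cmat (blk_d \<gamma>)))"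
    unfolding blocks[symmetric] by (simp add: transpose_def)
qed

lemma block_relations_form:
  assumes "block_relations a b c d"
  shows "cbil (c *v s + d *v t) (a *v u + b *v v) - cbil (a *v s + b *v t) (c *v u + d *v v) = cbil t u - cbil s v"
proof -
  have r: "transpose c ** a = transpose a ** c" "transpose d ** b = transpose b ** d"
    "transpose a ** d = mat 1 + transpose c ** b"
    using assms by (auto simp: block_relations_def algebra_simps)
  have r': "transpose d ** a = mat 1 + transpose b ** c"
  proof -
    have "transpose (A + B) = transpose A + transpose B" for A B :: "complex^'a^'a"
      by (simp add: transpose_def vec_eq_iff)
    then show ?thesis
      using arg_cong[OF r(3), of transpose] by (simp add: matrix_transpose_mul transpose_mat)
  qed
  have move: "cbil (A *v x) (B *v y) = cbil x ((transpose A ** B) *v y)"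
    for A B :: "complex^'a^'a" and x y
    using cbil_matrix[of x "transpose A" "B *v y"]
    by (simp add: transpose_transpose matrix_vector_mul_assoc[symmetric])
  show ?thesis
    by (simp add: cbil_add_left cbil_add_right move r r' matrix_vector_mult_add_rdistrib)
qed

definition vcnj :: "complex^'g \<Rightarrow> complex^'g" where
  "vcnj v = (\<chi> i. cnj (v $ i))"

text \<open>For symmetric \<^term>\<open>\<tau>\<close> the mixed terms of real and imaginary parts cancel.\<close>

lemma Im_hermitian_pos:
  assumes "\<tau> \<in> siegel_space" "v \<noteq> 0"
  shows "Im (cbil (vcnj v) (\<tau> *v v)) > 0"
proof -
  have sym: "transpose \<tau> = \<tau>" and pos: "pos_im \<tau>" using assms(1) by (auto simp: siegel_space_iff)
  define x where "x = (\<chi> i. Re (v $ i))"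
  define y where "y = (\<chi> i. Im (v $ i))"
  have v: "v = cvec x + \<i> *s cvec y" "vcnj v = cvec x - \<i> *s cvec y"
    by (auto simp: vec_eq_iff cvec_def vcnj_def x_def y_def complex_eq_iff)
  have Y: "Im (cbil (cvec u) (\<tau> *v cvec u)) = u \<bullet> ((\<chi> i j. Im (\<tau> $ i $ j)) *v u)" for u
    by (simp add: cbil_def matrix_vector_mult_def cvec_def inner_vec_def)
  have ge: "0 \<le> u \<bullet> ((\<chi> i j. Im (\<tau> $ i $ j)) *v u)" for u :: "real^'a"
    using pos by (cases "u = 0") (auto simp: pos_im_def intro: less_imp_le)
  have "cbil (vcnj v) (\<tau> *v v) = cbil (cvec x) (\<tau> *v cvec x) + cbil (cvec y) (\<tau> *v cvec y)"
    unfolding v(2) unfolding v(1) using cbil_symmetric[OF sym, of "cvec x" "cvec y"]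
    by (simp add: cbil_simps matrix_vector_right_distrib vector_scalar_commute algebra_simps)
  moreover have "x \<noteq> 0 \<or> y \<noteq> 0"
    using assms(2) by (auto simp: vec_eq_iff x_def y_def complex_eq_iff)
  then have "0 < x \<bullet> ((\<chi> i j. Im (\<tau> $ i $ j)) *v x) \<or> 0 < y \<bullet> ((\<chi> i j. Im (\<tau> $ i $ j)) *v y)"
    using pos by (auto simp: pos_im_def)
  ultimately show ?thesis using ge[of x] ge[of y] by (auto simp: Y)
qed

lemma matrix_inv_inverse:
  fixes X :: "complex^'g^'g"
  assumes "invertible X"
  shows "X ** matrix_inv X = mat 1" "matrix_inv X ** X = mat 1"
proof -
  have "X ** matrix_inv X = mat 1 \<and> matrix_inv X ** X = mat 1"
    unfolding matrix_inv_def by (rule someI_ex) (use assms in \<open>simp add: invertible_def\<close>)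
  then show "X ** matrix_inv X = mat 1" "matrix_inv X ** X = mat 1" by blast+
qed

lemma invertible_if_injective_matrix:
  fixes X :: "complex^'g^'g"
  assumes "\<And>v. X *v v = 0 \<Longrightarrow> v = 0"
  shows "invertible X" "X ** matrix_inv X = mat 1" "matrix_inv X ** X = mat 1"
proof -
  have "\<exists>B. B ** X = mat 1"
    unfolding matrix_left_invertible_ker using assms by blast
  then show inv: "invertible X" by (simp add: invertible_left_inverse)
  show "X ** matrix_inv X = mat 1" "matrix_inv X ** X = mat 1" by (rule matrix_inv_inverse[OF inv])+
qed

text \<open>The relations say that numerator and denominator preserve the alternating form. Applied to a vector and
  its conjugate this compares the Hermitian forms given by the imaginary parts of the matrix and of its
  image, so the denominator is injective and the image is again positive.\<close>

lemma symplectic_action: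
  fixes \<gamma> :: "int^('g::finite+'g)^('g+'g)" and \<tau> :: "complex^'g^'g"
  assumes \<gamma>: "\<gamma> \<in> Sp_int" and \<tau>: "\<tau> \<in> siegel_space"
    and X: "X = cmat (blk_c \<gamma>) ** \<tau> + cmat (blk_d \<gamma>)"
  shows "X ** matrix_inv X = mat 1" "matrix_inv X ** X = mat 1"
    and "siegel_act \<gamma> \<tau> ** X = cmat (blk_a \<gamma>) ** \<tau> + cmat (blk_b \<gamma>)"
    and "siegel_act \<gamma> \<tau> \<in> siegel_space"
proof -
  define a b c d where "a = cmat (blk_a \<gamma>)" and "b = cmat (blk_b \<gamma>)" and "c = cmat (blk_c \<gamma>)"
    and "d = cmat (blk_d \<gamma>)"
  define Y where "Y = a ** \<tau> + b"
  define \<tau>' where "\<tau>' = siegel_act \<gamma> \<tau>"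
  have sym: "transpose \<tau> = \<tau>" using \<tau> by (simp add: siegel_space_iff)
  have rel: "block_relations a b c d"
    unfolding a_def b_def c_def d_def by (rule Sp_int_block_relations(1)[OF \<gamma>])
  have Xv: "X *v v = c *v (\<tau> *v v) + d *v v" and Yv: "Y *v v = a *v (\<tau> *v v) + b *v v" for v
    by (simp_all add: X Y_def c_def d_def matrix_vector_mult_add_rdistrib matrix_vector_mul_assoc)
  have cnjm: "vcnj (cmat M *v v) = cmat M *v vcnj v" for M :: "int^'g^'g" and v
    by (simp add: vcnj_def cmat_def matrix_vector_mult_def vec_eq_iff)
  have cnja: "vcnj (u + v) = vcnj u + vcnj v" for u v :: "complex^'g" by (simp add: vcnj_def vec_eq_iff)
  have cnjb: "cbil (vcnj u) v = cnj (cbil (vcnj v) u)" for u v :: "complex^'g"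
    by (simp add: cbil_def vcnj_def mult.commute)
  have herm: "cbil (vcnj (X *v v)) (Y *v v) - cbil (vcnj (Y *v v)) (X *v v) =
      cbil (vcnj v) (\<tau> *v v) - cnj (cbil (vcnj v) (\<tau> *v v))" for v
  proof -
    have "vcnj (X *v v) = c *v vcnj (\<tau> *v v) + d *v vcnj v" "vcnj (Y *v v) = a *v vcnj (\<tau> *v v) + b *v vcnj v"
      unfolding Xv Yv cnja a_def b_def c_def d_def cnjm by simp_all
    then show ?thesis
      unfolding Xv Yv using block_relations_form[OF rel, of "vcnj (\<tau> *v v)" "vcnj v" "\<tau> *v v" v]
        cnjb[of "\<tau> *v v" v] by simp
  qed
  have ker: "v = 0" if "X *v v = 0" for v
  proof (rule ccontr)
    assume v: "v \<noteq> 0"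
    have "vcnj (0 :: complex^'g) = 0" by (simp add: vcnj_def vec_eq_iff)
    then have "Im (cbil (vcnj v) (\<tau> *v v) - cnj (cbil (vcnj v) (\<tau> *v v))) = 0"
      using herm[of v] that by simp
    then show False using Im_hermitian_pos[OF \<tau> v] by simp
  qed
  show XI: "X ** matrix_inv X = mat 1" and IX: "matrix_inv X ** X = mat 1"
    by (rule invertible_if_injective_matrix[of X], use ker in blast)+
  show \<tau>'X: "siegel_act \<gamma> \<tau> ** X = cmat (blk_a \<gamma>) ** \<tau> + cmat (blk_b \<gamma>)"
    unfolding siegel_act_def X[symmetric] by (simp add: matrix_mul_assoc[symmetric] IX)
  then have tX: "\<tau>' *v (X *v v) = Y *v v" for v
    by (simp add: \<tau>'_def Y_def a_def b_def matrix_vector_mul_assoc)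
  have surj: "X *v (matrix_inv X *v z) = z" for z by (simp add: matrix_vector_mul_assoc XI)
  have symp: "cbil z (\<tau>' *v w) = cbil (\<tau>' *v z) w" for z w
  proof -
    define x y where "x = matrix_inv X *v z" and "y = matrix_inv X *v w"
    have zw: "z = X *v x" "w = X *v y" by (simp_all add: x_def y_def surj)
    have "cbil (X *v x) (Y *v y) - cbil (Y *v x) (X *v y) = 0"
      unfolding Xv Yv block_relations_form[OF rel]
      using cbil_symmetric[OF sym, of x y] by (simp add: cbil_commute)
    then show ?thesis unfolding zw tX by simp
  qed
  have "transpose \<tau>' = \<tau>'"
  proof -
    have "\<tau>' $ i $ j = \<tau>' $ j $ i" for i j
      using symp[of "axis i 1" "axis j 1"] unfolding cbil_axis
      by (simp add: matrix_vector_mult_def axis_def if_distrib cong: if_cong)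
    then show ?thesis by (simp add: vec_eq_iff transpose_def)
  qed
  moreover have "pos_im \<tau>'"
    unfolding pos_im_def
  proof (intro allI impI)
    fix x :: "real^'g" assume x: "x \<noteq> 0"
    define v where "v = matrix_inv X *v cvec x"
    have xv: "X *v v = cvec x" by (simp add: v_def surj)
    have "cvec x \<noteq> 0" using x by (auto simp: cvec_def vec_eq_iff)
    then have v0: "v \<noteq> 0" using xv by auto
    have real: "vcnj (cvec x) = cvec x" by (simp add: vcnj_def cvec_def vec_eq_iff)
    have "cbil (cvec x) (\<tau>' *v cvec x) - cnj (cbil (cvec x) (\<tau>' *v cvec x)) =
        cbil (vcnj (X *v v)) (Y *v v) - cbil (vcnj (Y *v v)) (X *v v)"
      using cnjb[of "Y *v v" "X *v v"] unfolding tX[symmetric] xv real by simp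
    then have "Im (cbil (cvec x) (\<tau>' *v cvec x)) = Im (cbil (vcnj v) (\<tau> *v v))"
      unfolding herm by (simp add: complex_eq_iff)
    moreover have "Im (cbil (cvec x) (\<tau>' *v cvec x)) = x \<bullet> ((\<chi> i j. Im (\<tau>' $ i $ j)) *v x)"
      by (simp add: cbil_def matrix_vector_mult_def cvec_def inner_vec_def)
    ultimately show "0 < x \<bullet> ((\<chi> i j. Im (\<tau>' $ i $ j)) *v x)"
      using Im_hermitian_pos[OF \<tau> v0] by simp
  qed
  ultimately show "siegel_act \<gamma> \<tau> \<in> siegel_space" by (simp add: siegel_space_iff \<tau>'_def)
qed

section \<open>The theta function under symplectic substitutions\<close>

declare transpose_matrix_vector [simp del]

lemma cbil_transpose_left: "cbil (A *v x) y = cbil x (transpose A *v y)"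
  using cbil_matrix[of x "transpose A" y] by (simp add: transpose_transpose)

lemma Gamma_blocks:
  assumes "\<gamma> \<in> Gamma n"
  shows "n dvd (blk_a \<gamma> - mat 1) $ i $ j" "n dvd blk_b \<gamma> $ i $ j" "n dvd blk_c \<gamma> $ i $ j"
    "n dvd (blk_d \<gamma> - mat 1) $ i $ j"
proof -
  have d: "n dvd (\<gamma> - mat 1) $ k $ l" for k l using assms by (simp add: Gamma_def)
  show "n dvd (blk_a \<gamma> - mat 1) $ i $ j" using d[of "Inl i" "Inl j"] by (simp add: blk_a_def mat_def)
  show "n dvd blk_b \<gamma> $ i $ j" using d[of "Inl i" "Inr j"] by (simp add: blk_b_def mat_def)
  show "n dvd blk_c \<gamma> $ i $ j" using d[of "Inr i" "Inl j"] by (simp add: blk_c_def mat_def)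
  show "n dvd (blk_d \<gamma> - mat 1) $ i $ j" using d[of "Inr i" "Inr j"] by (simp add: blk_d_def mat_def)
qed

text \<open>The substitution \<^term>\<open>W\<close> maps periods to periods, and the quadratic exponent given by \<^term>\<open>S\<close> accounts
  for the difference of the factors of automorphy. The third identity supplies the
  constants both for periods and for the halves of periods that occur as characteristics.\<close>

lemma symplectic_lattice_identities:
  fixes a b c d \<tau> \<tau>' X :: "complex^'g^'g" and e f :: "complex^'g"
  assumes rel: "block_relations a b c d"
    and rel': "block_relations (transpose a) (transpose c) (transpose b) (transpose d)"
    and sym: "transpose \<tau> = \<tau>" and sym': "transpose \<tau>' = \<tau>'"
    and X: "X = c ** \<tau> + d" and XI: "X ** matrix_inv X = mat 1" and IX: "matrix_inv X ** X = mat 1"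
    and \<tau>': "\<tau>' ** X = a ** \<tau> + b"
    and W: "W = transpose (matrix_inv X)" and S: "S = matrix_inv X ** c"
    and m: "m = transpose a *v e + transpose c *v f" and n: "n = transpose b *v e + transpose d *v f"
  shows "W *v (\<tau> *v m + n) = \<tau>' *v e + f"
    and "cbil z (S *v (\<tau> *v m + n)) = cbil z m - cbil e (W *v z)"
    and "cbil (\<tau> *v m + n) (S *v (\<tau> *v m + n)) =
      cbil m (\<tau> *v m) + cbil n m - cbil e (\<tau>' *v e) - cbil e f"
    and "cbil x (S *v y) = cbil y (S *v x)"
proof -
  let ?l = "\<tau> *v m + n"
  have Xv: "X *v y = c *v (\<tau> *v y) + d *v y" for y
    by (simp add: X matrix_vector_mult_add_rdistrib matrix_vector_mul_assoc)
  have XIv: "X *v (matrix_inv X *v y) = y" and IXv: "matrix_inv X *v (X *v y) = y" for y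
    by (simp_all add: matrix_vector_mul_assoc XI IX)
  have tX: "\<tau>' *v (X *v y) = a *v (\<tau> *v y) + b *v y" for y
    by (simp add: matrix_vector_mul_assoc \<tau>' matrix_vector_mult_add_rdistrib)
  have Wl: "cbil (W *v u) y = cbil u (matrix_inv X *v y)" for u y
    by (simp add: W cbil_transpose_left transpose_transpose)
  have F1: "cbil (W *v ?l) y = cbil (\<tau>' *v e + f) y" for y
  proof -
    define v where "v = matrix_inv X *v y"
    have y: "y = X *v v" by (simp add: v_def XIv)
    have "cbil (\<tau>' *v e + f) (X *v v) = cbil e (\<tau>' *v (X *v v)) + cbil f (X *v v)"
      by (simp add: cbil_add_left cbil_transpose_left sym')
    also have "\<dots> = cbil ?l v"
      unfolding tX unfolding Xv m n
      by (simp add: cbil_simps cbil_transpose_left transpose_transpose sym matrix_vector_right_distrib)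
    finally show ?thesis unfolding y Wl IXv by simp
  qed
  show 1: "W *v ?l = \<tau>' *v e + f"
    using F1[of "axis _ 1"] by (simp add: vec_eq_iff cbil_axis)
  have r: "a ** transpose b = b ** transpose a" "c ** transpose d = d ** transpose c"
    "a ** transpose d - b ** transpose c = mat 1"
    using rel' by (simp_all add: block_relations_def transpose_transpose)
  have r3: "d ** transpose a = mat 1 + c ** transpose b"
  proof -
    have t: "transpose (A - B) = transpose A - transpose B" for A B :: "complex^'g^'g"
      by (simp add: transpose_def vec_eq_iff)
    have "d ** transpose a - c ** transpose b = mat 1"
      using arg_cong[OF r(3), of transpose]
      unfolding t matrix_transpose_mul transpose_transpose transpose_mat .
    then show ?thesis by (metis diff_add_cancel)
  qed
  have cl: "c *v ?l + e = X *v m"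
  proof -
    have "d *v m = c *v n + e"
      unfolding m n by (simp add: matrix_vector_right_distrib matrix_vector_mul_assoc r3 r(2)
          matrix_vector_mult_add_rdistrib)
    then show ?thesis by (simp add: Xv matrix_vector_right_distrib)
  qed
  show 2: "cbil z (S *v ?l) = cbil z m - cbil e (W *v z)" for z
  proof -
    have "cbil z (S *v ?l) + cbil e (W *v z) = cbil z (matrix_inv X *v (c *v ?l + e))"
      unfolding S cbil_commute[of e] Wl
      by (simp add: matrix_vector_right_distrib cbil_add_right matrix_vector_mul_assoc matrix_mul_assoc)
    then show ?thesis unfolding cl IXv by (simp add: algebra_simps)
  qed
  show "cbil ?l (S *v ?l) = cbil m (\<tau> *v m) + cbil n m - cbil e (\<tau>' *v e) - cbil e f"
    unfolding 2 1 by (simp add: cbil_simps cbil_commute[of "\<tau> *v m"])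
  show "cbil x (S *v y) = cbil y (S *v x)"
  proof -
    have tW: "transpose X *v (W *v u) = u" for u
    proof -
      have "transpose (matrix_inv X ** X) = mat 1" by (simp add: IX transpose_mat)
      then have "transpose X ** W = mat 1" by (simp add: matrix_transpose_mul W)
      then show ?thesis by (simp add: matrix_vector_mul_assoc)
    qed
    have key: "cbil (transpose X *v \<xi>) (S *v (transpose X *v \<eta>)) =
        cbil (transpose c *v \<xi>) (\<tau> *v (transpose c *v \<eta>)) + cbil \<xi> ((c ** transpose d) *v \<eta>)" for \<xi> \<eta>
    proof -
      have "transpose X *v \<eta> = \<tau> *v (transpose c *v \<eta>) + transpose d *v \<eta>"
      proof -
        have "transpose X = \<tau> ** transpose c + transpose d"
          using sym by (simp add: X matrix_transpose_mul[symmetric] transpose_def vec_eq_iff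
              matrix_matrix_mult_def mult.commute)
        then show ?thesis by (simp add: matrix_vector_mult_add_rdistrib matrix_vector_mul_assoc)
      qed
      moreover have "cbil (transpose X *v \<xi>) (S *v (transpose X *v \<eta>)) = cbil \<xi> (c *v (transpose X *v \<eta>))"
        by (simp add: cbil_transpose_left transpose_transpose S matrix_vector_mul_assoc matrix_mul_assoc XI)
      ultimately show ?thesis
        by (simp add: matrix_vector_right_distrib cbil_add_right cbil_transpose_left transpose_transpose
            matrix_vector_mul_assoc)
    qed
    have "cbil \<xi> ((c ** transpose d) *v \<eta>) = cbil \<eta> ((c ** transpose d) *v \<xi>)" for \<xi> \<eta>
      by (rule cbil_symmetric) (simp add: matrix_transpose_mul transpose_transpose r(2))
    then have "cbil (transpose X *v \<xi>) (S *v (transpose X *v \<eta>)) =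
        cbil (transpose X *v \<eta>) (S *v (transpose X *v \<xi>))" for \<xi> \<eta>
      unfolding key using cbil_symmetric[OF sym, of "transpose c *v \<xi>" "transpose c *v \<eta>"] by simp
    from this[of "W *v x" "W *v y"] show ?thesis by (simp only: tW)
  qed
qed

text \<open>The transformed function, corrected by the quadratic exponent, has the quasi-periods of the theta function
  at \<^term>\<open>\<tau>\<close>, and these determine it up to a constant. For \<^term>\<open>\<gamma>\<close> congruent to one modulo two the signs
  that arise are trivial, so no characteristic appears.\<close>

theorem rtheta_symplectic:
  fixes \<gamma> :: "int^('g::finite+'g)^('g+'g)" and \<tau> :: "complex^'g^'g"
  assumes \<gamma>: "\<gamma> \<in> Gamma 4" and \<tau>: "\<tau> \<in> siegel_space"
    and X: "X = cmat (blk_c \<gamma>) ** \<tau> + cmat (blk_d \<gamma>)"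
    and W: "W = transpose (matrix_inv X)" and S: "S = matrix_inv X ** cmat (blk_c \<gamma>)"
  shows "\<exists>K. K \<noteq> 0 \<and> (\<forall>z. rtheta (siegel_act \<gamma> \<tau>) (W *v z) =
    K * exp (of_real pi * \<i> * cbil z (S *v z)) * rtheta \<tau> z)"
proof -
  have sp: "\<gamma> \<in> Sp_int" using \<gamma> by (simp add: Gamma_def)
  define \<tau>' where "\<tau>' = siegel_act \<gamma> \<tau>"
  note act = symplectic_action[OF sp \<tau> X, folded \<tau>'_def]
  have sym: "transpose \<tau> = \<tau>" "transpose \<tau>' = \<tau>'" using \<tau> act(4) by (simp_all add: siegel_space_iff)
  note rel = Sp_int_block_relations[OF sp]
  note ids = symplectic_lattice_identities[OF rel sym X act(1,2,3) W S]
  define \<Phi> where "\<Phi> = (\<lambda>z. exp (- (of_real pi * \<i>) * cbil z (S *v z)) * rtheta \<tau>' (W *v z))"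
  have ent: "entire \<Phi>" unfolding \<Phi>_def
    using entire_affine[OF entire_rtheta[OF act(4)], of W 0]
    by (intro entire_mult entire_exp entire_const entire_quadratic) simp
  have shift: "\<Phi> (z + (\<tau> *v ivec m + ivec n)) = automorphy \<tau> m z * \<Phi> z" for z m n
  proof -
    define e where "e = blk_d \<gamma> *v m - blk_c \<gamma> *v n"
    define f where "f = blk_a \<gamma> *v n - blk_b \<gamma> *v m"
    let ?a = "cmat (blk_a \<gamma>)" and ?b = "cmat (blk_b \<gamma>)" and ?c = "cmat (blk_c \<gamma>)" and ?d = "cmat (blk_d \<gamma>)"
    have ie: "ivec e = ?d *v ivec m - ?c *v ivec n" "ivec f = ?a *v ivec n - ?b *v ivec m"
      by (simp_all add: e_def f_def ivec_matrix_vector)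
    have r: "transpose ?a ** ?c = transpose ?c ** ?a" "transpose ?b ** ?d = transpose ?d ** ?b"
      "transpose ?a ** ?d = mat 1 + transpose ?c ** ?b"
      using rel(1) by (simp_all add: block_relations_def algebra_simps)
    have r': "transpose ?d ** ?a = mat 1 + transpose ?b ** ?c"
    proof -
      have "transpose (A + B) = transpose A + transpose B" for A B :: "complex^'g^'g"
        by (simp add: transpose_def vec_eq_iff)
      then show ?thesis
        using arg_cong[OF r(3), of transpose] by (simp add: matrix_transpose_mul transpose_mat transpose_transpose)
    qed
    have m: "ivec m = transpose ?a *v ivec e + transpose ?c *v ivec f"
      unfolding ie by (simp add: matrix_vector_mult_diff_distrib matrix_vector_mul_assoc r
          matrix_vector_mult_add_rdistrib)
    have n: "ivec n = transpose ?b *v ivec e + transpose ?d *v ivec f"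
      unfolding ie by (simp add: matrix_vector_mult_diff_distrib matrix_vector_mul_assoc r r'
          matrix_vector_mult_add_rdistrib)
    note id = ids[OF m n]
    let ?l = "\<tau> *v ivec m + ivec n"
    \<comment> \<open>The sign of the transformation law, trivial because the pairs are congruent modulo two.\<close>
    have par: "exp (- (of_real pi * \<i>) * (cbil (ivec n) (ivec m) - cbil (ivec f) (ivec e))) = 1"
    proof -
      have ev: "even (e $ i - m $ i)" "even (f $ i - n $ i)" for i
      proof -
        have four: "even k" if "4 dvd k" for k :: int using that by presburger
        have mv: "even ((M *v x) $ i)" if "\<And>j. even (M $ i $ j)" for M :: "int^'g^'g" and x
          unfolding matrix_vector_mult_def using that by (simp add: dvd_sum)
        have "e $ i - m $ i = ((blk_d \<gamma> - mat 1) *v m - blk_c \<gamma> *v n) $ i"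
          by (simp add: e_def matrix_vector_mult_diff_rdistrib)
        also have "even \<dots>"
          unfolding vector_minus_component[of "_ *v _"]
          by (intro dvd_diff mv four[OF Gamma_blocks(4)[OF \<gamma>]] four[OF Gamma_blocks(3)[OF \<gamma>]])
        finally show "even (e $ i - m $ i)" .
        have "f $ i - n $ i = ((blk_a \<gamma> - mat 1) *v n - blk_b \<gamma> *v m) $ i"
          by (simp add: f_def matrix_vector_mult_diff_rdistrib)
        also have "even \<dots>"
          unfolding vector_minus_component[of "_ *v _"]
          by (intro dvd_diff mv four[OF Gamma_blocks(1)[OF \<gamma>]] four[OF Gamma_blocks(2)[OF \<gamma>]])
        finally show "even (f $ i - n $ i)" .
      qed
      have "(\<Sum>i\<in>UNIV. n $ i * m $ i) - (\<Sum>i\<in>UNIV. f $ i * e $ i) = (\<Sum>i\<in>UNIV. n $ i * m $ i - f $ i * e $ i)"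
        by (simp add: sum_subtractf)
      moreover have "even (\<Sum>i\<in>UNIV. n $ i * m $ i - f $ i * e $ i)"
      proof (rule dvd_sum)
        fix i
        show "even (n $ i * m $ i - f $ i * e $ i)" using ev[of i] by (simp; metis)
      qed
      ultimately obtain k where "(\<Sum>i\<in>UNIV. n $ i * m $ i) - (\<Sum>i\<in>UNIV. f $ i * e $ i) = 2 * k"
        by (metis evenE)
      then have "cbil (ivec n) (ivec m) - cbil (ivec f) (ivec e) = of_int (2 * k)"
        by (simp only: cbil_ivec_ivec of_int_diff[symmetric])
      then have "- (of_real pi * \<i>) * (cbil (ivec n) (ivec m) - cbil (ivec f) (ivec e)) =
          of_int (- k) * (2 * of_real pi * \<i>)" by simp
      then show ?thesis by (simp only: exp_of_int_times_2pi_i)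
    qed
    have W: "W *v (z + ?l) = (W *v z + \<tau>' *v ivec e) + ivec f"
      unfolding matrix_vector_right_distrib[of W z] id(1) by (simp add: add.assoc)
    have th: "rtheta \<tau>' (W *v (z + ?l)) = automorphy \<tau>' e (W *v z) * rtheta \<tau>' (W *v z)"
      unfolding W rtheta_periodic rtheta_quasi_periodic[OF act(4)] ..
    have q: "cbil (z + ?l) (S *v (z + ?l)) = cbil z (S *v z) + 2 * (cbil z (ivec m) - cbil (ivec e) (W *v z)) +
      (cbil (ivec m) (\<tau> *v ivec m) + cbil (ivec n) (ivec m) - cbil (ivec e) (\<tau>' *v ivec e) - cbil (ivec e) (ivec f))"
      unfolding matrix_vector_right_distrib[of S z] cbil_add_left[of z] cbil_add_right[of _ "S *v z"]
        id(4)[of ?l z] id(3) id(2)[of z] by simp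
    have "- (of_real pi * \<i>) * cbil (z + ?l) (S *v (z + ?l)) +
        - (of_real pi * \<i> * qform \<tau>' e + 2 * of_real pi * \<i> * cbil (ivec e) (W *v z)) =
      - (of_real pi * \<i> * qform \<tau> m + 2 * of_real pi * \<i> * cbil (ivec m) z) +
      - (of_real pi * \<i>) * (cbil (ivec n) (ivec m) - cbil (ivec f) (ivec e)) +
      - (of_real pi * \<i>) * cbil z (S *v z)"
      unfolding q qform_def cbil_commute[of "ivec m" z] cbil_commute[of "ivec f"]
      by (simp add: algebra_simps)
    from arg_cong[OF this, of exp] show ?thesis
      unfolding \<Phi>_def th automorphy_def exp_add par by (simp only: mult_1_right mult.assoc[symmetric])
  qed
  have "\<exists>K. \<forall>z. \<Phi> z = K * rtheta \<tau> z"
  proof (rule quasi_periodic_imp_multiple_of_rtheta[OF \<tau> ent])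
    show "\<Phi> (z + ivec n) = \<Phi> z" for z n
      using shift[of z 0 n] by (simp add: automorphy_def qform_def)
    show "\<Phi> (z + \<tau> *v ivec m) = automorphy \<tau> m z * \<Phi> z" for z m
      using shift[of z m 0] by simp
  qed
  then obtain K where K: "\<And>z. \<Phi> z = K * rtheta \<tau> z" by blast
  have eq: "rtheta \<tau>' (W *v z) = K * exp (of_real pi * \<i> * cbil z (S *v z)) * rtheta \<tau> z" for z
  proof -
    have "rtheta \<tau>' (W *v z) = exp (of_real pi * \<i> * cbil z (S *v z)) * \<Phi> z"
      unfolding \<Phi>_def by (simp add: exp_minus)
    then show ?thesis unfolding K by (simp add: mult_ac)
  qed
  have "K \<noteq> 0"
  proof
    assume "K = 0"
    obtain y where y: "rtheta \<tau>' y \<noteq> 0" using rtheta_not_identically_zero[OF act(4)] by blast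
    have "transpose (X ** matrix_inv X) = mat 1" by (simp add: act(1) transpose_mat)
    then have "W ** transpose X = mat 1" by (simp add: matrix_transpose_mul W)
    then have "W *v (transpose X *v y) = y" by (simp add: matrix_vector_mul_assoc)
    then show False using eq[of "transpose X *v y"] y \<open>K = 0\<close> by simp
  qed
  then show ?thesis using eq unfolding \<tau>'_def by blast
qed

section \<open>Theta functions with characteristics and their gradients\<close>

subsection \<open>The transformation law with characteristics\<close>

text \<open>The theta function with characteristic as a translate of the Riemann theta function by a half-period.
  The characteristic is an arbitrary vector here, since a symplectic substitution takes it out of the
  vectors with entries zero and one.\<close>

definition rtheta_char :: "complex^'g^'g \<Rightarrow> complex^'g \<Rightarrow> complex^'g \<Rightarrow> complex^'g \<Rightarrow> complex" where
  "rtheta_char \<tau> e d z = exp (of_real pi * \<i> * (cbil e (\<tau> *v e) / 4 + cbil e z + cbil e d / 2)) *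
    rtheta \<tau> (z + (1/2) *s (\<tau> *v e + d))"

lemma ivec_bint: "ivec (bint \<epsilon>) = 2 *s half_char \<epsilon>"
  by (simp add: ivec_def bint_def half_char_def vec_eq_iff)

lemma theta_eq_rtheta_char:
  assumes sym: "transpose \<tau> = \<tau>"
  shows "theta \<epsilon> \<delta> \<tau> z = rtheta_char \<tau> (ivec (bint \<epsilon>)) (ivec (bint \<delta>)) z"
proof -
  let ?e = "half_char \<epsilon>" and ?d = "half_char \<delta>"
  have ex: "of_real pi * \<i> * (cbil (ivec m + ?e) (\<tau> *v (ivec m + ?e)) + 2 * cbil (ivec m + ?e) (z + ?d)) =
      of_real pi * \<i> * (cbil (2 *s ?e) (\<tau> *v (2 *s ?e)) / 4 + cbil (2 *s ?e) z + cbil (2 *s ?e) (2 *s ?d) / 2) +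
      theta_exponent \<tau> (z + (1/2) *s (\<tau> *v (2 *s ?e) + 2 *s ?d)) m" for m
    using cbil_symmetric[OF sym, of ?e "ivec m"]
    by (simp add: theta_exponent_def qform_def cbil_simps matrix_vector_right_distrib
        vector_scalar_commute algebra_simps)
  have "theta \<epsilon> \<delta> \<tau> z = (\<Sum>\<^sub>\<infinity>m. exp (of_real pi * \<i> * (cbil (ivec m + ?e) (\<tau> *v (ivec m + ?e)) +
      2 * cbil (ivec m + ?e) (z + ?d))))"
    by (simp add: theta_def ivec_def Let_def)
  then show ?thesis
    unfolding ex rtheta_char_def ivec_bint rtheta_def theta_series_def exp_add
    by (simp add: infsum_cmult_right')
qed

lemma exp_even_int: "exp (of_real pi * \<i> * (2 * of_int k)) = (1 :: complex)"
  using exp_of_int_times_2pi_i[of k] by (simp add: mult_ac)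

text \<open>Adding four to a characteristic moves the translation by twice a period; the constants that this
  produces combine to an integral multiple of \<open>2 \<pi> \<i>\<close>.\<close>

lemma rtheta_char_mod_four:
  fixes e d p q :: "int^'g"
  assumes \<tau>: "\<tau> \<in> siegel_space"
  shows "rtheta_char \<tau> (ivec e + 4 *s ivec p) (ivec d + 4 *s ivec q) z = rtheta_char \<tau> (ivec e) (ivec d) z"
proof -
  have sym: "transpose \<tau> = \<tau>" using \<tau> by (simp add: siegel_space_iff)
  let ?e = "ivec e" and ?d = "ivec d" and ?p = "ivec p" and ?q = "ivec q"
  let ?y = "z + (1/2) *s (\<tau> *v ?e + ?d)"
  have two: "ivec (2 *s p) = 2 *s ?p" "ivec (2 *s q) = 2 *s ?q"
    using ivec_simps(6)[of 2 p] ivec_simps(6)[of 2 q] by simp_all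
  have arg: "z + (1/2) *s (\<tau> *v (?e + 4 *s ?p) + (?d + 4 *s ?q)) =
      (?y + \<tau> *v ivec (2 *s p)) + ivec (2 *s q)"
    unfolding two by (simp add: matrix_vector_right_distrib vector_scalar_commute vec_eq_iff algebra_simps)
  have int: "cbil ?e ?q + 4 * cbil ?p ?q =
      of_int ((\<Sum>i\<in>UNIV. e $ i * q $ i) + 4 * (\<Sum>i\<in>UNIV. p $ i * q $ i))"
    unfolding cbil_ivec_ivec by simp
  have "of_real pi * \<i> * (cbil (?e + 4 *s ?p) (\<tau> *v (?e + 4 *s ?p)) / 4 + cbil (?e + 4 *s ?p) z +
        cbil (?e + 4 *s ?p) (?d + 4 *s ?q) / 2) +
      - (of_real pi * \<i> * qform \<tau> (2 *s p) + 2 * of_real pi * \<i> * cbil (ivec (2 *s p)) ?y) =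
      of_real pi * \<i> * (cbil ?e (\<tau> *v ?e) / 4 + cbil ?e z + cbil ?e ?d / 2) +
      of_real pi * \<i> * (2 * (cbil ?e ?q + 4 * cbil ?p ?q))"
    unfolding qform_def two
    using cbil_symmetric[OF sym, of ?p ?e]
    by (simp add: cbil_simps matrix_vector_right_distrib vector_scalar_commute algebra_simps add_divide_distrib)
  from arg_cong[OF this, of exp] show ?thesis
    unfolding rtheta_char_def arg rtheta_periodic rtheta_quasi_periodic[OF \<tau>] automorphy_def
      exp_add int exp_even_int
    by (simp only: mult_1_right mult.assoc[symmetric])
qed

text \<open>Off the diagonal the entries occur twice.\<close>

lemma symmetric_quadratic_divisible:
  fixes F :: "'a \<Rightarrow> 'a \<Rightarrow> int"
  assumes "finite S" "\<And>i j. F i j = F j i" "\<And>i j. 4 dvd F i j" "\<And>i. 8 dvd F i i"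
  shows "8 dvd (\<Sum>i\<in>S. \<Sum>j\<in>S. e i * F i j * e j)"
  using assms(1)
proof (induction S)
  case (insert x S)
  have "(\<Sum>i\<in>S. e i * F i x * e x) = (\<Sum>j\<in>S. e x * F x j * e j)"
    by (rule sum.cong) (simp_all add: assms(2)[of x])
  then have eq: "(\<Sum>i\<in>insert x S. \<Sum>j\<in>insert x S. e i * F i j * e j) =
      e x * F x x * e x + 2 * (\<Sum>j\<in>S. e x * F x j * e j) + (\<Sum>i\<in>S. \<Sum>j\<in>S. e i * F i j * e j)"
    using insert.hyps by (simp add: sum.distrib)
  have "4 dvd (\<Sum>j\<in>S. e x * F x j * e j)" by (intro dvd_sum dvd_mult dvd_mult2 assms(3))
  then have "8 dvd 2 * (\<Sum>j\<in>S. e x * F x j * e j)" using mult_dvd_mono[of 2 2 "4::int"] by simp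
  moreover have "8 dvd e x * F x x * e x" by (intro dvd_mult dvd_mult2 assms(4))
  ultimately show ?case unfolding eq using insert.IH by (intro dvd_add)
qed simp

lemma cbil_cmat:
  "cbil (ivec e) (cmat F *v ivec f) = of_int (\<Sum>i\<in>UNIV. \<Sum>j\<in>UNIV. e $ i * F $ i $ j * f $ j)"
  by (simp add: cbil_def cmat_def ivec_def matrix_vector_mult_def sum_distrib_left mult.assoc)

text \<open>The exponent of the eighth root of unity in the transformation law with characteristics. The difference
  is a sum of quadratic forms given by the symmetric matrices whose diagonals the group restricts, and of
  twice a bilinear form that is divisible by four.\<close>

lemma Gamma2_characteristic_pairing:
  fixes \<gamma> :: "int^('g::finite+'g)^('g+'g)" and e f :: "int^'g"
  assumes \<gamma>: "\<gamma> \<in> Gamma2 4"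
    and m: "m = transpose (cmat (blk_a \<gamma>)) *v ivec e + transpose (cmat (blk_c \<gamma>)) *v ivec f"
    and n: "n = transpose (cmat (blk_b \<gamma>)) *v ivec e + transpose (cmat (blk_d \<gamma>)) *v ivec f"
  shows "\<exists>k. cbil m n - cbil (ivec e) (ivec f) = 8 * of_int k"
proof -
  have \<gamma>4: "\<gamma> \<in> Gamma 4" and sp: "\<gamma> \<in> Sp_int" using \<gamma> by (simp_all add: Gamma2_def Gamma_def)
  let ?a = "cmat (blk_a \<gamma>)" and ?b = "cmat (blk_b \<gamma>)" and ?c = "cmat (blk_c \<gamma>)" and ?d = "cmat (blk_d \<gamma>)"
  let ?ab = "blk_a \<gamma> ** transpose (blk_b \<gamma>)" and ?cd = "blk_c \<gamma> ** transpose (blk_d \<gamma>)"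
    and ?bc = "blk_b \<gamma> ** transpose (blk_c \<gamma>)"
  have r: "?a ** transpose ?b = ?b ** transpose ?a" "?c ** transpose ?d = ?d ** transpose ?c"
    "?a ** transpose ?d = mat 1 + ?b ** transpose ?c"
    using Sp_int_block_relations(2)[OF sp] by (simp_all add: block_relations_def transpose_transpose algebra_simps)
  have "cbil (transpose M *v x) (transpose N *v y) = cbil x ((M ** transpose N) *v y)" for M N :: "complex^'g^'g" and x y
    by (simp add: cbil_transpose_left transpose_transpose matrix_vector_mul_assoc)
  then have "cbil m n = cbil (ivec e) ((?a ** transpose ?b) *v ivec e) + cbil (ivec f) ((?c ** transpose ?d) *v ivec f) +
      cbil (ivec e) ((?a ** transpose ?d) *v ivec f) + cbil (ivec e) ((?b ** transpose ?c) *v ivec f)"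
    unfolding m n cbil_add_left cbil_add_right cbil_commute[of "transpose ?c *v ivec f" "transpose ?b *v ivec e"]
    by simp
  then have sum: "cbil m n - cbil (ivec e) (ivec f) = cbil (ivec e) (cmat ?ab *v ivec e) +
      cbil (ivec f) (cmat ?cd *v ivec f) + 2 * cbil (ivec e) (cmat ?bc *v ivec f)"
    unfolding r(3) by (simp add: cmat_mult cmat_transpose matrix_vector_mult_add_rdistrib cbil_add_right)
  have sym: "?ab $ i $ j = ?ab $ j $ i" "?cd $ i $ j = ?cd $ j $ i" for i j
  proof -
    have entries: "M $ i $ j = M $ j $ i" if "transpose (cmat M) = cmat M" for M :: "int^'g^'g"
      using arg_cong[OF that, of "\<lambda>N. N $ j $ i"] by (simp add: transpose_def cmat_def)
    show "?ab $ i $ j = ?ab $ j $ i" "?cd $ i $ j = ?cd $ j $ i"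
      by (rule entries, simp only: cmat_mult cmat_transpose matrix_transpose_mul transpose_transpose r(1,2))+
  qed
  have four: "4 dvd ?ab $ i $ j" "4 dvd ?cd $ i $ j" "4 dvd ?bc $ i $ j" for i j
    unfolding matrix_matrix_mult_def transpose_def vec_lambda_beta
    by (intro dvd_sum dvd_mult dvd_mult2 Gamma_blocks[OF \<gamma>4])+
  have diag: "8 dvd ?ab $ i $ i" "8 dvd ?cd $ i $ i" for i using \<gamma> by (simp_all add: Gamma2_def)
  have "8 dvd (\<Sum>i\<in>UNIV. \<Sum>j\<in>UNIV. e $ i * ?ab $ i $ j * e $ j)"
    by (rule symmetric_quadratic_divisible[where F = "\<lambda>i j. ?ab $ i $ j" and e = "\<lambda>i. e $ i"])
      (simp, rule sym, rule four, rule diag)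
  then obtain k1 where k1: "(\<Sum>i\<in>UNIV. \<Sum>j\<in>UNIV. e $ i * ?ab $ i $ j * e $ j) = 8 * k1" by (rule dvdE)
  have "8 dvd (\<Sum>i\<in>UNIV. \<Sum>j\<in>UNIV. f $ i * ?cd $ i $ j * f $ j)"
    by (rule symmetric_quadratic_divisible[where F = "\<lambda>i j. ?cd $ i $ j" and e = "\<lambda>i. f $ i"])
      (simp, rule sym, rule four, rule diag)
  then obtain k2 where k2: "(\<Sum>i\<in>UNIV. \<Sum>j\<in>UNIV. f $ i * ?cd $ i $ j * f $ j) = 8 * k2" by (rule dvdE)
  have "4 dvd (\<Sum>i\<in>UNIV. \<Sum>j\<in>UNIV. e $ i * ?bc $ i $ j * f $ j)"
    by (intro dvd_sum dvd_mult dvd_mult2 four)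
  then obtain k3 where k3: "(\<Sum>i\<in>UNIV. \<Sum>j\<in>UNIV. e $ i * ?bc $ i $ j * f $ j) = 4 * k3" by (rule dvdE)
  show ?thesis
    unfolding sum cbil_cmat k1 k2 k3 by (rule exI[of _ "k1 + k2 + k3"]) simp
qed

text \<open>The transformation law at \<open>z\<close> shifted by half a period. The new characteristic agrees with the old one
  modulo four, and the root of unity is trivial, so the constant is the same for all characteristics.\<close>

theorem theta_Gamma2:
  fixes \<gamma> :: "int^('g::finite+'g)^('g+'g)" and \<tau> :: "complex^'g^'g"
  assumes \<gamma>: "\<gamma> \<in> Gamma2 4" and \<tau>: "\<tau> \<in> siegel_space"
    and X: "X = cmat (blk_c \<gamma>) ** \<tau> + cmat (blk_d \<gamma>)"
    and W: "W = transpose (matrix_inv X)" and S: "S = matrix_inv X ** cmat (blk_c \<gamma>)"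
  shows "\<exists>K. K \<noteq> 0 \<and> (\<forall>\<epsilon> \<delta> z. theta \<epsilon> \<delta> (siegel_act \<gamma> \<tau>) (W *v z) =
    K * exp (of_real pi * \<i> * cbil z (S *v z)) * theta \<epsilon> \<delta> \<tau> z)"
proof -
  have \<gamma>4: "\<gamma> \<in> Gamma 4" and sp: "\<gamma> \<in> Sp_int" using \<gamma> by (simp_all add: Gamma2_def Gamma_def)
  define \<tau>' where "\<tau>' = siegel_act \<gamma> \<tau>"
  note act = symplectic_action[OF sp \<tau> X, folded \<tau>'_def]
  have sym: "transpose \<tau> = \<tau>" "transpose \<tau>' = \<tau>'" using \<tau> act(4) by (simp_all add: siegel_space_iff)
  note ids = symplectic_lattice_identities[OF Sp_int_block_relations[OF sp] sym X act(1,2,3) W S]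
  obtain K where "K \<noteq> 0" and K: "\<And>z. rtheta \<tau>' (W *v z) = K * exp (of_real pi * \<i> * cbil z (S *v z)) * rtheta \<tau> z"
    using rtheta_symplectic[OF \<gamma>4 \<tau> X W S] unfolding \<tau>'_def by blast
  have char: "theta \<epsilon> \<delta> \<tau>' (W *v z) = K * exp (of_real pi * \<i> * cbil z (S *v z)) * theta \<epsilon> \<delta> \<tau> z" for \<epsilon> \<delta> z
  proof -
    define e f where "e = bint \<epsilon>" and "f = bint \<delta>"
    define m n where "m = transpose (cmat (blk_a \<gamma>)) *v ivec e + transpose (cmat (blk_c \<gamma>)) *v ivec f"
      and "n = transpose (cmat (blk_b \<gamma>)) *v ivec e + transpose (cmat (blk_d \<gamma>)) *v ivec f"
    let ?l = "\<tau> *v m + n"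
    note id = ids[OF m_def n_def]
    have arg: "W *v z + (1/2) *s (\<tau>' *v ivec e + ivec f) = W *v (z + (1/2) *s ?l)"
      by (simp only: matrix_vector_right_distrib[of W z] vector_scalar_commute id(1))
    have q: "cbil (z + (1/2) *s ?l) (S *v (z + (1/2) *s ?l)) = cbil z (S *v z) + (cbil z m - cbil (ivec e) (W *v z)) +
      (cbil m (\<tau> *v m) + cbil n m - cbil (ivec e) (\<tau>' *v ivec e) - cbil (ivec e) (ivec f)) / 4"
      unfolding matrix_vector_right_distrib[of S z] cbil_add_left[of z] cbil_add_right[of _ "S *v z"]
        vector_scalar_commute cbil_scale_left cbil_scale_right id(4)[of ?l z] id(3) id(2)[of z] by (simp add: field_simps)
    obtain k where k: "cbil m n - cbil (ivec e) (ivec f) = 8 * of_int k"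
      using Gamma2_characteristic_pairing[OF \<gamma> m_def n_def] by blast
    have "of_real pi * \<i> * (cbil (ivec e) (\<tau>' *v ivec e) / 4 + cbil (ivec e) (W *v z) + cbil (ivec e) (ivec f) / 2) +
        of_real pi * \<i> * cbil (z + (1/2) *s ?l) (S *v (z + (1/2) *s ?l)) =
      of_real pi * \<i> * cbil z (S *v z) + of_real pi * \<i> * (cbil m (\<tau> *v m) / 4 + cbil m z + cbil m n / 2) +
      of_real pi * \<i> * (- ((cbil m n - cbil (ivec e) (ivec f)) / 4))"
      unfolding q cbil_commute[of z m] cbil_commute[of n m] by (simp add: field_simps)
    also have "- ((cbil m n - cbil (ivec e) (ivec f)) / 4) = 2 * of_int (- k)" unfolding k by simp
    finally have ex: "exp (of_real pi * \<i> * (cbil (ivec e) (\<tau>' *v ivec e) / 4 + cbil (ivec e) (W *v z) + cbil (ivec e) (ivec f) / 2)) *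
        exp (of_real pi * \<i> * cbil (z + (1/2) *s ?l) (S *v (z + (1/2) *s ?l))) =
      exp (of_real pi * \<i> * cbil z (S *v z)) * exp (of_real pi * \<i> * (cbil m (\<tau> *v m) / 4 + cbil m z + cbil m n / 2))"
      by (simp only: exp_add[symmetric]) (simp only: exp_add exp_even_int mult_1_right)
    have regroup: "a * (K * b * r) = K * c * (d * r)" if "a * b = c * d" for a b c d r :: complex
    proof -
      have "a * (K * b * r) = K * (a * b) * r" by (simp only: mult_ac)
      then show ?thesis unfolding that by (simp only: mult_ac)
    qed
    have law: "rtheta_char \<tau>' (ivec e) (ivec f) (W *v z) =
        K * exp (of_real pi * \<i> * cbil z (S *v z)) * rtheta_char \<tau> m n z"
      unfolding rtheta_char_def arg K by (rule regroup[OF ex])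
    have four: "\<exists>p. (\<chi> i. \<Sum>j\<in>UNIV. M $ j $ i * x $ j) = 4 *s p" if "\<And>i j. 4 dvd M $ i $ j"
      for M :: "int^'g^'g" and x :: "int^'g"
    proof -
      have "4 dvd (\<Sum>j\<in>UNIV. M $ j $ i * x $ j)" for i by (intro dvd_sum dvd_mult2 that)
      then have "(\<chi> i. \<Sum>j\<in>UNIV. M $ j $ i * x $ j) = 4 *s (\<chi> i. (\<Sum>j\<in>UNIV. M $ j $ i * x $ j) div 4)"
        by (simp add: vec_eq_iff)
      then show ?thesis by blast
    qed
    have tr: "transpose (cmat M) *v ivec x = ivec (\<chi> i. \<Sum>j\<in>UNIV. M $ j $ i * x $ j)" for M :: "int^'g^'g" and x
      by (simp add: vec_eq_iff ivec_def cmat_def transpose_def matrix_vector_mult_def)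
    have tr1: "transpose (cmat M) *v ivec x = ivec x + transpose (cmat (M - mat 1)) *v ivec x"
      for M :: "int^'g^'g" and x
    proof -
      have "transpose (cmat M) = mat 1 + transpose (cmat (M - mat 1))"
        by (simp add: vec_eq_iff cmat_def transpose_def mat_def)
      then show ?thesis by (metis matrix_vector_mul_lid matrix_vector_mult_add_rdistrib)
    qed
    have i4: "ivec (4 *s p) = 4 *s ivec p" for p :: "int^'g" using ivec_simps(6)[of 4 p] by simp
    obtain p1 where p1: "transpose (cmat (blk_a \<gamma> - mat 1)) *v ivec e = ivec (4 *s p1)"
      unfolding tr using four[OF Gamma_blocks(1)[OF \<gamma>4], of e] by force
    obtain p2 where p2: "transpose (cmat (blk_c \<gamma>)) *v ivec f = ivec (4 *s p2)"
      unfolding tr using four[OF Gamma_blocks(3)[OF \<gamma>4], of f] by force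
    obtain q1 where q1: "transpose (cmat (blk_b \<gamma>)) *v ivec e = ivec (4 *s q1)"
      unfolding tr using four[OF Gamma_blocks(2)[OF \<gamma>4], of e] by force
    obtain q2 where q2: "transpose (cmat (blk_d \<gamma> - mat 1)) *v ivec f = ivec (4 *s q2)"
      unfolding tr using four[OF Gamma_blocks(4)[OF \<gamma>4], of f] by force
    have mn: "m = ivec e + 4 *s ivec (p1 + p2)" "n = ivec f + 4 *s ivec (q1 + q2)"
      unfolding m_def n_def tr1[of "blk_a \<gamma>"] tr1[of "blk_d \<gamma>"] p1 p2 q1 q2 i4 by (simp_all add: vec_eq_iff algebra_simps)
    show ?thesis
      unfolding theta_eq_rtheta_char[OF sym(1)] theta_eq_rtheta_char[OF sym(2)] e_def[symmetric] f_def[symmetric]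
        law unfolding mn rtheta_char_mod_four[OF \<tau>] ..
  qed
  show ?thesis using \<open>K \<noteq> 0\<close> char unfolding \<tau>'_def by blast
qed

subsection \<open>Gradients as series\<close>

text \<open>Summation over the index \<open>2 m + \<epsilon>\<close>.\<close>

lemma theta_eq_theta_series:
  "theta \<epsilon> \<delta> \<tau> z = theta_series (char_coeff \<epsilon> \<delta>) ((1/4) *\<^sub>R \<tau>) ((1/2) *s z)"
proof -
  let ?P = "{n :: int^'a. \<forall>i. odd (n $ i) = \<epsilon> $ i}"
  let ?h = "\<lambda>m :: int^'a. 2 *s m + bint \<epsilon>"
  let ?f = "\<lambda>n. char_coeff \<epsilon> \<delta> n * exp (theta_exponent ((1/4) *\<^sub>R \<tau>) ((1/2) *s z) n)"
  have bij: "bij_betw ?h UNIV ?P"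
  proof (rule bij_betw_byWitness[where f' = "\<lambda>n. \<chi> i. n $ i div 2"])
    show "\<forall>n\<in>?P. ?h (\<chi> i. n $ i div 2) = n"
    proof
      fix n assume "n \<in> ?P"
      then have "\<epsilon> $ i = odd (n $ i)" for i by simp
      then show "?h (\<chi> i. n $ i div 2) = n" by (simp add: vec_eq_iff bint_def mod_2_eq_odd[symmetric])
    qed
    have "(2 * k + of_bool b) div 2 = k" "odd (2 * k + of_bool b) = b" for k :: int and b
      by (cases b; simp)+
    then show "\<forall>m\<in>UNIV. (\<chi> i. ?h m $ i div 2) = m" "?h ` UNIV \<subseteq> ?P"
      by (simp_all add: vec_eq_iff bint_def image_subset_iff)
  qed simp
  have v: "ivec (?h m) = 2 *s ((\<chi> i. of_int (m $ i)) + half_char \<epsilon>)" for m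
    by (simp add: vec_eq_iff ivec_def bint_def half_char_def)
  have term_eq: "?f (?h m) = (let v = (\<chi> i. of_int (m $ i)) + half_char \<epsilon>
     in exp (of_real pi * \<i> * (cbil v (\<tau> *v v) + 2 * cbil v (z + half_char \<delta>))))" for m
  proof -
    let ?v = "(\<chi> i. of_int (m $ i)) + half_char \<epsilon>"
    have "?h m \<in> ?P" using bij_betwE[OF bij] by blast
    then have "?f (?h m) = exp (of_real pi * \<i> / 2 * cbil (ivec (?h m)) (ivec (bint \<delta>)) +
        theta_exponent ((1/4) *\<^sub>R \<tau>) ((1/2) *s z) (?h m))"
      by (simp add: char_coeff_def exp_add)
    also have "of_real pi * \<i> / 2 * cbil (ivec (?h m)) (ivec (bint \<delta>)) +
        theta_exponent ((1/4) *\<^sub>R \<tau>) ((1/2) *s z) (?h m) =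
        of_real pi * \<i> * (cbil ?v (\<tau> *v ?v) + 2 * cbil ?v (z + half_char \<delta>))"
      unfolding theta_exponent_def qform_scaleR unfolding qform_def v ivec_bint
      by (simp add: cbil_simps vector_scalar_commute algebra_simps)
    finally show ?thesis by (simp only: Let_def)
  qed
  have "theta_series (char_coeff \<epsilon> \<delta>) ((1/4) *\<^sub>R \<tau>) ((1/2) *s z) = infsum ?f ?P"
    unfolding theta_series_def by (rule infsum_cong_neutral) (auto simp: char_coeff_def)
  also have "\<dots> = (\<Sum>\<^sub>\<infinity>m. ?f (?h m))"
    by (rule infsum_reindex_bij_betw[OF bij, symmetric])
  finally show ?thesis unfolding theta_def term_eq by simp
qed

text \<open>The derivative of the theta function at the origin in the direction \<^term>\<open>y\<close>, as a series that makes
  sense without symmetry of the matrix. So it can be differentiated in all matrix entries.\<close>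

definition theta_gradient_series :: "bool^'g \<Rightarrow> bool^'g \<Rightarrow> complex^'g^'g \<Rightarrow> complex^'g \<Rightarrow> complex" where
  "theta_gradient_series \<epsilon> \<delta> \<tau> y =
    theta_series (\<lambda>n. char_coeff \<epsilon> \<delta> n * (of_real pi * \<i> * cbil (ivec n) y)) ((1/4) *\<^sub>R \<tau>) 0"

lemma theta_line_derivative:
  assumes "\<tau> \<in> siegel_space"
  shows "((\<lambda>w. theta \<epsilon> \<delta> \<tau> (w *s y)) has_field_derivative theta_gradient_series \<epsilon> \<delta> \<tau> y) (at 0)"
proof -
  note pos = pos_im_quarter[OF assms]
  have arg: "(1/2) *s (w *s y) = 0 + w *s ((1/2) *s y)" for w by (simp add: vec_eq_iff)
  have coef: "char_coeff \<epsilon> \<delta> n * (2 * of_real pi * \<i> * cbil (ivec n) ((1/2) *s y)) =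
      char_coeff \<epsilon> \<delta> n * (of_real pi * \<i> * cbil (ivec n) y)" for n
    by (simp add: cbil_scale_right)
  show ?thesis
    using theta_series_line_derivative[OF pos poly_bounded_char_coeff, of \<epsilon> \<delta> 0 "(1/2) *s y" 0]
    unfolding theta_eq_theta_series arg coef theta_gradient_series_def by simp
qed

lemma theta_gradients_series:
  assumes "\<tau> \<in> siegel_space" "Rep_odd_char m = (\<epsilon>, \<delta>)"
  shows "theta_gradients \<tau> $ i $ m = theta_gradient_series \<epsilon> \<delta> \<tau> (axis i 1)"
proof -
  have "(\<lambda>w. theta \<epsilon> \<delta> \<tau> (axis i w)) = (\<lambda>w. theta \<epsilon> \<delta> \<tau> (w *s axis i 1))"
    by (intro ext arg_cong[of _ _ "theta \<epsilon> \<delta> \<tau>"]) (simp add: vec_eq_iff axis_def)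
  then show ?thesis
    using DERIV_imp_deriv[OF theta_line_derivative[OF assms(1), of \<epsilon> \<delta> "axis i 1"]] assms(2)
    by (simp add: theta_gradients_def)
qed

lemma theta_gradient_series_expand:
  assumes "\<tau> \<in> siegel_space"
  shows "theta_gradient_series \<epsilon> \<delta> \<tau> y = (\<Sum>i\<in>UNIV. y $ i * theta_gradient_series \<epsilon> \<delta> \<tau> (axis i 1))"
proof -
  note pos = pos_im_quarter[OF assms]
  have eq: "theta_gradient_series \<epsilon> \<delta> \<tau> y =
      theta_series (\<lambda>n. (of_real pi * \<i> * char_coeff \<epsilon> \<delta> n) * cbil (ivec n) y) ((1/4) *\<^sub>R \<tau>) 0" for y
    by (simp add: theta_gradient_series_def mult_ac)
  show ?thesis
    unfolding eq by (rule theta_series_cbil_expand[OF pos poly_bounded_cmult[OF poly_bounded_char_coeff]])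
qed

subsection \<open>Invariance of the space of gradients\<close>

text \<open>The quadratic exponential has derivative zero at the origin, so differentiating the transformation
  law there only transforms the direction linearly.\<close>

lemma theta_gradients_symplectic:
  fixes \<gamma> :: "int^('g::finite+'g)^('g+'g)" and \<tau> :: "complex^'g^'g"
  assumes \<gamma>: "\<gamma> \<in> Gamma2 4" and \<tau>: "\<tau> \<in> siegel_space"
  shows "\<exists>P. invertible P \<and> theta_gradients (siegel_act \<gamma> \<tau>) = P ** theta_gradients \<tau>"
proof -
  have sp: "\<gamma> \<in> Sp_int" using \<gamma> by (simp add: Gamma2_def Gamma_def)
  define X where "X = cmat (blk_c \<gamma>) ** \<tau> + cmat (blk_d \<gamma>)"
  note act = symplectic_action[OF sp \<tau> X_def]
  define W where "W = transpose (matrix_inv X)"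
  define S where "S = matrix_inv X ** cmat (blk_c \<gamma>)"
  obtain K where K: "K \<noteq> 0" "\<And>\<epsilon> \<delta> z. theta \<epsilon> \<delta> (siegel_act \<gamma> \<tau>) (W *v z) =
    K * exp (of_real pi * \<i> * cbil z (S *v z)) * theta \<epsilon> \<delta> \<tau> z"
    using theta_Gamma2[OF \<gamma> \<tau> X_def W_def S_def] by blast
  define P where "P = (\<chi> i j. K * X $ i $ j)"
  have inv: "invertible P"
  proof -
    define Q where "Q = (\<chi> i j. matrix_inv X $ i $ j / K)"
    have "P ** Q = X ** matrix_inv X" "Q ** P = matrix_inv X ** X"
      using K(1) by (simp_all add: P_def Q_def matrix_matrix_mult_def vec_eq_iff)
    then show ?thesis unfolding invertible_def act(1,2) by blast
  qed
  have entry: "theta_gradients (siegel_act \<gamma> \<tau>) $ i $ m = (P ** theta_gradients \<tau>) $ i $ m" for i m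
  proof -
    obtain \<epsilon> \<delta> where m: "Rep_odd_char m = (\<epsilon>, \<delta>)" by (cases "Rep_odd_char m")
    then have odd: "odd_pair (\<epsilon>, \<delta>)" using Rep_odd_char[of m] by simp
    define y where "y = transpose X *v axis i 1"
    have y: "y $ j = X $ i $ j" for j
      by (simp add: y_def matrix_vector_mult_def transpose_def axis_def if_distrib cong: if_cong)
    have "transpose (X ** matrix_inv X) = mat 1" by (simp add: act(1) transpose_mat)
    then have "W ** transpose X = mat 1" by (simp add: matrix_transpose_mul W_def)
    then have Wy: "W *v (w *s y) = w *s axis i 1" for w
      by (simp add: y_def vector_scalar_commute matrix_vector_mul_assoc)
    have eq: "theta \<epsilon> \<delta> (siegel_act \<gamma> \<tau>) (w *s axis i 1) =
        (K * exp (of_real pi * \<i> * (w\<^sup>2 * cbil y (S *v y)))) * theta \<epsilon> \<delta> \<tau> (w *s y)" for w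
      using K(2)[of \<epsilon> \<delta> "w *s y", unfolded Wy]
      by (simp add: vector_scalar_commute cbil_simps power2_eq_square mult_ac)
    have E: "((\<lambda>w. K * exp (of_real pi * \<i> * (w\<^sup>2 * cbil y (S *v y)))) has_field_derivative 0) (at 0)"
      by (auto intro!: derivative_eq_intros)
    have "((\<lambda>w. theta \<epsilon> \<delta> (siegel_act \<gamma> \<tau>) (w *s axis i 1)) has_field_derivative
        K * theta_gradient_series \<epsilon> \<delta> \<tau> y) (at 0)"
      unfolding eq using DERIV_mult[OF E theta_line_derivative[OF \<tau>, of \<epsilon> \<delta> y]] by (simp add: mult.commute[of K])
    from DERIV_unique[OF this theta_line_derivative[OF act(4)]]
    have "theta_gradient_series \<epsilon> \<delta> (siegel_act \<gamma> \<tau>) (axis i 1) = K * theta_gradient_series \<epsilon> \<delta> \<tau> y" by simp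
    also have "\<dots> = (\<Sum>j\<in>UNIV. P $ i $ j * theta_gradient_series \<epsilon> \<delta> \<tau> (axis j 1))"
      unfolding theta_gradient_series_expand[OF \<tau>, of \<epsilon> \<delta> y] by (simp add: P_def y sum_distrib_left mult_ac)
    finally show ?thesis
      by (simp add: theta_gradients_series[OF act(4) m] theta_gradients_series[OF \<tau> m] matrix_matrix_mult_def)
  qed
  show ?thesis using inv entry by (metis vec_eq_iff)
qed

lemma span_rows_mult_subset: "vec.span (rows (P ** G)) \<subseteq> vec.span (rows (G :: complex^'n^'g))"
proof (rule vec.span_minimal)
  show "rows (P ** G) \<subseteq> vec.span (rows G)"
  proof
    fix x assume "x \<in> rows (P ** G)"
    then obtain i where x: "x = row i (P ** G)" by (auto simp: rows_def)
    have "x = (\<Sum>j\<in>UNIV. P $ i $ j *s row j G)"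
      unfolding x by (simp add: vec_eq_iff row_def matrix_matrix_mult_def)
    also have "\<dots> \<in> vec.span (rows G)"
      by (intro vec.span_sum vec.span_scale vec.span_base) (auto simp: rows_def)
    finally show "x \<in> vec.span (rows G)" .
  qed
qed simp

lemma span_rows_invertible_mult:
  assumes "invertible P"
  shows "vec.span (rows (P ** G)) = vec.span (rows (G :: complex^'n^'g))"
proof
  obtain Q where "Q ** P = mat 1" using assms by (auto simp: invertible_def)
  then have "G = Q ** (P ** G)" by (simp add: matrix_mul_assoc)
  then show "vec.span (rows G) \<subseteq> vec.span (rows (P ** G))" by (metis span_rows_mult_subset)
qed (rule span_rows_mult_subset)

lemma grad_space_symplectic:
  assumes "\<gamma> \<in> Gamma2 4" "\<tau> \<in> siegel_space"
  shows "grad_space (siegel_act \<gamma> \<tau>) = grad_space \<tau>"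
proof -
  obtain P where "invertible P" "theta_gradients (siegel_act \<gamma> \<tau>) = P ** theta_gradients \<tau>"
    using theta_gradients_symplectic[OF assms] by blast
  then show ?thesis by (simp add: grad_space_def span_rows_invertible_mult)
qed

lemma mem_siegel_class:
  assumes "\<tau> \<in> siegel_space"
  shows "\<tau> \<in> siegel_class n \<tau>"
proof -
  have blocks: "blk_a (mat 1) = mat 1" "blk_b (mat 1) = 0" "blk_c (mat 1) = 0" "blk_d (mat 1) = mat 1"
    by (simp_all add: blk_a_def blk_b_def blk_c_def blk_d_def mat_def vec_eq_iff)
  have "mat 1 \<in> Gamma2 n"
    by (simp add: Gamma2_def Gamma_def Sp_int_def blocks transpose_mat)
      (simp add: matrix_matrix_mult_def transpose_def)
  moreover have "siegel_act (mat 1) \<tau> = \<tau>"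
  proof -
    have z: "cmat 0 = (0 :: complex^'a^'a)" by (simp add: cmat_def vec_eq_iff)
    have zm: "0 ** \<tau> = 0" by (simp add: matrix_matrix_mult_def vec_eq_iff)
    have "matrix_inv (mat 1) = (mat 1 :: complex^'a^'a)"
      using matrix_inv_inverse(1)[of "mat 1 :: complex^'a^'a"] by (simp add: invertible_def)
    then show ?thesis by (simp add: siegel_act_def blocks cmat_mat_1 z zm)
  qed
  ultimately have "\<exists>\<gamma>\<in>Gamma2 n. \<tau> = siegel_act \<gamma> \<tau>" by (intro bexI[of _ "mat 1"]) simp_all
  then show ?thesis using assms by (simp add: siegel_class_def siegel_rel_def)
qed

lemma siegel_class_4:
  assumes \<tau>: "\<tau> \<in> siegel_space" and t: "t \<in> siegel_class 4 \<tau>"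
  shows "t \<in> siegel_space" "grad_space t = grad_space \<tau>"
proof -
  obtain \<gamma> where \<gamma>: "\<gamma> \<in> Gamma2 4" "t = siegel_act \<gamma> \<tau>"
    using t by (auto simp: siegel_class_def siegel_rel_def)
  then have "\<gamma> \<in> Sp_int" by (simp add: Gamma2_def Gamma_def)
  then show "t \<in> siegel_space" using symplectic_action(4)[OF _ \<tau> refl] \<gamma>(2) by blast
  show "grad_space t = grad_space \<tau>" using grad_space_symplectic[OF \<gamma>(1) \<tau>] \<gamma>(2) by simp
qed

lemma PgrTh_siegel_class:
  assumes \<tau>: "\<tau> \<in> siegel_space"
  shows "PgrTh (siegel_class 4 \<tau>) = grad_space \<tau>"
proof -
  have "grad_space ` siegel_class 4 \<tau> = (\<lambda>_. grad_space \<tau>) ` siegel_class 4 \<tau>"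
    using siegel_class_4(2)[OF \<tau>] by (rule image_cong[OF refl])
  also have "\<dots> = {grad_space \<tau>}" using mem_siegel_class[OF \<tau>, of 4] by (rule image_constant)
  finally have "grad_space ` siegel_class 4 \<tau> = {grad_space \<tau>}" .
  then show ?thesis by (simp add: PgrTh_def)
qed

section \<open>Charts of the Grassmannian\<close>

text \<open>The square matrix of the columns that the chart normalizes.\<close>

definition chart_minor :: "('g \<Rightarrow> 'n) \<Rightarrow> complex^'n^'g \<Rightarrow> complex^'g^'g" where
  "chart_minor I G = (\<chi> i j. G $ i $ I j)"

lemma gr_normalized_iff: "gr_normalized I B \<longleftrightarrow> chart_minor I B = mat 1"
  by (simp add: gr_normalized_def chart_minor_def mat_def vec_eq_iff)

lemma chart_minor_mult: "chart_minor I (P ** G) = P ** chart_minor I G"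
  by (simp add: chart_minor_def matrix_matrix_mult_def vec_eq_iff)

lemma span_rows_eq_range: "vec.span (rows G) = range (\<lambda>k. transpose G *v k)"
  for G :: "complex^'n^'g"
proof
  have comb: "transpose G *v k = (\<Sum>i\<in>UNIV. k $ i *s row i G)" for k
    by (simp add: vec_eq_iff row_def transpose_def matrix_vector_mult_def mult.commute)
  show "range (\<lambda>k. transpose G *v k) \<subseteq> vec.span (rows G)"
    unfolding comb
    by (rule image_subsetI, rule vec.span_sum, rule vec.span_scale, rule vec.span_base) (auto simp: rows_def)
  show "vec.span (rows G) \<subseteq> range (\<lambda>k. transpose G *v k)"
  proof (rule vec.span_minimal)
    have "row i G = transpose G *v axis i 1" for i
      by (simp add: vec_eq_iff row_def transpose_def matrix_vector_mult_def axis_def if_distrib cong: if_cong)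
    then show "rows G \<subseteq> range (\<lambda>k. transpose G *v k)" by (auto simp: rows_def)
    show "vec.subspace (range (\<lambda>k. transpose G *v k))"
      unfolding vec.subspace_def
      by (auto simp flip: matrix_vector_right_distrib vector_scalar_commute
          intro: range_eqI[of _ _ 0] simp: matrix_vector_mult_0_right)
  qed
qed

lemma rows_in_span_factor:
  fixes B G :: "complex^'n^'g"
  assumes "rows B \<subseteq> vec.span (rows G)"
  shows "\<exists>P. B = P ** G"
proof -
  have "\<exists>k. row i B = transpose G *v k" for i
  proof -
    have "row i B \<in> rows B" by (auto simp: rows_def)
    then show ?thesis using assms unfolding span_rows_eq_range by blast
  qed
  then obtain k where k: "\<And>i. row i B = transpose G *v k i" by metis
  have "B = (\<chi> i. k i) ** G"
    using k by (simp add: vec_eq_iff row_def transpose_def matrix_vector_mult_def matrix_matrix_mult_def mult.commute)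
  then show ?thesis by blast
qed

text \<open>Matrices with the same row space differ by a factor on the left, which the columns chosen by the chart
  determine.\<close>

lemma chart_of_row_space:
  fixes G :: "complex^'n^'g"
  shows "vec.span (rows G) \<in> gr_chart_domain I \<longleftrightarrow> det (chart_minor I G) \<noteq> 0"
    and "det (chart_minor I G) \<noteq> 0 \<Longrightarrow>
      gr_chart I (vec.span (rows G)) = matrix_inv (chart_minor I G) ** G"
proof -
  let ?N = "chart_minor I G"
  have good: "gr_normalized I (matrix_inv ?N ** G)" "vec.span (rows (matrix_inv ?N ** G)) = vec.span (rows G)"
    if "det ?N \<noteq> 0"
  proof -
    have "invertible ?N" using that by (simp add: invertible_det_nz)
    from matrix_inv_inverse[OF this]
    have "matrix_inv ?N ** ?N = mat 1" "invertible (matrix_inv ?N)" by (auto simp: invertible_def)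
    then show "gr_normalized I (matrix_inv ?N ** G)" "vec.span (rows (matrix_inv ?N ** G)) = vec.span (rows G)"
      by (simp_all add: gr_normalized_iff chart_minor_mult span_rows_invertible_mult)
  qed
  have factor: "\<exists>P. B = P ** A" if "vec.span (rows B) = vec.span (rows A)" for A B :: "complex^'n^'g"
    using rows_in_span_factor vec.span_superset that by metis
  have nz: "det ?N \<noteq> 0" if B: "gr_normalized I B" "vec.span (rows B) = vec.span (rows G)" for B
  proof -
    obtain P where "B = P ** G" using factor[OF B(2)] by blast
    then have "P ** ?N = mat 1" using B(1) by (simp add: gr_normalized_iff chart_minor_mult)
    then have "invertible ?N" using invertible_left_inverse by blast
    then show ?thesis by (simp add: invertible_det_nz)
  qed
  show "vec.span (rows G) \<in> gr_chart_domain I \<longleftrightarrow> det ?N \<noteq> 0"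
    unfolding gr_chart_domain_def using nz good by blast
  assume d: "det ?N \<noteq> 0"
  show "gr_chart I (vec.span (rows G)) = matrix_inv ?N ** G"
    unfolding gr_chart_def
  proof (rule the_equality)
    show "gr_normalized I (matrix_inv ?N ** G) \<and> vec.span (rows (matrix_inv ?N ** G)) = vec.span (rows G)"
      using good[OF d] by blast
    fix B assume B: "gr_normalized I B \<and> vec.span (rows B) = vec.span (rows G)"
    obtain P where P: "B = P ** (matrix_inv ?N ** G)"
      using factor[of B "matrix_inv ?N ** G"] B good[OF d] by auto
    have "chart_minor I B = P ** chart_minor I (matrix_inv ?N ** G)" unfolding P chart_minor_mult ..
    then have "P = mat 1" using B good(1)[OF d] by (simp add: gr_normalized_iff)
    then show "B = matrix_inv ?N ** G" using P by simp
  qed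
qed

lemma dim_row_space:
  fixes G :: "complex^'n^'g"
  assumes "\<And>k. transpose G *v k = 0 \<Longrightarrow> k = 0"
  shows "vec.dim (vec.span (rows G)) = CARD('g)"
proof -
  have "inj (\<lambda>k. transpose G *v k)"
  proof (rule injI)
    fix x y assume "transpose G *v x = transpose G *v y"
    then have "transpose G *v (x - y) = 0" by (simp add: matrix_vector_mult_diff_distrib)
    then show "x = y" using assms by fastforce
  qed
  then show ?thesis
    unfolding span_rows_eq_range
    using vec.dim_image_eq[OF matrix_vector_mul_linear_gen[of "transpose G"], of UNIV]
    unfolding vec_dim_card by simp
qed

subsection \<open>Differentiating normalized matrices\<close>

lemma has_derivative_vec_lambda:
  fixes f :: "'n::finite \<Rightarrow> 'a::real_normed_vector \<Rightarrow> 'b::real_normed_vector"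
  assumes "\<And>i. (f i has_derivative f' i) F"
  shows "((\<lambda>t. \<chi> i. f i t) has_derivative (\<lambda>h. \<chi> i. f' i h)) F"
proof -
  have norm_axis: "norm (axis i x :: 'b^'n) = norm x" for i x
    by (simp add: norm_vec_def L2_set_def axis_def if_distrib[of norm] if_distrib[of "\<lambda>x. x\<^sup>2"] cong: if_cong)
  have ax: "bounded_linear (axis i :: 'b \<Rightarrow> 'b^'n)" for i
    by (rule bounded_linear_intro[where K = 1]) (simp_all only: norm_axis mult_1_right order_refl, simp_all add: vec_eq_iff axis_def)
  have eq: "(\<chi> i. x i) = (\<Sum>i\<in>UNIV. axis i (x i))" for x :: "'n \<Rightarrow> 'b"
    by (simp add: vec_eq_iff axis_def)
  show ?thesis unfolding eq
    by (intro has_derivative_sum bounded_linear.has_derivative[OF ax] assms)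
qed

lemma differentiable_det:
  fixes N :: "'a::real_normed_vector \<Rightarrow> complex^'g^'g"
  assumes "\<And>i j. (\<lambda>t. N t $ i $ j) differentiable (at x)"
  shows "(\<lambda>t. det (N t)) differentiable (at x)"
proof -
  obtain D where "\<And>i j. ((\<lambda>t. N t $ i $ j) has_derivative D i j) (at x)"
    using assms unfolding differentiable_def by metis
  then have "(\<lambda>t. \<Prod>i\<in>UNIV. N t $ i $ p i) differentiable (at x)" for p
    unfolding differentiable_def by (intro exI) (rule has_derivative_prod)
  then show ?thesis
    unfolding det_def by (intro differentiable_sum differentiable_mult) (auto simp: finite_permutations)
qed

text \<open>Cramer's rule gives differentiability. The derivative itself is described by differentiating the equation
  that defines the inverse, which avoids derivatives of determinants.\<close>

lemma has_derivative_inverse_mult: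
  fixes N :: "'a::real_normed_vector \<Rightarrow> complex^'g^'g" and G :: "'a \<Rightarrow> complex^'n^'g"
  assumes N: "\<And>i j. ((\<lambda>t. N t $ i $ j) has_derivative N' i j) (at x)"
    and G: "\<And>i m. ((\<lambda>t. G t $ i $ m) has_derivative G' i m) (at x)"
    and d: "det (N x) \<noteq> 0"
  shows "\<forall>\<^sub>F t in at x. det (N t) \<noteq> 0"
    and "\<exists>D. ((\<lambda>t. matrix_inv (N t) ** G t) has_derivative D) (at x) \<and>
      (\<forall>\<eta> i m. G' i m \<eta> = (\<Sum>j\<in>UNIV. N' i j \<eta> * (matrix_inv (N x) ** G x) $ j $ m + N x $ i $ j * D \<eta> $ j $ m))"
proof -
  let ?B = "\<lambda>t. matrix_inv (N t) ** G t"
  have diff: "(\<lambda>t. det (N t)) differentiable (at x)"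
    by (rule differentiable_det) (use N in \<open>auto simp: differentiable_def\<close>)
  then have "isCont (\<lambda>t. det (N t)) x"
    by (metis differentiable_def has_derivative_continuous)
  then have tend: "((\<lambda>t. det (N t)) \<longlongrightarrow> det (N x)) (at x)" by (simp add: isCont_def)
  show ev: "\<forall>\<^sub>F t in at x. det (N t) \<noteq> 0" by (rule tendsto_imp_eventually_ne[OF tend d])
  define C where "C = (\<lambda>j m t. det (\<chi> i k. if k = j then G t $ i $ m else N t $ i $ k) / det (N t))"
  have NB: "N t ** ?B t = G t" and BC: "?B t $ j $ m = C j m t" if "det (N t) \<noteq> 0" for t j m
  proof -
    have "N t ** matrix_inv (N t) = mat 1" using that by (intro matrix_inv_inverse) (simp add: invertible_det_nz)
    then show NB: "N t ** ?B t = G t" by (simp add: matrix_mul_assoc)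
    have "N t *v (\<chi> j. ?B t $ j $ m) = (\<chi> i. G t $ i $ m)"
      using arg_cong[OF NB, of "\<lambda>M. \<chi> i. M $ i $ m"]
      by (simp add: matrix_vector_mult_def matrix_matrix_mult_def)
    then have "(\<chi> j. ?B t $ j $ m) = (\<chi> k. det (\<chi> i j. if j = k then (\<chi> i. G t $ i $ m) $ i else N t $ i $ j) / det (N t))"
      using cramer[OF that] by blast
    from arg_cong[OF this, of "\<lambda>v. v $ j"] show "?B t $ j $ m = C j m t"
      by (simp add: C_def cong: if_cong)
  qed
  have "C j m differentiable (at x)" for j m
  proof -
    have "(\<lambda>t. (\<chi> i k. if k = j then G t $ i $ m else N t $ i $ k) $ i $ k) differentiable (at x)" for i k
      using differentiableI[OF N] differentiableI[OF G] by (cases "k = j") simp_all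
    then show ?thesis unfolding C_def by (intro differentiable_divide differentiable_det diff d)
  qed
  then obtain D where D: "\<And>j m. (C j m has_derivative D j m) (at x)"
    unfolding differentiable_def by metis
  have "((\<lambda>t. \<chi> j m. C j m t) has_derivative (\<lambda>\<eta>. \<chi> j m. D j m \<eta>)) (at x)"
    by (intro has_derivative_vec_lambda D)
  then have DB: "(?B has_derivative (\<lambda>\<eta>. \<chi> j m. D j m \<eta>)) (at x)"
    by (rule has_derivative_transform_eventually)
      (use ev BC d in \<open>auto simp: vec_eq_iff elim!: eventually_mono\<close>)
  have prod: "((\<lambda>t. \<Sum>j\<in>UNIV. N t $ i $ j * C j m t) has_derivative
      (\<lambda>\<eta>. \<Sum>j\<in>UNIV. N x $ i $ j * D j m \<eta> + N' i j \<eta> * C j m x)) (at x)" for i m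
    by (intro has_derivative_sum has_derivative_mult N D)
  have prodG: "(\<Sum>j\<in>UNIV. N t $ i $ j * C j m t) = G t $ i $ m" if "det (N t) \<noteq> 0" for t i m
    using arg_cong[OF NB[OF that], of "\<lambda>M. M $ i $ m"] by (simp add: matrix_matrix_mult_def BC[OF that, symmetric])
  have "((\<lambda>t. G t $ i $ m) has_derivative
      (\<lambda>\<eta>. \<Sum>j\<in>UNIV. N x $ i $ j * D j m \<eta> + N' i j \<eta> * C j m x)) (at x)" for i m
    by (rule has_derivative_transform_eventually[OF prod])
      (use ev prodG d in \<open>auto elim!: eventually_mono\<close>)
  from has_derivative_unique[OF G this]
  have "G' i m \<eta> = (\<Sum>j\<in>UNIV. N x $ i $ j * D j m \<eta> + N' i j \<eta> * C j m x)" for i m \<eta> by metis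
  then have "G' i m \<eta> = (\<Sum>j\<in>UNIV. N' i j \<eta> * ?B x $ j $ m + N x $ i $ j * (\<chi> j m. D j m \<eta>) $ j $ m)" for i m \<eta>
    by (simp add: BC[OF d] add.commute)
  then show "\<exists>D. (?B has_derivative D) (at x) \<and>
      (\<forall>\<eta> i m. G' i m \<eta> = (\<Sum>j\<in>UNIV. N' i j \<eta> * ?B x $ j $ m + N x $ i $ j * D \<eta> $ j $ m))"
    using DB by blast
qed

section \<open>The differential\<close>

text \<open>Extends \<^const>\<open>theta_gradients\<close> to matrices that need not be symmetric, so that derivatives can be taken
  on an open set and are unique.\<close>

definition gradient_matrix :: "complex^'g^'g \<Rightarrow> complex^('g odd_char)^'g" where
  "gradient_matrix \<tau> = (\<chi> i m. theta_gradient_series (fst (Rep_odd_char m)) (snd (Rep_odd_char m)) \<tau> (axis i 1))"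

lemma theta_gradients_eq_gradient_matrix:
  assumes "\<tau> \<in> siegel_space"
  shows "theta_gradients \<tau> = gradient_matrix \<tau>"
  using theta_gradients_series[OF assms prod.collapse[symmetric]]
  by (simp add: vec_eq_iff gradient_matrix_def)

lemma gradient_matrix_combination:
  assumes \<tau>: "\<tau> \<in> siegel_space" and m: "Rep_odd_char m = (\<epsilon>, \<delta>)"
  shows "(\<Sum>i\<in>UNIV. k $ i * gradient_matrix \<tau> $ i $ m) =
    of_real pi * \<i> * theta_series (\<lambda>n. char_coeff \<epsilon> \<delta> n * cbil (ivec n) k) ((1/4) *\<^sub>R \<tau>) 0"
proof -
  have "char_coeff \<epsilon> \<delta> n * (of_real pi * \<i> * cbil (ivec n) k) = of_real pi * \<i> * (char_coeff \<epsilon> \<delta> n * cbil (ivec n) k)" for n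
    by (simp only: mult_ac)
  then have "theta_gradient_series \<epsilon> \<delta> \<tau> k =
      of_real pi * \<i> * theta_series (\<lambda>n. char_coeff \<epsilon> \<delta> n * cbil (ivec n) k) ((1/4) *\<^sub>R \<tau>) 0"
    unfolding theta_gradient_series_def by (simp only: theta_series_cmult)
  then show ?thesis
    using theta_gradient_series_expand[OF \<tau>, of \<epsilon> \<delta> k] by (simp add: gradient_matrix_def m)
qed

lemma odd_charE:
  assumes "odd_pair (\<epsilon>, \<delta>)"
  obtains m where "Rep_odd_char m = (\<epsilon>, \<delta>)"
  using assms by (metis Abs_odd_char_inverse mem_Collect_eq)

text \<open>A relation between the rows is a tangent vector that kills all odd characteristics.\<close>

lemma gradient_matrix_full_rank:
  assumes \<tau>: "\<tau> \<in> siegel_space" and k: "transpose (gradient_matrix \<tau>) *v k = 0"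
  shows "k = 0"
proof (rule order_four_separates_tangent_vectors[OF \<tau>])
  fix c :: "int^'a \<Rightarrow> complex" assume c: "lattice_periodic 4 c"
  note pos = pos_im_quarter[OF \<tau>]
  show "theta_series (\<lambda>n. c n * cbil (ivec n) k) ((1/4) *\<^sub>R \<tau>) 0 = 0"
  proof (rule vanishing_on_characteristics[OF pos poly_bounded_cbil _ _ c])
    fix \<epsilon> \<delta> :: "bool^'a" assume "odd_pair (\<epsilon>, \<delta>)"
    then obtain m where m: "Rep_odd_char m = (\<epsilon>, \<delta>)" by (rule odd_charE)
    have "(\<Sum>i\<in>UNIV. k $ i * gradient_matrix \<tau> $ i $ m) = (transpose (gradient_matrix \<tau>) *v k) $ m"
      by (simp add: matrix_vector_mult_def transpose_def mult.commute)
    then show "theta_series (\<lambda>n. char_coeff \<epsilon> \<delta> n * cbil (ivec n) k) ((1/4) *\<^sub>R \<tau>) 0 = 0"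
      unfolding gradient_matrix_combination[OF \<tau> m] k by simp
  qed (simp add: cbil_minus_left)
qed

lemma grad_space_in_grassmannian:
  fixes \<tau> :: "complex^'g^'g"
  assumes "\<tau> \<in> siegel_space"
  shows "grad_space \<tau> \<in> grassmannian CARD('g)"
  using dim_row_space[OF gradient_matrix_full_rank[OF assms]]
  by (simp add: grassmannian_def grad_space_def theta_gradients_eq_gradient_matrix[OF assms])

text \<open>The heat equation at the origin.\<close>

lemma gradient_matrix_has_derivative:
  assumes \<tau>: "\<tau> \<in> siegel_space" and m: "Rep_odd_char m = (\<epsilon>, \<delta>)"
  shows "((\<lambda>t. gradient_matrix t $ i $ m) has_derivative (\<lambda>\<eta>. (of_real pi * \<i>)\<^sup>2 / 4 *
    theta_series (\<lambda>n. char_coeff \<epsilon> \<delta> n * (qform \<eta> n * cbil (ivec n) (axis i 1))) ((1/4) *\<^sub>R \<tau>) 0)) (at \<tau>)"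
proof -
  note pos = pos_im_quarter[OF \<tau>]
  let ?c = "\<lambda>n. char_coeff \<epsilon> \<delta> n * (of_real pi * \<i> * cbil (ivec n) (axis i 1))"
  have pb: "poly_bounded ?c"
    by (intro poly_bounded_mult poly_bounded_char_coeff poly_bounded_cbil poly_bounded_const)
  have "((\<lambda>t. (1/4) *\<^sub>R t) has_derivative (\<lambda>\<eta>. (1/4) *\<^sub>R \<eta>)) (at \<tau>)"
    by (auto intro!: derivative_eq_intros)
  from has_derivative_compose[OF this theta_series_has_derivative_matrix[OF pos pb, of 0]]
  have "((\<lambda>t. theta_series ?c ((1/4) *\<^sub>R t) 0) has_derivative
      (\<lambda>\<eta>. theta_series (\<lambda>n. ?c n * (of_real pi * \<i> * qform ((1/4) *\<^sub>R \<eta>) n)) ((1/4) *\<^sub>R \<tau>) 0)) (at \<tau>)" .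
  moreover have "?c n * (of_real pi * \<i> * qform ((1/4) *\<^sub>R \<eta>) n) =
      (of_real pi * \<i>)\<^sup>2 / 4 * (char_coeff \<epsilon> \<delta> n * (qform \<eta> n * cbil (ivec n) (axis i 1)))" for n \<eta>
    by (simp add: qform_scaleR power2_eq_square)
  ultimately show ?thesis
    by (simp only: theta_series_cmult gradient_matrix_def vec_lambda_beta m fst_conv snd_conv
        theta_gradient_series_def)
qed

text \<open>If the rows move inside their span, then along \<^term>\<open>\<eta>\<close> the third order terms of all odd theta functions at
  the origin are combinations of their gradients, which is the situation of a divisible cubic symbol.\<close>

lemma gradient_derivative_injective:
  fixes \<tau> \<eta> A :: "complex^'g^'g"
  assumes g: "2 \<le> CARD('g)" and \<tau>: "\<tau> \<in> siegel_space" and sym: "transpose \<eta> = \<eta>"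
    and G': "\<And>i m. ((\<lambda>t. gradient_matrix t $ i $ m) has_derivative G' i m) (at \<tau>)"
    and rel: "\<And>i m. G' i m \<eta> = (A ** gradient_matrix \<tau>) $ i $ m"
  shows "\<eta> = 0"
proof (rule order_four_no_divisible_cubic_symbol[OF g \<tau> sym])
  fix i :: 'g
  let ?\<kappa> = "(of_real pi * \<i>)\<^sup>2 / 4 :: complex"
  let ?T = "\<lambda>c. theta_series c ((1/4) *\<^sub>R \<tau>) 0"
  note pos = pos_im_quarter[OF \<tau>]
  define b where "b = (4 / (of_real pi * \<i>)) *s A $ i"
  define P where "P = (\<lambda>n. qform \<eta> n * cbil (ivec n) (axis i 1) - cbil (ivec n) b)"
  have pbP: "poly_bounded P" unfolding P_def
    by (intro poly_bounded_diff poly_bounded_mult poly_bounded_qform poly_bounded_cbil)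
  have "\<forall>c. lattice_periodic 4 c \<longrightarrow> ?T (\<lambda>n. c n * P n) = 0"
  proof (intro allI impI)
    fix c :: "int^'g \<Rightarrow> complex" assume c: "lattice_periodic 4 c"
    show "?T (\<lambda>n. c n * P n) = 0"
    proof (rule vanishing_on_characteristics[OF pos pbP _ _ c])
      show "P (- n) = - P n" for n by (simp add: P_def qform_def cbil_simps matrix_vector_mult_uminus)
      fix \<epsilon> \<delta> :: "bool^'g" assume "odd_pair (\<epsilon>, \<delta>)"
      then obtain m where m: "Rep_odd_char m = (\<epsilon>, \<delta>)" by (rule odd_charE)
      have "?\<kappa> * ?T (\<lambda>n. char_coeff \<epsilon> \<delta> n * (qform \<eta> n * cbil (ivec n) (axis i 1))) = G' i m \<eta>"
        using has_derivative_unique[OF G' gradient_matrix_has_derivative[OF \<tau> m, of i]] by metis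
      also have "\<dots> = of_real pi * \<i> * ?T (\<lambda>n. char_coeff \<epsilon> \<delta> n * cbil (ivec n) (A $ i))"
        unfolding rel gradient_matrix_combination[OF \<tau> m, symmetric] by (simp add: matrix_matrix_mult_def)
      also have "\<dots> = ?\<kappa> * (4 / (of_real pi * \<i>) * ?T (\<lambda>n. char_coeff \<epsilon> \<delta> n * cbil (ivec n) (A $ i)))"
        by (simp add: power2_eq_square)
      also have "\<dots> = ?\<kappa> * ?T (\<lambda>n. char_coeff \<epsilon> \<delta> n * cbil (ivec n) b)"
        unfolding b_def theta_series_cmult[symmetric] cbil_scale_right by (simp only: mult.left_commute)
      finally have "?T (\<lambda>n. char_coeff \<epsilon> \<delta> n * (qform \<eta> n * cbil (ivec n) (axis i 1))) =
          ?T (\<lambda>n. char_coeff \<epsilon> \<delta> n * cbil (ivec n) b)" by simp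
      then show "?T (\<lambda>n. char_coeff \<epsilon> \<delta> n * P n) = 0"
        unfolding P_def right_diff_distrib
        by (subst theta_series_diff[OF pos])
          (auto intro!: poly_bounded_mult poly_bounded_char_coeff poly_bounded_qform poly_bounded_cbil)
    qed
  qed
  then show "\<exists>b. \<forall>c. lattice_periodic 4 c \<longrightarrow> theta_series
      (\<lambda>n. c n * (qform \<eta> n * cbil (ivec n) (axis i 1) - cbil (ivec n) b)) ((1/4) *\<^sub>R \<tau>) 0 = 0"
    unfolding P_def by (rule exI[of _ b])
qed

text \<open>If the derivative of the normalized matrix vanishes in a direction, the gradient matrix moves in this
  direction by a factor on the left.\<close>

lemma injective_differential_at_PgrTh:
  fixes \<tau> :: "complex^'g^'g" and I :: "'g \<Rightarrow> 'g odd_char"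
  assumes g: "2 \<le> CARD('g)" and \<tau>: "\<tau> \<in> siegel_space" and dom: "grad_space \<tau> \<in> gr_chart_domain I"
  shows "\<forall>\<^sub>F t in at \<tau> within siegel_space. PgrTh (siegel_class 4 t) \<in> gr_chart_domain I"
    and "\<exists>D. ((\<lambda>t. gr_chart I (PgrTh (siegel_class 4 t))) has_derivative D) (at \<tau> within siegel_space)
      \<and> inj_on D {\<eta>. transpose \<eta> = \<eta>}"
proof -
  let ?G = "gradient_matrix :: complex^'g^'g \<Rightarrow> _" and ?N = "\<lambda>t. chart_minor I (gradient_matrix t)"
  have space: "PgrTh (siegel_class 4 t) = vec.span (rows (?G t))" if "t \<in> siegel_space" for t
    using that by (simp add: PgrTh_siegel_class grad_space_def theta_gradients_eq_gradient_matrix)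
  have chart: "PgrTh (siegel_class 4 t) \<in> gr_chart_domain I \<longleftrightarrow> det (?N t) \<noteq> 0"
    "det (?N t) \<noteq> 0 \<Longrightarrow> gr_chart I (PgrTh (siegel_class 4 t)) = matrix_inv (?N t) ** ?G t"
    if "t \<in> siegel_space" for t
    unfolding space[OF that] by (rule chart_of_row_space)+
  have d: "det (?N \<tau>) \<noteq> 0" using dom chart(1)[OF \<tau>] by (simp add: PgrTh_siegel_class[OF \<tau>])
  have "\<exists>D. ((\<lambda>t. ?G t $ i $ m) has_derivative D) (at \<tau>)" for i m
    using gradient_matrix_has_derivative[OF \<tau>, of m "fst (Rep_odd_char m)" "snd (Rep_odd_char m)" i] by auto
  then obtain G' where G': "\<And>i m. ((\<lambda>t. ?G t $ i $ m) has_derivative G' i m) (at \<tau>)" by metis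
  have N': "((\<lambda>t. ?N t $ i $ j) has_derivative G' i (I j)) (at \<tau>)" for i j
    using G' by (simp add: chart_minor_def)
  note inverse = has_derivative_inverse_mult[where N = ?N and G = ?G, OF N' G' d]
  obtain D where D: "((\<lambda>t. matrix_inv (?N t) ** ?G t) has_derivative D) (at \<tau>)"
    "\<And>\<eta> i m. G' i m \<eta> = (\<Sum>j\<in>UNIV. G' i (I j) \<eta> * (matrix_inv (?N \<tau>) ** ?G \<tau>) $ j $ m + ?N \<tau> $ i $ j * D \<eta> $ j $ m)"
    using inverse(2) by blast
  have ev: "\<forall>\<^sub>F t in at \<tau> within siegel_space. t \<in> siegel_space \<and> det (?N t) \<noteq> 0"
    using filter_leD[OF at_le[OF subset_UNIV] inverse(1)]
    by (intro eventually_conj) (auto simp: eventually_at_filter)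
  then show "\<forall>\<^sub>F t in at \<tau> within siegel_space. PgrTh (siegel_class 4 t) \<in> gr_chart_domain I"
    by (rule eventually_mono) (simp add: chart(1))
  have deriv: "((\<lambda>t. gr_chart I (PgrTh (siegel_class 4 t))) has_derivative D) (at \<tau> within siegel_space)"
  proof (rule has_derivative_transform_eventually[OF has_derivative_at_withinI[OF D(1)]])
    show "\<forall>\<^sub>F t in at \<tau> within siegel_space. matrix_inv (?N t) ** ?G t = gr_chart I (PgrTh (siegel_class 4 t))"
      using ev by (rule eventually_mono) (simp add: chart(2))
  qed (use \<tau> d chart(2) in auto)
  have kernel: "\<eta> = 0" if "transpose \<eta> = \<eta>" "D \<eta> = 0" for \<eta>
  proof (rule gradient_derivative_injective[OF g \<tau> that(1) G'])
    show "G' i m \<eta> = (((\<chi> i j. G' i (I j) \<eta>) ** matrix_inv (?N \<tau>)) ** ?G \<tau>) $ i $ m" for i m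
      unfolding matrix_mul_assoc[symmetric] using D(2)[of i m \<eta>]
      by (simp add: that(2) matrix_matrix_mult_def[of "\<chi> i j. G' i (I j) \<eta>"])
  qed
  have "inj_on D {\<eta>. transpose \<eta> = \<eta>}"
  proof (rule inj_onI)
    fix x y assume xy: "x \<in> {\<eta>. transpose \<eta> = \<eta>}" "y \<in> {\<eta>. transpose \<eta> = \<eta>}" "D x = D y"
    have "transpose (x - y) = transpose x - transpose y" by (simp add: transpose_def vec_eq_iff)
    then have "transpose (x - y) = x - y" using xy(1,2) by simp
    moreover have "D (x - y) = 0"
      using linear_diff[OF has_derivative_linear[OF D(1)], of x y] xy(3) by simp
    ultimately have "x - y = 0" by (rule kernel)
    then show "x = y" by simp
  qed
  then show "\<exists>D. ((\<lambda>t. gr_chart I (PgrTh (siegel_class 4 t))) has_derivative D) (at \<tau> within siegel_space)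
      \<and> inj_on D {\<eta>. transpose \<eta> = \<eta>}"
    using deriv by blast
qed

theorem theorem3:
  assumes "2 \<le> CARD('g::finite)"
  shows "PgrTh \<in> (siegel_quotient 4 :: (complex^'g^'g) set set) \<rightarrow> grassmannian CARD('g) \<and>
    (\<forall>p \<in> (siegel_quotient 4 :: (complex^'g^'g) set set). injective_differential_at 4 PgrTh p)"
proof -
  have classE: "\<exists>\<tau>\<in>siegel_space. p = siegel_class 4 \<tau>" if "p \<in> siegel_quotient 4" for p :: "(complex^'g^'g) set"
    using that by (auto simp: siegel_quotient_def quotient_def siegel_class_def)
  show ?thesis
  proof (intro conjI ballI funcsetI)
    fix p :: "(complex^'g^'g) set" assume "p \<in> siegel_quotient 4"
    then obtain \<sigma> where \<sigma>: "\<sigma> \<in> siegel_space" "p = siegel_class 4 \<sigma>" using classE by blast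
    then show "PgrTh p \<in> grassmannian CARD('g)"
      by (simp add: PgrTh_siegel_class grad_space_in_grassmannian)
    show "injective_differential_at 4 PgrTh p"
      unfolding injective_differential_at_def
    proof (intro ballI allI impI)
      fix \<tau> and I :: "'g \<Rightarrow> 'g odd_char"
      assume \<tau>: "\<tau> \<in> p" and dom: "PgrTh p \<in> gr_chart_domain I"
      have \<tau>': "\<tau> \<in> siegel_space" and eq: "grad_space \<tau> = grad_space \<sigma>"
        using siegel_class_4[OF \<sigma>(1)] \<tau> unfolding \<sigma>(2) by blast+
      have "grad_space \<tau> \<in> gr_chart_domain I" using dom by (simp add: eq \<sigma> PgrTh_siegel_class)
      then show "(\<forall>\<^sub>F t in at \<tau> within siegel_space. PgrTh (siegel_class 4 t) \<in> gr_chart_domain I) \<and>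
        (\<exists>D. ((\<lambda>t. gr_chart I (PgrTh (siegel_class 4 t))) has_derivative D) (at \<tau> within siegel_space)
             \<and> inj_on D {\<eta>. transpose \<eta> = \<eta>})"
        using injective_differential_at_PgrTh[OF assms \<tau>'] by blast
    qed
  qed
qed

end
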